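(* Let $C$ be a field of characteristic $p$ and $D$ a central division algebra over $C$ of degree $d$. Let $\delta$ be a derivation of $D$ such that $\delta|_C$ is algebraic with minimum polynomial $g(t)=t^{p^e}+c_1t^{p^{e-1}}+\dots+c_et\in F[t]$ of degree $p^e$, where $F={\rm Const}(\delta)\cap C$. Let $d_0\in D$ satisfy $g(\delta)(z)=d_0z-zd_0$ for all $z\in D$ and $\delta(d_0)=0$. Let $R=D[t;\delta]$ and $x=g(t)-d_0$, and let $N$ be the reduced norm of the central simple $F(x)$-algebra $D(t;\delta)$. Let $f\in R$ be a polynomial of degree $m$, let $h(t)=\hat h(g(t)-d_0)$ with $\hat h\in F[x]$ monic be its minimal central left multiple, and suppose that $\deg(\hat h)=dm$ (degree in $x$). (i) If $\hat h$ is irreducible in $F[x]$, then $f$ is irreducible in $R$. (ii) If $f$ is irreducible in $R$, then $N(f)$ is irreducible in $F[x]$.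
   Context: ${\rm Const}(\delta)=\{a\in D:\delta(a)=0\}$. $D[t;\delta]$ is the ring of polynomials $\sum a_it^i$, $a_i\in D$, with $ta=at+\delta(a)$ for $a\in D$. Its center is $C(R)=F[x]$, $x=g(t)-d_0$. The ring of central quotients $D(t;\delta)=\{f/q: f\in R,\ 0\ne q\in F[x]\}$ is a central simple algebra of degree $p^ed$ over $F(x)$; $N$ is its reduced norm, and $N(f)\in F[x]$ for $f\in R$. An element $f\in R$ is irreducible if it is not a unit and is not a product $qr$ with $q,r\in R$ and $1\le\deg q,\deg r<\deg f$. The minimal central left multiple of $f\neq0$ is the unique polynomial $h\in C(R)$ of minimal degree such that $h=qf$ for some $q\in R$ and $h(t)=\hat h(g(t)-d_0)$ with $\hat h\in F[x]$ monic. *)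

theory Defs
  imports
    "HOL-Algebra.Algebraic_Closure_Type"
    "Jordan_Normal_Form.Determinant"
begin

section \<open>Division algebras with a derivation\<close>

definition ring_center :: "('r, 'm) ring_scheme \<Rightarrow> 'r set" where
  "ring_center R = {z \<in> carrier R. \<forall>y \<in> carrier R. z \<otimes>\<^bsub>R\<^esub> y = y \<otimes>\<^bsub>R\<^esub> z}"

text \<open>The division algebra \<open>D\<close> is the type \<open>'a\<close>, with base field \<open>C\<close> its center.\<close>

abbreviation base_field :: "'a::division_ring set" where
  "base_field \<equiv> ring_center ring_of_type_algebra"

definition central_division_algebra_degree :: "'a::division_ring itself \<Rightarrow> nat \<Rightarrow> bool" where
  "central_division_algebra_degree _ d \<longleftrightarrow>
     ring.dimension (ring_of_type_algebra :: 'a ring) (d\<^sup>2) base_field UNIV"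

definition derivation :: "('a::division_ring \<Rightarrow> 'a) \<Rightarrow> bool" where
  "derivation \<delta> \<longleftrightarrow>
     (\<forall>a b. \<delta> (a + b) = \<delta> a + \<delta> b) \<and> (\<forall>a b. \<delta> (a * b) = \<delta> a * b + a * \<delta> b)"

definition Const :: "('a::division_ring \<Rightarrow> 'a) \<Rightarrow> 'a set" where
  "Const \<delta> = {a. \<delta> a = 0}"

definition const_field :: "('a::division_ring \<Rightarrow> 'a) \<Rightarrow> 'a set" where
  "const_field \<delta> = Const \<delta> \<inter> base_field"

definition polys_over :: "'a::zero set \<Rightarrow> 'a poly set" where
  "polys_over S = {q. \<forall>i. coeff q i \<in> S}"

text \<open>The operator \<open>q(\<delta>)\<close> on \<open>D\<close>.\<close>

definition poly_in_der :: "'a::division_ring poly \<Rightarrow> ('a \<Rightarrow> 'a) \<Rightarrow> 'a \<Rightarrow> 'a" where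
  "poly_in_der q \<delta> z = (\<Sum>i\<le>degree q. coeff q i * (\<delta> ^^ i) z)"

definition min_poly_der :: "('a::division_ring \<Rightarrow> 'a) \<Rightarrow> 'a poly \<Rightarrow> bool" where
  "min_poly_der \<delta> g \<longleftrightarrow>
     g \<in> polys_over (const_field \<delta>) \<and> lead_coeff g = 1 \<and>
     (\<forall>z \<in> base_field. poly_in_der g \<delta> z = 0) \<and>
     (\<forall>q \<in> polys_over (const_field \<delta>).
        q \<noteq> 0 \<and> (\<forall>z \<in> base_field. poly_in_der q \<delta> z = 0) \<longrightarrow> degree g \<le> degree q)"


section \<open>The ring of differential polynomials\<close>

text \<open>
  Elements of \<open>D[t;\<delta>]\<close> are stored as their left coefficients \<open>\<Sum> a\<^sub>i t\<^sup>i\<close>. Since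
  \<open>t b = b t + \<delta> b\<close>, left multiplication by \<open>t\<close> shifts the coefficients and adds the
  coefficientwise image under \<open>\<delta>\<close>.
\<close>

definition skew_t :: "('a::division_ring \<Rightarrow> 'a) \<Rightarrow> 'a poly \<Rightarrow> 'a poly" where
  "skew_t \<delta> q = pCons 0 q + map_poly \<delta> q"

definition skew_mult :: "('a::division_ring \<Rightarrow> 'a) \<Rightarrow> 'a poly \<Rightarrow> 'a poly \<Rightarrow> 'a poly" where
  "skew_mult \<delta> f q = (\<Sum>i\<le>degree f. map_poly ((*) (coeff f i)) ((skew_t \<delta> ^^ i) q))"

definition skew_poly_ring :: "('a::division_ring \<Rightarrow> 'a) \<Rightarrow> 'a poly ring" where
  "skew_poly_ring \<delta> =
     \<lparr>carrier = UNIV, monoid.mult = skew_mult \<delta>, one = [:1:], ring.zero = 0, add = (+)\<rparr>"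

lemma skew_poly_ring_relation:
  assumes "derivation \<delta>"
  shows "[:0, 1:] \<otimes>\<^bsub>skew_poly_ring \<delta>\<^esub> [:a:] =
         [:a:] \<otimes>\<^bsub>skew_poly_ring \<delta>\<^esub> [:0, 1:] \<oplus>\<^bsub>skew_poly_ring \<delta>\<^esub> [:\<delta> a:]"
proof -
  have "\<delta> 0 + \<delta> 0 = \<delta> 0"
    using assms unfolding derivation_def by (metis add_0)
  then have "\<delta> 0 = 0" by simp
  then show ?thesis
    by (auto simp: skew_poly_ring_def skew_mult_def skew_t_def poly_eq_iff coeff_map_poly
        coeff_pCons split: nat.splits)
qed

definition skew_irreducible :: "('a::division_ring \<Rightarrow> 'a) \<Rightarrow> 'a poly \<Rightarrow> bool" where
  "skew_irreducible \<delta> f \<longleftrightarrow>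
     f \<notin> Units (skew_poly_ring \<delta>) \<and>
     \<not> (\<exists>q r. f = q \<otimes>\<^bsub>skew_poly_ring \<delta>\<^esub> r \<and>
          1 \<le> degree q \<and> degree q < degree f \<and> 1 \<le> degree r \<and> degree r < degree f)"

definition min_central_left_multiple ::
    "('a::division_ring \<Rightarrow> 'a) \<Rightarrow> 'a poly \<Rightarrow> 'a poly \<Rightarrow> bool" where
  "min_central_left_multiple \<delta> f h \<longleftrightarrow>
     (let R = skew_poly_ring \<delta>;
          is_multiple = (\<lambda>k. k \<in> ring_center R \<and> k \<noteq> 0 \<and> (\<exists>q. k = q \<otimes>\<^bsub>R\<^esub> f))
      in is_multiple h \<and> (\<forall>k. is_multiple k \<longrightarrow> degree h \<le> degree k))"

text \<open>\<open>q(x) = \<Sum> q\<^sub>i x\<^sup>i\<close> in \<open>D[t;\<delta>]\<close>, and the subring \<open>F[x]\<close>.\<close>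

definition skew_eval :: "('a::division_ring \<Rightarrow> 'a) \<Rightarrow> 'a poly \<Rightarrow> 'a poly \<Rightarrow> 'a poly" where
  "skew_eval \<delta> x q =
     (\<Sum>i\<le>degree q. [:coeff q i:] \<otimes>\<^bsub>skew_poly_ring \<delta>\<^esub> (x [^]\<^bsub>skew_poly_ring \<delta>\<^esub> i))"

definition central_polys :: "('a::division_ring \<Rightarrow> 'a) \<Rightarrow> 'a poly \<Rightarrow> 'a poly set" where
  "central_polys \<delta> x = skew_eval \<delta> x ` polys_over (const_field \<delta>)"


section \<open>Rings of central quotients\<close>

text \<open>The fraction \<open>f/q\<close>, as a class of pairs, with denominators in \<open>Z - {0}\<close>.\<close>

definition central_frac :: "('r, 'm) ring_scheme \<Rightarrow> 'r set \<Rightarrow> 'r \<Rightarrow> 'r \<Rightarrow> ('r \<times> 'r) set" where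
  "central_frac R Z f q =
     {(f', q'). f' \<in> carrier R \<and> q' \<in> Z - {\<zero>\<^bsub>R\<^esub>} \<and> f \<otimes>\<^bsub>R\<^esub> q' = f' \<otimes>\<^bsub>R\<^esub> q}"

definition central_quotients :: "('r, 'm) ring_scheme \<Rightarrow> 'r set \<Rightarrow> ('r \<times> 'r) set ring" where
  "central_quotients R Z =
     \<lparr>carrier = {central_frac R Z f q | f q. f \<in> carrier R \<and> q \<in> Z - {\<zero>\<^bsub>R\<^esub>}},
      monoid.mult = (\<lambda>U V. \<Union>u \<in> U. \<Union>v \<in> V.
        central_frac R Z (fst u \<otimes>\<^bsub>R\<^esub> fst v) (snd u \<otimes>\<^bsub>R\<^esub> snd v)),
      one = central_frac R Z \<one>\<^bsub>R\<^esub> \<one>\<^bsub>R\<^esub>,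
      ring.zero = central_frac R Z \<zero>\<^bsub>R\<^esub> \<one>\<^bsub>R\<^esub>,
      add = (\<lambda>U V. \<Union>u \<in> U. \<Union>v \<in> V.
        central_frac R Z (fst u \<otimes>\<^bsub>R\<^esub> snd v \<oplus>\<^bsub>R\<^esub> fst v \<otimes>\<^bsub>R\<^esub> snd u)
          (snd u \<otimes>\<^bsub>R\<^esub> snd v))\<rparr>"

definition quotients_of_center :: "('r, 'm) ring_scheme \<Rightarrow> 'r set \<Rightarrow> ('r \<times> 'r) set set" where
  "quotients_of_center R Z = {central_frac R Z a q | a q. a \<in> Z \<and> q \<in> Z - {\<zero>\<^bsub>R\<^esub>}}"


section \<open>Reduced norms of central simple algebras\<close>

text \<open>
  A \<open>K\<close>-algebra homomorphism \<open>\<phi>: A \<rightarrow> M\<^sub>n(L)\<close>, with \<open>L\<close> a field containing \<open>K\<close> through \<open>\<iota>\<close>,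
  whose \<open>L\<close>-linear extension \<open>A \<otimes>\<^sub>K L \<rightarrow> M\<^sub>n(L)\<close> is bijective: it sends a \<open>K\<close>-basis of \<open>A\<close> to
  an \<open>L\<close>-basis of \<open>M\<^sub>n(L)\<close>, where \<open>L\<close> is identified with the scalar matrices.
\<close>

definition splitting ::
    "('b, 'm) ring_scheme \<Rightarrow> 'b set \<Rightarrow> nat \<Rightarrow> ('b \<Rightarrow> 'l::field) \<Rightarrow> ('b \<Rightarrow> 'l mat) \<Rightarrow> bool" where
  "splitting A K n \<iota> \<phi> \<longleftrightarrow>
     (let M = ring_mat TYPE('l) n (); S = {c \<cdot>\<^sub>m 1\<^sub>m n | c. True} in
        \<phi> \<in> Ring.ring_hom A M \<and> (\<forall>k \<in> K. \<phi> k = \<iota> k \<cdot>\<^sub>m 1\<^sub>m n) \<and>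
        (\<exists>Us. ring.independent A K Us \<and> ring.Span A K Us = carrier A \<and>
              ring.independent M S (map \<phi> Us) \<and> ring.Span M S (map \<phi> Us) = carrier M))"

text \<open>
  \<open>N: A \<rightarrow> K\<close> is the reduced norm of the central simple \<open>K\<close>-algebra \<open>A\<close>, computed from a
  splitting over the field \<open>'l\<close>. As the splitting field cannot be constructed inside a definition
  without fixing its type, this is a relation rather than a function; statements about reduced
  norms are polymorphic in \<open>'l\<close>.
\<close>

definition is_reduced_norm ::
    "'l::field itself \<Rightarrow> ('b, 'm) ring_scheme \<Rightarrow> 'b set \<Rightarrow> ('b \<Rightarrow> 'b) \<Rightarrow> bool" where
  "is_reduced_norm _ A K N \<longleftrightarrow>
     (\<exists>n (\<iota> :: 'b \<Rightarrow> 'l) \<phi>. splitting A K n \<iota> \<phi> \<and>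
        (\<forall>a \<in> carrier A. N a \<in> K \<and> \<iota> (N a) = det (\<phi> a)))"

end

theory Submission
  imports Defs
begin

text \<open>
  The center of \<open>R = D[t;\<delta>]\<close> is \<open>F[x]\<close>, and \<open>[D:F] \<le> d\<^sup>2 p\<^sup>e\<close> because every family of more than
  \<open>p\<^sup>e\<close> elements of \<open>C\<close> is annihilated by \<open>g(\<delta>)\<close>, hence dependent over \<open>F\<close>.

  (i) Suppose \<open>f = ab\<close> is a proper factorization. As \<open>h\<close> is irreducible, \<open>R/Rb\<close> is a vector space
  over the field \<open>F[x]/(h)\<close>, of dimension \<open>w\<close> say, and counting dimensions over \<open>F\<close> gives
  \<open>w d deg f \<le> d\<^sup>2 p\<^sup>e deg b\<close>. By Ore's condition some \<open>r \<noteq> 0\<close> with \<open>deg r \<le> w deg b\<close> annihilates a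
  basis, and hence all of \<open>R/Rb\<close>. The annihilator is a two-sided ideal, so it is generated by a
  central element, which divides \<open>h\<close> and so is \<open>h\<close>. Thus \<open>deg h = p\<^sup>e d deg f \<le> w deg b\<close>, and
  together \<open>deg f \<le> deg b\<close>, a contradiction.

  (ii) If \<open>f\<close> is irreducible, then \<open>R/Rf\<close> is simple, so \<open>h = qf\<close> is irreducible in \<open>F[x]\<close>. On \<open>R\<close> the
  reduced norm is a homogeneous polynomial of degree \<open>n\<close> in coordinates over \<open>F[x]\<close>, so the powers
  \<open>N(f)\<^sup>k = N(f\<^sup>k)\<close> have a common denominator and degrees at most \<open>n k deg f + const\<close>; hence
  \<open>N(f) \<in> F[x]\<close> and \<open>deg N(f) \<le> n deg f\<close>, and likewise for \<open>q\<close>. Since \<open>N(f) N(q) = h\<^sup>n\<close>, both bounds are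
  equalities and \<open>N(f)\<close> is a unit times a power of \<open>h\<close>. The exponent is 1 because \<open>n \<le> d p\<^sup>e\<close>.
\<close>

section \<open>Arithmetic of differential polynomials\<close>

text \<open>\<open>F[x]\<close> is never a polynomial type of its own: it is the set
  \<open>Z\<close> inside \<open>'a poly\<close>, and degrees of its elements are degrees in
  \<open>t\<close>, so a degree in \<open>x\<close> reappears multiplied by \<open>p ^ e\<close>.
  Neither the field \<open>F[x]/(h)\<close> nor the module \<open>R/Rb\<close> is constructed; a
  generating set of least cardinality modulo \<open>Rb\<close> stands in for a basis.

  The obstacle in (ii) is that the splitting field \<open>'l\<close> is arbitrary. The form that
  computes the determinant has coefficients in \<open>'l\<close>, possibly outside
  \<open>F(x)\<close>, where there is no denominator to clear. A linear retraction onto the copy of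
  \<open>F(x)\<close> inside \<open>'l\<close> replaces these coefficients by fractions; values on
  \<open>R\<close> do not change, because each determinant already is a fraction. The denominator so
  obtained is the same for all elements of \<open>R\<close>, which is what the argument with powers
  requires.

  All dimension counts are upper bounds. The equality \<open>n = d p^e\<close> is not imported from
  the theory of central simple algebras; it comes out at the end, when the degree of
  \<open>N(f)\<close> is compared with that of a power of \<open>h\<close>.\<close>

locale derivation_ring =
  fixes \<delta> :: "'a::division_ring \<Rightarrow> 'a"
  assumes der: "derivation \<delta>"
begin

abbreviation skew_times :: "'a poly \<Rightarrow> 'a poly \<Rightarrow> 'a poly" (infixl "\<star>" 70) where
  "f \<star> q \<equiv> skew_mult \<delta> f q"

lemma skew_poly_ring_simps:
  "carrier (skew_poly_ring \<delta>) = UNIV" "\<zero>\<^bsub>skew_poly_ring \<delta>\<^esub> = 0" "\<one>\<^bsub>skew_poly_ring \<delta>\<^esub> = [:1:]"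
  "f \<otimes>\<^bsub>skew_poly_ring \<delta>\<^esub> q = f \<star> q" "f \<oplus>\<^bsub>skew_poly_ring \<delta>\<^esub> q = f + q"
  by (simp_all add: skew_poly_ring_def)

abbreviation scale :: "'a \<Rightarrow> 'a poly \<Rightarrow> 'a poly" where
  "scale a q \<equiv> map_poly ((*) a) q"

lemma der_add [simp]: "\<delta> (a + b) = \<delta> a + \<delta> b"
  using der by (simp add: derivation_def)

lemma der_mult: "\<delta> (a * b) = \<delta> a * b + a * \<delta> b"
  using der by (simp add: derivation_def)

lemma der_0 [simp]: "\<delta> 0 = 0"
  using der_add[of 0 0] by simp

lemma der_1 [simp]: "\<delta> 1 = 0"
  using der_mult[of 1 1] by simp

lemma der_minus [simp]: "\<delta> (- a) = - \<delta> a"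
  using der_add[of a "- a"] by (simp add: eq_neg_iff_add_eq_0 add.commute)

lemma der_diff [simp]: "\<delta> (a - b) = \<delta> a - \<delta> b"
  using der_add[of a "- b"] by simp

lemma der_sum: "\<delta> (\<Sum>i\<in>A. f i) = (\<Sum>i\<in>A. \<delta> (f i))"
  by (induction A rule: infinite_finite_induct) auto

lemma coeff_scale [simp]: "coeff (scale a q) n = a * coeff q n"
  by (simp add: coeff_map_poly)

lemma scale_0_left [simp]: "scale 0 q = 0"
  by (simp add: poly_eq_iff)

lemma scale_1_left [simp]: "scale 1 q = q"
  by (simp add: poly_eq_iff)

lemma scale_add: "scale a (p + q) = scale a p + scale a q"
  by (simp add: poly_eq_iff distrib_left)

lemma scale_add_left: "scale (a + b) q = scale a q + scale b q"
  by (simp add: poly_eq_iff distrib_right)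

lemma scale_scale: "scale a (scale b q) = scale (a * b) q"
  by (simp add: poly_eq_iff mult.assoc)

lemma scale_sum: "scale a (\<Sum>i\<in>A. f i) = (\<Sum>i\<in>A. scale a (f i))"
  by (induction A rule: infinite_finite_induct) (auto simp: scale_add)

lemma coeff_skew_t: "coeff (skew_t \<delta> q) n = (case n of 0 \<Rightarrow> 0 | Suc k \<Rightarrow> coeff q k) + \<delta> (coeff q n)"
  by (simp add: skew_t_def coeff_map_poly coeff_pCons)

lemma skew_t_add: "skew_t \<delta> (p + q) = skew_t \<delta> p + skew_t \<delta> q"
  by (simp add: poly_eq_iff coeff_skew_t split: nat.split)

lemma skew_t_0 [simp]: "skew_t \<delta> 0 = 0"
  by (simp add: poly_eq_iff coeff_skew_t split: nat.split)

lemma skew_t_sum: "skew_t \<delta> (\<Sum>i\<in>A. f i) = (\<Sum>i\<in>A. skew_t \<delta> (f i))"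
  by (induction A rule: infinite_finite_induct) (auto simp: skew_t_add)

lemma skew_t_scale: "skew_t \<delta> (scale a q) = scale a (skew_t \<delta> q) + scale (\<delta> a) q"
  by (simp add: poly_eq_iff coeff_skew_t der_mult distrib_left split: nat.split)

lemma skew_t_pow_add: "(skew_t \<delta> ^^ i) (p + q) = (skew_t \<delta> ^^ i) p + (skew_t \<delta> ^^ i) q"
  by (induction i) (auto simp: skew_t_add)

lemma skew_t_pow_0 [simp]: "(skew_t \<delta> ^^ i) 0 = 0"
  by (induction i) auto

text \<open>Terms beyond the degree vanish, so left factors of different degrees can be expanded
  over one common range.\<close>

lemma skew_mult_eq_sum:
  assumes "degree f \<le> n"
  shows "f \<star> q = (\<Sum>i\<le>n. scale (coeff f i) ((skew_t \<delta> ^^ i) q))"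
  unfolding skew_mult_def
  by (rule sum.mono_neutral_left) (use assms in \<open>auto simp: coeff_eq_0\<close>)

lemma skew_mult_0_left [simp]: "0 \<star> q = 0"
  by (simp add: skew_mult_def)

lemma skew_mult_0_right [simp]: "q \<star> 0 = 0"
  by (simp add: skew_mult_def)

lemma const_skew_mult [simp]: "[:a:] \<star> q = scale a q"
  by (simp add: skew_mult_def)

lemma skew_mult_add_left: "(f + g) \<star> q = f \<star> q + g \<star> q"
proof -
  let ?n = "max (degree f) (degree g)"
  have "degree (f + g) \<le> ?n" by (rule degree_add_le_max)
  then show ?thesis
    by (simp add: skew_mult_eq_sum[of _ ?n] scale_add_left sum.distrib)
qed

lemma skew_mult_add_right: "f \<star> (p + q) = f \<star> p + f \<star> q"
  by (simp add: skew_mult_def skew_t_pow_add scale_add sum.distrib)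

lemma scale_skew_mult: "scale a f \<star> q = scale a (f \<star> q)"
proof -
  have "degree (scale a f) \<le> degree f" by (rule degree_le) (simp add: coeff_eq_0)
  then show ?thesis
    by (simp add: skew_mult_eq_sum[of _ "degree f"] scale_sum scale_scale)
qed

text \<open>Since \<open>t a = a t + \<delta>(a)\<close>, one has
  \<open>t a t^i q = a t^(i+1) q + \<delta>(a) t^i q\<close>, and \<open>skew_t\<close> changes the
  coefficients of the left factor in the same way. This case carries associativity; the rest is
  additivity and scaling.\<close>

lemma skew_t_skew_mult: "skew_t \<delta> f \<star> q = skew_t \<delta> (f \<star> q)"
proof -
  let ?n = "degree f" and ?T = "skew_t \<delta>"
  have d: "degree (?T f) \<le> Suc ?n"
    by (rule degree_le) (auto simp: coeff_skew_t coeff_eq_0 split: nat.split)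
  have "?T f \<star> q = (\<Sum>i\<le>Suc ?n. scale (case i of 0 \<Rightarrow> 0 | Suc k \<Rightarrow> coeff f k) ((?T ^^ i) q))
      + (\<Sum>i\<le>Suc ?n. scale (\<delta> (coeff f i)) ((?T ^^ i) q))"
    by (simp only: skew_mult_eq_sum[OF d] coeff_skew_t scale_add_left sum.distrib)
  also have "(\<Sum>i\<le>Suc ?n. scale (case i of 0 \<Rightarrow> 0 | Suc k \<Rightarrow> coeff f k) ((?T ^^ i) q))
      = (\<Sum>i\<le>?n. scale (coeff f i) (?T ((?T ^^ i) q)))"
    by (subst sum.atMost_Suc_shift) simp
  also have "(\<Sum>i\<le>Suc ?n. scale (\<delta> (coeff f i)) ((?T ^^ i) q))
      = (\<Sum>i\<le>?n. scale (\<delta> (coeff f i)) ((?T ^^ i) q))"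
    by (simp add: coeff_eq_0)
  also have "(\<Sum>i\<le>?n. scale (coeff f i) (?T ((?T ^^ i) q)))
      + (\<Sum>i\<le>?n. scale (\<delta> (coeff f i)) ((?T ^^ i) q)) = ?T (f \<star> q)"
    by (simp add: skew_mult_def skew_t_sum skew_t_scale sum.distrib)
  finally show ?thesis .
qed

lemma skew_t_pow_skew_mult: "(skew_t \<delta> ^^ i) f \<star> q = (skew_t \<delta> ^^ i) (f \<star> q)"
  by (induction i) (auto simp: skew_t_skew_mult)

lemma sum_skew_mult: "(\<Sum>i\<in>A. f i) \<star> q = (\<Sum>i\<in>A. f i \<star> q)"
  by (induction A rule: infinite_finite_induct) (auto simp: skew_mult_add_left)

lemma skew_mult_sum: "q \<star> (\<Sum>i\<in>A. f i) = (\<Sum>i\<in>A. q \<star> f i)"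
  by (induction A rule: infinite_finite_induct) (auto simp: skew_mult_add_right)

lemma skew_mult_assoc: "f \<star> q \<star> r = f \<star> (q \<star> r)"
  unfolding skew_mult_def[of \<delta> f]
  by (simp add: sum_skew_mult scale_skew_mult skew_t_pow_skew_mult)

lemma skew_t_pow_1: "(skew_t \<delta> ^^ i) [:1:] = monom 1 i"
proof (induction i)
  case (Suc i)
  show ?case
    by (simp only: funpow.simps o_apply Suc)
      (auto simp: poly_eq_iff coeff_skew_t split: nat.split)
qed (simp add: monom_0)

lemma skew_mult_1_right: "f \<star> [:1:] = f"
proof -
  have "f \<star> [:1:] = (\<Sum>i\<le>degree f. monom (coeff f i) i)"
    unfolding skew_mult_def skew_t_pow_1
    by (intro sum.cong refl) (auto simp: poly_eq_iff)
  also have "\<dots> = f" by (rule poly_as_sum_of_monoms)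
  finally show ?thesis .
qed

text \<open>\<open>D\<close> need not be commutative, so the ring structure is attached to
  \<open>\<star>\<close> by interpretation. Addition is that of \<open>'a poly\<close>, and
  \<open>sk.power\<close> denotes powers in \<open>D[t;\<delta>]\<close>.\<close>

sublocale sk: ring_1 "[:1:]" "(\<star>)" "(+)" "0 :: 'a poly" "(-)" uminus
  by unfold_locales
    (auto simp: skew_mult_assoc skew_mult_1_right skew_mult_add_left skew_mult_add_right)

lemma coeff_skew_t_pow_eq_0: "degree q + i < n \<Longrightarrow> coeff ((skew_t \<delta> ^^ i) q) n = 0"
  by (induction i arbitrary: n) (auto simp: coeff_skew_t coeff_eq_0 split: nat.split)

lemma coeff_skew_t_pow_lead: "coeff ((skew_t \<delta> ^^ i) q) (degree q + i) = lead_coeff q"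
  by (induction i) (auto simp: coeff_skew_t coeff_skew_t_pow_eq_0)

lemma coeff_skew_mult_eq_0: "degree f + degree q < n \<Longrightarrow> coeff (f \<star> q) n = 0"
  by (auto simp: skew_mult_def coeff_sum coeff_skew_t_pow_eq_0 intro!: sum.neutral)

text \<open>Applying \<open>skew_t\<close> \<open>i\<close> times raises the degree by
  \<open>i\<close> and keeps the leading coefficient, so only the top term of \<open>f\<close>
  reaches this position. As \<open>D\<close> is a division ring, degrees add and there are no zero
  divisors.\<close>

lemma coeff_skew_mult_lead: "coeff (f \<star> q) (degree f + degree q) = lead_coeff f * lead_coeff q"
proof -
  have "coeff (f \<star> q) (degree f + degree q)
      = (\<Sum>i\<le>degree f. coeff f i * coeff ((skew_t \<delta> ^^ i) q) (degree f + degree q))"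
    by (simp add: skew_mult_def coeff_sum)
  also have "\<dots> = (\<Sum>i\<in>{degree f}. coeff f i * coeff ((skew_t \<delta> ^^ i) q) (degree f + degree q))"
    by (intro sum.mono_neutral_right ballI) (auto simp: coeff_skew_t_pow_eq_0)
  also have "\<dots> = lead_coeff f * lead_coeff q"
    by (simp add: coeff_skew_t_pow_lead add.commute[of "degree f"])
  finally show ?thesis .
qed

lemma skew_mult_eq_0_iff [simp]: "f \<star> q = 0 \<longleftrightarrow> f = 0 \<or> q = 0"
  using coeff_skew_mult_lead[of f q] by auto

lemma degree_skew_mult: "f \<noteq> 0 \<Longrightarrow> q \<noteq> 0 \<Longrightarrow> degree (f \<star> q) = degree f + degree q"
  by (intro antisym degree_le le_degree) (auto simp: coeff_skew_mult_eq_0 coeff_skew_mult_lead)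

lemma lead_coeff_skew_mult: "lead_coeff (f \<star> q) = lead_coeff f * lead_coeff q"
  by (cases "f = 0 \<or> q = 0") (auto simp: degree_skew_mult coeff_skew_mult_lead)

lemma degree_skew_mult_le: "degree (f \<star> q) \<le> degree f + degree q"
  by (cases "f = 0 \<or> q = 0") (auto simp: degree_skew_mult)

lemma skew_mult_cancel_right: "r \<noteq> 0 \<Longrightarrow> f \<star> r = q \<star> r \<Longrightarrow> f = q"
  using skew_mult_eq_0_iff[of "f - q" r] by (simp add: sk.left_diff_distrib)

lemma skew_division:
  assumes "b \<noteq> 0"
  obtains s r where "f = s \<star> b + r" "r = 0 \<or> degree r < degree b"
proof -
  have "\<exists>s r. f = s \<star> b + r \<and> (r = 0 \<or> degree r < degree b)"
  proof (induction "degree f" arbitrary: f rule: less_induct)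
    case less
    show ?case
    proof (cases "f = 0 \<or> degree f < degree b")
      case True
      then show ?thesis by (intro exI[of _ 0] exI[of _ f]) auto
    next
      case False
      define k where "k = degree f - degree b"
      \<comment> \<open>The divisor is the right factor, and leading coefficients multiply in the
        order \<open>lead_coeff c * lead_coeff b\<close>; hence the inverse goes to the right of
        \<open>lead_coeff f\<close>.\<close>
      define c where "c = monom (lead_coeff f * inverse (lead_coeff b)) k"
      have c0: "c \<noteq> 0" and dc: "degree c = k" and lc: "lead_coeff c = lead_coeff f * inverse (lead_coeff b)"
        using False assms by (auto simp: c_def degree_monom_eq)
      have dcb: "degree (c \<star> b) = degree f" using c0 dc assms False by (simp add: degree_skew_mult k_def)
      have "lead_coeff (c \<star> b) = lead_coeff f"
        using assms by (simp only: lead_coeff_skew_mult lc) (simp add: mult.assoc)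
      then have c0': "coeff (f - c \<star> b) (degree f) = 0" by (simp add: dcb)
      show ?thesis
      proof (cases "f = c \<star> b")
        case True
        then show ?thesis by (intro exI[of _ c] exI[of _ 0]) auto
      next
        case neq: False
        have "degree (f - c \<star> b) < degree f"
          using c0' neq dcb
          by (metis degree_diff_le eq_iff_diff_eq_0 le_neq_implies_less leading_coeff_0_iff order_refl)
        from less[OF this] obtain s r where "f - c \<star> b = s \<star> b + r" "r = 0 \<or> degree r < degree b" by auto
        then show ?thesis
          by (intro exI[of _ "c + s"] exI[of _ r]) (auto simp: sk.distrib_right algebra_simps)
      qed
    qed
  qed
  then show ?thesis using that by blast
qed

text \<open>A nonzero \<open>s\<close> would give \<open>s \<star> b\<close> degree at least that of
  \<open>b\<close>. This homogeneous form is the one that applies to a division identity after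
  taking commutators.\<close>

lemma skew_division_unique:
  assumes "s \<star> b + r = 0" "r = 0 \<or> degree r < degree b" "b \<noteq> 0"
  shows "s = 0 \<and> r = 0"
proof -
  have eq: "s \<star> b = - r" using assms(1) by (simp add: eq_neg_iff_add_eq_0)
  have "s = 0"
  proof (rule ccontr)
    assume s: "s \<noteq> 0"
    then have "degree (s \<star> b) \<ge> degree b" using assms(3) by (simp add: degree_skew_mult)
    moreover have "s \<star> b \<noteq> 0" using s assms(3) by simp
    ultimately show False using eq assms(2) by auto
  qed
  then show ?thesis using eq by simp
qed

end

section \<open>The center\<close>

lemma mem_base_field: "z \<in> (base_field :: 'a::division_ring set) \<longleftrightarrow> (\<forall>y. z * y = y * z)"
  by (simp add: ring_center_def ring_of_type_algebra_def)

text \<open>From \<open>i * (p^k choose i) = p^k * (p^k - 1 choose i - 1)\<close>: were the binomial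
  coefficient prime to \<open>p\<close>, then \<open>p^k\<close> would divide
  \<open>i\<close>.\<close>

lemma of_nat_prime_power_choose_eq_0:
  assumes "prime p" "CHAR('a::division_ring) = p" "0 < i" "i < p ^ k"
  shows "(of_nat (p ^ k choose i) :: 'a) = 0"
proof -
  have "p dvd (p ^ k choose i)"
  proof (rule ccontr)
    assume "\<not> p dvd (p ^ k choose i)"
    then have "coprime (p ^ k) (p ^ k choose i)"
      using assms(1) by (simp add: prime_imp_coprime)
    moreover have "i * (p ^ k choose i) = p ^ k * ((p ^ k - 1) choose (i - 1))"
      using assms(3) by (rule times_binomial_minus1_eq)
    then have "p ^ k dvd i * (p ^ k choose i)" by simp
    ultimately have "p ^ k dvd i" using coprime_dvd_mult_left_iff by blast
    then show False using assms(3,4) by (auto dest: dvd_imp_le)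
  qed
  then show ?thesis using assms(2) by (simp add: of_nat_eq_0_iff_char_dvd)
qed

lemma base_field_closed:
  fixes a b :: "'a::division_ring"
  assumes "a \<in> base_field" "b \<in> base_field"
  shows "a + b \<in> base_field" "a * b \<in> base_field" "- a \<in> base_field" "a - b \<in> base_field"
    "inverse a \<in> base_field" "0 \<in> (base_field :: 'a set)" "1 \<in> (base_field :: 'a set)"
proof -
  have a: "\<And>y. a * y = y * a" and b: "\<And>y. b * y = y * b" using assms by (auto simp: mem_base_field)
  show "a + b \<in> base_field" "- a \<in> base_field" "a - b \<in> base_field"
    "0 \<in> (base_field :: 'a set)" "1 \<in> (base_field :: 'a set)"
    by (auto simp: mem_base_field a b distrib_left distrib_right left_diff_distrib right_diff_distrib)
  show "a * b \<in> base_field" by (auto simp: mem_base_field mult.assoc b) (metis a mult.assoc)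
  show "inverse a \<in> base_field"
  proof (cases "a = 0")
    case False
    have "inverse a * y = y * inverse a" for y
    proof -
      have "inverse a * y = inverse a * (y * a) * inverse a" using False by (simp add: mult.assoc)
      also have "\<dots> = inverse a * a * (y * inverse a)" by (simp only: a[symmetric, of y] mult.assoc)
      also have "\<dots> = y * inverse a" using False by simp
      finally show ?thesis .
    qed
    then show ?thesis by (simp add: mem_base_field)
  qed (simp add: mem_base_field)
qed

context derivation_ring
begin

section \<open>The action of differential polynomials on \<open>D\<close> as differential
  operators\<close>

lemma der_pow_0 [simp]: "(\<delta> ^^ i) 0 = 0"
  by (induction i) auto

lemma poly_in_der_eq_sum:
  assumes "degree f \<le> n"
  shows "poly_in_der f \<delta> z = (\<Sum>i\<le>n. coeff f i * (\<delta> ^^ i) z)"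
  unfolding poly_in_der_def
  by (rule sum.mono_neutral_left) (use assms in \<open>auto simp: coeff_eq_0\<close>)

lemma poly_in_der_add: "poly_in_der (f + q) \<delta> z = poly_in_der f \<delta> z + poly_in_der q \<delta> z"
proof -
  let ?n = "max (degree f) (degree q)"
  have "degree (f + q) \<le> ?n" by (rule degree_add_le_max)
  then show ?thesis
    by (simp add: poly_in_der_eq_sum[of _ ?n] distrib_right sum.distrib)
qed

lemma poly_in_der_minus: "poly_in_der (- f) \<delta> z = - poly_in_der f \<delta> z"
  by (simp add: poly_in_der_def sum_negf)

lemma poly_in_der_diff: "poly_in_der (f - q) \<delta> z = poly_in_der f \<delta> z - poly_in_der q \<delta> z"
  using poly_in_der_add[of f "- q"] by (simp add: poly_in_der_minus)

lemma poly_in_der_0 [simp]: "poly_in_der 0 \<delta> z = 0"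
  by (simp add: poly_in_der_def)

lemma poly_in_der_const [simp]: "poly_in_der [:a:] \<delta> z = a * z"
  by (simp add: poly_in_der_def)

lemma poly_in_der_sum: "poly_in_der (\<Sum>i\<in>A. f i) \<delta> z = (\<Sum>i\<in>A. poly_in_der (f i) \<delta> z)"
  by (induction A rule: infinite_finite_induct) (auto simp: poly_in_der_add)

lemma poly_in_der_scale: "poly_in_der (scale a f) \<delta> z = a * poly_in_der f \<delta> z"
proof -
  have "degree (scale a f) \<le> degree f" by (rule degree_le) (simp add: coeff_eq_0)
  then show ?thesis
    by (simp add: poly_in_der_eq_sum[of _ "degree f"] sum_distrib_left mult.assoc)
qed

lemma poly_in_der_monom: "poly_in_der (monom a n) \<delta> z = a * (\<delta> ^^ n) z"
proof (cases "a = 0")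
  case False
  have "(\<Sum>i\<le>n. (if n = i then a else 0) * (\<delta> ^^ i) z) = (\<Sum>i\<le>n. if n = i then a * (\<delta> ^^ i) z else 0)"
    by (intro sum.cong) auto
  with False show ?thesis by (simp add: poly_in_der_def degree_monom_eq)
qed (simp add: poly_in_der_def)

lemma skew_t_eq_sum: "skew_t \<delta> f = (\<Sum>i\<le>degree f. monom (coeff f i) (Suc i) + monom (\<delta> (coeff f i)) i)"
proof -
  have "skew_t \<delta> f = skew_t \<delta> (\<Sum>i\<le>degree f. monom (coeff f i) i)"
    by (simp add: poly_as_sum_of_monoms)
  also have "skew_t \<delta> (monom a i) = monom a (Suc i) + monom (\<delta> a) i" for a i
    by (simp add: skew_t_def monom_Suc map_poly_monom)
  then have "skew_t \<delta> (\<Sum>i\<le>degree f. monom (coeff f i) i)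
      = (\<Sum>i\<le>degree f. monom (coeff f i) (Suc i) + monom (\<delta> (coeff f i)) i)"
    by (simp add: skew_t_sum)
  finally show ?thesis .
qed

lemma poly_in_der_skew_t: "poly_in_der (skew_t \<delta> f) \<delta> z = \<delta> (poly_in_der f \<delta> z)"
  unfolding skew_t_eq_sum poly_in_der_sum poly_in_der_add poly_in_der_monom
  by (simp add: poly_in_der_def der_sum der_mult add.commute)

lemma poly_in_der_skew_t_pow: "poly_in_der ((skew_t \<delta> ^^ i) f) \<delta> z = (\<delta> ^^ i) (poly_in_der f \<delta> z)"
  by (induction i) (auto simp: poly_in_der_skew_t)

text \<open>\<open>D\<close> is a left module over \<open>D[t;\<delta>]\<close>, with \<open>t\<close> acting as \<open>\<delta>\<close>.\<close>

lemma poly_in_der_skew_mult: "poly_in_der (f \<star> q) \<delta> z = poly_in_der f \<delta> (poly_in_der q \<delta> z)"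
  unfolding skew_mult_def poly_in_der_sum poly_in_der_scale poly_in_der_skew_t_pow
  by (simp add: poly_in_der_def)

text \<open>Differentiate \<open>z * y = y * z\<close> and cancel the two terms containing
  \<open>\<delta> y\<close>.\<close>

lemma der_base_field: "z \<in> base_field \<Longrightarrow> \<delta> z \<in> base_field"
  unfolding mem_base_field
proof
  fix y assume "\<forall>y. z * y = y * z"
  then have "\<delta> (z * y) = \<delta> (y * z)" "z * \<delta> y = \<delta> y * z" by auto
  then show "\<delta> z * y = y * \<delta> z" by (simp add: der_mult)
qed

lemma der_pow_base_field: "z \<in> base_field \<Longrightarrow> (\<delta> ^^ i) z \<in> base_field"
  by (induction i) (auto simp: der_base_field)

lemma const_field_closed:
  assumes "a \<in> const_field \<delta>" "b \<in> const_field \<delta>"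
  shows "a + b \<in> const_field \<delta>" "a * b \<in> const_field \<delta>" "- a \<in> const_field \<delta>"
    "a - b \<in> const_field \<delta>" "inverse a \<in> const_field \<delta>"
proof -
  have "\<delta> (inverse a) = 0"
  proof (cases "a = 0")
    case False
    have "\<delta> (inverse a * a) = 0" using False by simp
    then show ?thesis using assms False by (simp only: der_mult) (simp add: const_field_def Const_def)
  qed simp
  then show "a + b \<in> const_field \<delta>" "a * b \<in> const_field \<delta>" "- a \<in> const_field \<delta>"
    "a - b \<in> const_field \<delta>" "inverse a \<in> const_field \<delta>"
    using assms base_field_closed[of a b] by (auto simp: const_field_def Const_def der_mult)
qed

lemma const_field_0 [simp]: "0 \<in> const_field \<delta>" and const_field_1 [simp]: "1 \<in> const_field \<delta>"
  using base_field_closed[of "0::'a" 0] by (auto simp: const_field_def Const_def mem_base_field)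

section \<open>Elements of the center and division inside it\<close>

abbreviation Z :: "'a poly set" where "Z \<equiv> ring_center (skew_poly_ring \<delta>)"

lemma mem_center: "z \<in> Z \<longleftrightarrow> (\<forall>y. z \<star> y = y \<star> z)"
  by (simp add: ring_center_def skew_poly_ring_def)

lemma center_commute: "z \<in> Z \<Longrightarrow> z \<star> y = y \<star> z"
  by (simp add: mem_center)

lemma skew_mult_t [simp]: "q \<star> [:0, 1:] = pCons 0 q"
proof -
  have "q \<star> [:0, 1:] = (\<Sum>i\<le>degree q. scale (coeff q i) (monom 1 (Suc i)))"
  proof -
    have "[:0, 1:] = skew_t \<delta> [:1:]" by (simp add: poly_eq_iff coeff_skew_t coeff_pCons split: nat.split)
    then have "(skew_t \<delta> ^^ i) [:0, 1:] = monom 1 (Suc i)" for i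
      using skew_t_pow_1[of "Suc i"] by (simp only: funpow_Suc_right o_apply)
    then show ?thesis by (simp add: skew_mult_def)
  qed
  also have "\<dots> = pCons 0 (\<Sum>i\<le>degree q. monom (coeff q i) i)"
    by (auto simp: poly_eq_iff coeff_sum coeff_pCons if_distrib[of "(*) _"] coeff_eq_0 split: nat.split cong: if_cong)
  finally show ?thesis by (simp add: poly_as_sum_of_monoms)
qed

lemma t_skew_mult [simp]: "[:0, 1:] \<star> q = skew_t \<delta> q"
  by (auto simp: skew_mult_def)

lemma monom_skew_mult: "monom 1 n \<star> q = (skew_t \<delta> ^^ n) q"
  by (simp add: skew_t_pow_1[symmetric] skew_t_pow_skew_mult)

text \<open>\<open>D\<close> and \<open>t\<close> generate the ring: \<open>pCons a q\<close> is
  \<open>a + q t\<close>, which is what the induction on \<open>y\<close> uses.\<close>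

lemma centerI:
  assumes "\<And>a. z \<star> [:a:] = scale a z" and "pCons 0 z = skew_t \<delta> z"
  shows "z \<in> Z"
  unfolding mem_center
proof
  fix y
  show "z \<star> y = y \<star> z"
  proof (induction y)
    case (pCons a q)
    have eq: "pCons a q = [:a:] + q \<star> [:0,1:]" by simp
    have "z \<star> (q \<star> [:0,1:]) = q \<star> [:0,1:] \<star> z"
    proof -
      have "z \<star> (q \<star> [:0,1:]) = q \<star> (z \<star> [:0,1:])"
        by (simp only: sk.mult_assoc[symmetric] pCons)
      also have "z \<star> [:0,1:] = [:0,1:] \<star> z" using assms(2) by simp
      finally show ?thesis by (simp only: sk.mult_assoc)
    qed
    then show ?case using assms(1) by (simp only: eq sk.distrib_left sk.distrib_right) simp
  qed simp
qed

lemma center_0 [simp]: "0 \<in> Z" and center_1 [simp]: "[:1:] \<in> Z"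
  by (auto simp: mem_center)

lemma center_add: "a \<in> Z \<Longrightarrow> b \<in> Z \<Longrightarrow> a + b \<in> Z"
  by (auto simp: mem_center sk.distrib_left sk.distrib_right)

lemma center_minus: "a \<in> Z \<Longrightarrow> - a \<in> Z"
  by (auto simp: mem_center)

lemma center_diff: "a \<in> Z \<Longrightarrow> b \<in> Z \<Longrightarrow> a - b \<in> Z"
  using center_add[of a "- b"] center_minus[of b] by simp

lemma center_mult: "a \<in> Z \<Longrightarrow> b \<in> Z \<Longrightarrow> a \<star> b \<in> Z"
  unfolding mem_center by (metis sk.mult_assoc)

lemma center_sum: "(\<And>i. i \<in> A \<Longrightarrow> f i \<in> Z) \<Longrightarrow> sum f A \<in> Z"
  by (induction A rule: infinite_finite_induct) (auto simp: center_add)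

lemma center_power: "a \<in> Z \<Longrightarrow> sk.power a n \<in> Z"
  by (induction n) (auto simp: center_mult)

lemma center_const: "a \<in> const_field \<delta> \<Longrightarrow> [:a:] \<in> Z"
  by (rule centerI)
    (auto simp: const_field_def Const_def mem_base_field poly_eq_iff coeff_skew_t coeff_pCons split: nat.split)

lemma center_constD: "[:a:] \<in> Z \<Longrightarrow> a \<in> const_field \<delta>"
proof -
  assume a: "[:a:] \<in> Z"
  have "a * y = y * a" for y
    using center_commute[OF a, of "[:y:]"] by (simp add: map_poly_pCons)
  moreover have "coeff ([:a:] \<star> [:0,1:]) 0 = coeff ([:0,1:] \<star> [:a:]) 0"
    by (simp only: center_commute[OF a])
  then have "coeff (pCons 0 [:a:]) 0 = coeff (skew_t \<delta> [:a:]) 0" by (simp only: skew_mult_t t_skew_mult)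
  then have "\<delta> a = 0" by (simp add: coeff_skew_t)
  ultimately show ?thesis by (simp add: const_field_def Const_def mem_base_field)
qed

lemma degree_der_le: "degree (skew_t \<delta> r - pCons 0 r) \<le> degree r"
  by (rule degree_le) (simp add: skew_t_def coeff_map_poly coeff_eq_0)

text \<open>Commuting \<open>a = s \<star> b + r\<close> with \<open>y\<close> gives
  \<open>[s,y] b + [r,y] = 0\<close>. For \<open>y\<close> in \<open>D\<close> and for
  \<open>y = t\<close> the commutator with \<open>r\<close> has degree at most that of
  \<open>r\<close>, so uniqueness of division makes both commutators vanish; these \<open>y\<close>
  suffice by \<open>centerI\<close>.\<close>

lemma skew_division_center:
  assumes "a \<in> Z" "b \<in> Z" "b \<noteq> 0" "a = s \<star> b + r" "r = 0 \<or> degree r < degree b"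
  shows "s \<in> Z \<and> r \<in> Z"
proof -
  have eq: "(s \<star> y - y \<star> s) \<star> b + (r \<star> y - y \<star> r) = 0" for y
  proof -
    have "(s \<star> b + r) \<star> y = y \<star> (s \<star> b + r)" using assms(1,4) center_commute by auto
    moreover have "s \<star> b \<star> y = s \<star> y \<star> b" using center_commute[OF assms(2)] by (simp add: sk.mult_assoc)
    ultimately show ?thesis
      by (simp add: sk.left_diff_distrib sk.distrib_left sk.distrib_right sk.mult_assoc)
        (simp add: algebra_simps)
  qed
  have 1: "s \<star> [:c:] - [:c:] \<star> s = 0 \<and> r \<star> [:c:] - [:c:] \<star> r = 0" for c
  proof (rule skew_division_unique[OF eq _ assms(3)])
    have "degree (r \<star> [:c:] - [:c:] \<star> r) \<le> degree r"
      using degree_skew_mult_le[of r "[:c:]"] degree_skew_mult_le[of "[:c:]" r]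
      by (intro degree_diff_le) auto
    then show "r \<star> [:c:] - [:c:] \<star> r = 0 \<or> degree (r \<star> [:c:] - [:c:] \<star> r) < degree b"
      using assms(5) by auto
  qed
  have 2: "s \<star> [:0,1:] - [:0,1:] \<star> s = 0 \<and> r \<star> [:0,1:] - [:0,1:] \<star> r = 0"
  proof (rule skew_division_unique[OF eq _ assms(3)])
    have "degree (skew_t \<delta> r - pCons 0 r) = degree (r \<star> [:0,1:] - [:0,1:] \<star> r)"
      by (simp only: skew_mult_t t_skew_mult degree_minus[symmetric, of "pCons 0 r - _"] minus_diff_eq)
    then show "r \<star> [:0,1:] - [:0,1:] \<star> r = 0 \<or> degree (r \<star> [:0,1:] - [:0,1:] \<star> r) < degree b"
      using assms(5) degree_der_le[of r] by auto
  qed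
  show ?thesis using 1 2 by (auto intro!: centerI)
qed

text \<open>
  The monic element of least degree vanishing on the center has central constant coefficients, as
  otherwise a commutator with \<open>D\<close> or with \<open>t\<close> would vanish there and have smaller degree.
\<close>

lemma degree_annihilator_base_field:
  assumes "min_poly_der \<delta> g" "r \<noteq> 0" "\<And>z. z \<in> base_field \<Longrightarrow> poly_in_der r \<delta> z = 0"
  shows "degree g \<le> degree r"
proof -
  define P where "P r \<longleftrightarrow> r \<noteq> 0 \<and> (\<forall>z\<in>base_field. poly_in_der r \<delta> z = 0)" for r
  have "P r" using assms by (simp add: P_def)
  then obtain u where u: "P u" and min: "\<And>v. P v \<Longrightarrow> degree u \<le> degree v"
    using ex_has_least_nat[of P r degree] by blast
  define v where "v = scale (inverse (lead_coeff u)) u"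
  have u0: "u \<noteq> 0" using u by (simp add: P_def)
  have dv: "degree v = degree u"
    unfolding v_def using u0 by (intro degree_map_poly) auto
  have lv: "coeff v (degree u) = 1" using u0 by (simp add: v_def)
  have v0: "v \<noteq> 0" using lv by auto
  have vz: "poly_in_der v \<delta> z = 0" if "z \<in> base_field" for z
    using u that by (simp add: P_def v_def poly_in_der_scale)
  have zero: "w = 0" if "\<And>z. z \<in> base_field \<Longrightarrow> poly_in_der w \<delta> z = 0" "degree w \<le> degree u" "coeff w (degree u) = 0" for w
  proof (rule ccontr)
    assume "w \<noteq> 0"
    then have "P w" using that by (simp add: P_def)
    then have "degree w = degree u" using min that(2) by force
    then show False using that(3) \<open>w \<noteq> 0\<close> by (metis leading_coeff_0_iff)
  qed
  have "coeff v i \<in> const_field \<delta>" for i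
  proof -
    have "coeff v i * b = b * coeff v i" for b
    proof -
      \<comment> \<open>The coefficientwise commutator of \<open>v\<close> with \<open>b\<close>. On
        central \<open>z\<close> it acts as the commutator of
        \<open>poly_in_der v \<delta> z\<close> with \<open>b\<close>, because \<open>b\<close>
        commutes with every \<open>(\<delta> ^^ n) z\<close>.\<close>
      define w where "w = map_poly (\<lambda>c. c * b) v - scale b v"
      have cw: "coeff w n = coeff v n * b - b * coeff v n" for n
        by (simp add: w_def coeff_map_poly)
      have dw: "degree w \<le> degree u"
        by (rule degree_le) (auto simp: cw dv[symmetric] coeff_eq_0)
      have "w = 0"
      proof (rule zero)
        fix z :: 'a assume z: "z \<in> base_field"
        have bz: "b * (\<delta> ^^ n) z = (\<delta> ^^ n) z * b" for n
          using der_pow_base_field[OF z, of n] by (simp add: mem_base_field)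
        have "poly_in_der w \<delta> z = poly_in_der v \<delta> z * b - b * poly_in_der v \<delta> z"
          using dw by (simp add: poly_in_der_eq_sum[of _ "degree u"] dv cw sum_distrib_left sum_distrib_right
            left_diff_distrib sum_subtractf mult.assoc bz)
        then show "poly_in_der w \<delta> z = 0" using vz[OF z] by simp
      qed (use dw lv in \<open>auto simp: cw\<close>)
      then show ?thesis using cw[of i] by simp
    qed
    moreover have "\<delta> (coeff v i) = 0"
    proof -
      \<comment> \<open>This is \<open>t v - v t\<close>, which applies \<open>\<delta>\<close> to
        each coefficient. It vanishes on central \<open>z\<close> because \<open>\<delta> z\<close>
        is central again.\<close>
      define w where "w = skew_t \<delta> v - pCons 0 v"
      have cw: "coeff w n = \<delta> (coeff v n)" for n
        by (simp add: w_def skew_t_def coeff_map_poly)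
      have "w = 0"
      proof (rule zero)
        fix z :: 'a assume z: "z \<in> base_field"
        have "poly_in_der w \<delta> z = poly_in_der ([:0,1:] \<star> v) \<delta> z - poly_in_der (v \<star> [:0,1:]) \<delta> z"
          by (simp add: w_def poly_in_der_diff)
        also have "\<dots> = 0"
          using vz[OF z] vz[OF der_base_field[OF z]]
          unfolding poly_in_der_skew_mult by (simp add: poly_in_der_def)
        finally show "poly_in_der w \<delta> z = 0" .
      qed (use degree_der_le[of v] dv lv in \<open>auto simp: cw, simp add: w_def\<close>)
      then show ?thesis using cw[of i] by simp
    qed
    ultimately show ?thesis by (simp add: const_field_def Const_def mem_base_field)
  qed
  then have "degree g \<le> degree v"
    using assms(1) v0 vz by (auto simp: min_poly_der_def polys_over_def)
  also have "degree v \<le> degree r" using dv min \<open>P r\<close> by simp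
  finally show ?thesis .
qed

text \<open>The Leibniz rule \<open>t^n z = \<Sum> (n choose k) \<delta>^(n-k)(z) t^k\<close>, by
  Pascal's recursion.\<close>

lemma coeff_skew_t_pow_const: "coeff ((skew_t \<delta> ^^ n) [:z:]) k = of_nat (n choose k) * (\<delta> ^^ (n - k)) z"
proof (induction n arbitrary: k)
  case (Suc n)
  have dn: "\<delta> (of_nat k * y) = of_nat k * \<delta> y" for k y
    by (induction k) (auto simp: distrib_right)
  show ?case
  proof (cases k)
    case (Suc j)
    \<comment> \<open>For \<open>j \<ge> n\<close> truncated subtraction makes the two operators
      differ, but then the binomial coefficient is zero.\<close>
    have "of_nat (n choose Suc j) * \<delta> ((\<delta> ^^ (n - Suc j)) z) = of_nat (n choose Suc j) * (\<delta> ^^ (n - j)) z"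
    proof (cases "j < n")
      case True
      then have "n - j = Suc (n - Suc j)" by simp
      then show ?thesis by simp
    qed (simp add: binomial_eq_0)
    then show ?thesis using Suc.IH Suc by (simp add: coeff_skew_t dn distrib_right)
  qed (simp add: Suc.IH coeff_skew_t dn)
qed (simp add: coeff_pCons split: nat.split)

end

section \<open>The central element \<open>x\<close>, and the center as \<open>F[x]\<close>\<close>

locale center_algebraic_derivation = derivation_ring \<delta>
  for \<delta> :: "'a::division_ring \<Rightarrow> 'a" +
  fixes p e :: nat and c :: "nat \<Rightarrow> 'a" and d0 :: 'a and g x :: "'a poly"
  assumes prime_p: "prime p" and char: "CHAR('a) = p"
    and g_def: "g = (\<Sum>i\<le>e. monom (c i) (p ^ (e - i)))"
    and c0: "c 0 = 1" and c_const: "\<And>i. i \<le> e \<Longrightarrow> c i \<in> const_field \<delta>"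
    and min_g: "min_poly_der \<delta> g"
    and inner: "\<And>z. poly_in_der g \<delta> z = d0 * z - z * d0" and d0_const: "\<delta> d0 = 0"
    and x_def: "x = g - [:d0:]"
begin

lemma coeff_g: "coeff g n \<in> const_field \<delta>"
  using min_g by (simp add: min_poly_der_def polys_over_def)

lemma g_scale_commute: "(\<Sum>i\<le>e. monom (c i * z) (p ^ (e - i))) = scale z g"
proof -
  have "scale z (monom (c i) (p ^ (e - i))) = monom (c i * z) (p ^ (e - i))" if "i \<le> e" for i
    using c_const[OF that] by (auto simp: poly_eq_iff const_field_def mem_base_field)
  then show ?thesis by (simp add: g_def scale_sum)
qed

lemma degree_g: "degree g = p ^ e"
proof (rule antisym)
  have p: "p > 1" using prime_p prime_gt_1_nat by auto
  show "degree g \<le> p ^ e" unfolding g_def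
  proof (rule degree_sum_le)
    fix i assume "i \<in> {..e}"
    have "degree (monom (c i) (p ^ (e - i))) \<le> p ^ (e - i)" by (rule degree_monom_le)
    also have "\<dots> \<le> p ^ e" using p by (intro power_increasing) auto
    finally show "degree (monom (c i) (p ^ (e - i))) \<le> p ^ e" .
  qed simp
  have "coeff g (p ^ e) = (\<Sum>i\<le>e. if i = 0 then c i else 0)"
    unfolding g_def coeff_sum using p by (intro sum.cong) auto
  then have "coeff g (p ^ e) = 1" by (simp add: c0)
  then show "p ^ e \<le> degree g" by (intro le_degree) simp
qed

lemma lead_g: "lead_coeff g = 1"
  using min_g by (simp add: min_poly_der_def)

lemma p_pow_pos: "0 < p ^ e"
  using prime_p prime_gt_0_nat by auto

lemma degree_x: "degree x = p ^ e" and lead_x: "lead_coeff x = 1"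
proof -
  have "coeff x n = coeff g n" if "n > 0" for n
    using that by (simp add: x_def coeff_pCons split: nat.split)
  then have c: "coeff x (p ^ e) = 1" and "\<And>n. n > p ^ e \<Longrightarrow> coeff x n = 0"
    using p_pow_pos lead_g by (auto simp: degree_g coeff_eq_0)
  then show "degree x = p ^ e" by (intro antisym degree_le le_degree) auto
  then show "lead_coeff x = 1" using c by simp
qed

lemma x_nonzero [simp]: "x \<noteq> 0"
  using lead_x by auto

text \<open>In the Leibniz rule all inner binomial coefficients vanish in characteristic
  \<open>p\<close>, so only the two extreme terms survive. This is why the exponents of
  \<open>g\<close> being powers of \<open>p\<close> matters.\<close>

lemma skew_t_pow_prime_power:
  "(skew_t \<delta> ^^ (p ^ k)) [:z:] = [:(\<delta> ^^ (p ^ k)) z:] + monom z (p ^ k)"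
proof -
  have p: "p ^ k > 0" using prime_p prime_gt_0_nat by auto
  have "coeff ((skew_t \<delta> ^^ (p ^ k)) [:z:]) i = coeff ([:(\<delta> ^^ (p ^ k)) z:] + monom z (p ^ k)) i" for i
  proof -
    consider "i = 0" | "0 < i" "i < p ^ k" | "i = p ^ k" | "i > p ^ k" by linarith
    then show ?thesis
      using p of_nat_prime_power_choose_eq_0[OF prime_p char, of i k]
      by cases (auto simp: coeff_skew_t_pow_const coeff_pCons binomial_eq_0 split: nat.splits)
  qed
  then show ?thesis by (simp add: poly_eq_iff)
qed

text \<open>The previous lemma gives \<open>g z = z g + g(\<delta>)(z)\<close>, and
  \<open>g(\<delta>)(z) = d0 z - z d0\<close> is exactly the defect removed by subtracting
  \<open>d0\<close>. Commutation with \<open>t\<close> holds because all coefficients of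
  \<open>x\<close> are constants of \<open>\<delta>\<close>.\<close>

lemma x_center: "x \<in> Z"
proof (rule centerI)
  fix z
  have "g \<star> [:z:] = (\<Sum>i\<le>e. scale (c i) (monom 1 (p ^ (e - i)) \<star> [:z:]))"
    unfolding g_def sum_skew_mult
  proof (intro sum.cong refl)
    fix i
    have "monom (c i) (p ^ (e - i)) = scale (c i) (monom 1 (p ^ (e - i)))" by (auto simp: poly_eq_iff)
    then show "monom (c i) (p ^ (e - i)) \<star> [:z:] = scale (c i) (monom 1 (p ^ (e - i)) \<star> [:z:])"
      by (simp add: scale_skew_mult)
  qed
  also have "\<dots> = (\<Sum>i\<le>e. [:c i * (\<delta> ^^ (p ^ (e - i))) z:]) + (\<Sum>i\<le>e. monom (c i * z) (p ^ (e - i)))"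
  proof -
    have "scale a ([:b:] + monom z n) = [:a * b:] + monom (a * z) n" for a b n
      by (auto simp: poly_eq_iff coeff_pCons distrib_left split: nat.split)
    then show ?thesis
      by (simp add: monom_skew_mult skew_t_pow_prime_power sum.distrib)
  qed
  also have "(\<Sum>i\<le>e. [:c i * (\<delta> ^^ (p ^ (e - i))) z:]) = [:poly_in_der g \<delta> z:]"
    by (auto simp: g_def poly_in_der_sum poly_in_der_monom poly_eq_iff coeff_sum coeff_pCons split: nat.split)
  finally have "g \<star> [:z:] = [:d0 * z - z * d0:] + scale z g" by (simp add: g_scale_commute inner)
  then have "x \<star> [:z:] = [:d0 * z - z * d0:] + scale z g - [:d0:] \<star> [:z:]"
    by (simp add: x_def sk.left_diff_distrib)
  then show "x \<star> [:z:] = scale z x"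
    by (auto simp: poly_eq_iff x_def coeff_pCons right_diff_distrib split: nat.split)
next
  have "\<delta> (coeff x n) = 0" for n
    using coeff_g[of n] d0_const
    by (auto simp: x_def coeff_pCons const_field_def Const_def split: nat.split)
  then show "pCons 0 x = skew_t \<delta> x"
    by (simp add: poly_eq_iff coeff_skew_t coeff_pCons)
qed

text \<open>Let \<open>r z = z r\<close> act on \<open>1\<close>: then
  \<open>r(\<delta>)(z) = z r_0\<close> with \<open>r_0\<close> the constant coefficient. So
  \<open>r - r_0\<close> annihilates the center of \<open>D\<close>, and a nonzero annihilator has
  degree at least \<open>p ^ e\<close>.\<close>

lemma center_low_degree:
  assumes "r \<in> Z" "degree r < p ^ e"
  obtains a where "a \<in> const_field \<delta>" "r = [:a:]"
proof -
  have "r - [:coeff r 0:] = 0"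
  proof (rule ccontr)
    assume nz: "r - [:coeff r 0:] \<noteq> 0"
    have "degree g \<le> degree (r - [:coeff r 0:])"
    proof (rule degree_annihilator_base_field[OF min_g nz])
      fix z :: 'a assume z: "z \<in> base_field"
      have r1: "poly_in_der r \<delta> 1 = coeff r 0"
      proof -
        have "(\<delta> ^^ i) 1 = (if i = 0 then 1 else 0)" for i
          by (induction i) auto
        then have "poly_in_der r \<delta> 1 = (\<Sum>i\<le>degree r. if i = 0 then coeff r i else 0)"
          unfolding poly_in_der_def by (intro sum.cong) auto
        then show ?thesis by simp
      qed
      have "poly_in_der r \<delta> z = poly_in_der (r \<star> [:z:]) \<delta> 1"
        by (simp add: poly_in_der_skew_mult)
      also have "\<dots> = poly_in_der ([:z:] \<star> r) \<delta> 1" using center_commute[OF assms(1)] by simp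
      also have "\<dots> = z * coeff r 0" by (simp add: poly_in_der_scale r1)
      also have "\<dots> = coeff r 0 * z" using z by (simp add: mem_base_field)
      finally show "poly_in_der (r - [:coeff r 0:]) \<delta> z = 0" by (simp add: poly_in_der_diff)
    qed
    moreover have "degree (r - [:coeff r 0:]) < p ^ e"
      using assms(2) degree_diff_le[of r "degree r" "[:coeff r 0:]"] by simp
    ultimately show False by (simp add: degree_g)
  qed
  then have r: "r = [:coeff r 0:]" by simp
  then have "coeff r 0 \<in> const_field \<delta>" using center_constD assms(1) by metis
  then show ?thesis using that r by blast
qed

lemma nat_pow_eq_power: "y [^]\<^bsub>skew_poly_ring \<delta>\<^esub> (n::nat) = sk.power y n"
proof (induction n)
  case (Suc n)
  have "y [^]\<^bsub>skew_poly_ring \<delta>\<^esub> Suc n = y [^]\<^bsub>skew_poly_ring \<delta>\<^esub> n \<star> y"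
    by (simp add: nat_pow_def skew_poly_ring_def)
  then show ?case using Suc sk.power_commutes by simp
qed (simp add: nat_pow_def skew_poly_ring_def)

lemma skew_eval_eq_sum:
  assumes "degree q \<le> n"
  shows "skew_eval \<delta> x q = (\<Sum>i\<le>n. scale (coeff q i) (sk.power x i))"
proof -
  have "skew_eval \<delta> x q = (\<Sum>i\<le>degree q. scale (coeff q i) (sk.power x i))"
    by (simp add: skew_eval_def nat_pow_eq_power skew_poly_ring_simps)
  also have "\<dots> = (\<Sum>i\<le>n. scale (coeff q i) (sk.power x i))"
    by (rule sum.mono_neutral_left) (use assms in \<open>auto simp: coeff_eq_0\<close>)
  finally show ?thesis .
qed

lemma skew_eval_pCons: "skew_eval \<delta> x (pCons a q) = [:a:] + skew_eval \<delta> x q \<star> x"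
proof -
  have "skew_eval \<delta> x (pCons a q) = (\<Sum>i\<le>Suc (degree q). scale (coeff (pCons a q) i) (sk.power x i))"
    by (rule skew_eval_eq_sum) (rule degree_pCons_le)
  also have "\<dots> = [:a:] + (\<Sum>i\<le>degree q. scale (coeff q i) (sk.power x i)) \<star> x"
    by (subst sum.atMost_Suc_shift) (simp add: sum_skew_mult scale_skew_mult sk.power_commutes map_poly_pCons)
  finally show ?thesis by (simp add: skew_eval_eq_sum[of q "degree q"])
qed

lemma skew_eval_0 [simp]: "skew_eval \<delta> x 0 = 0"
  by (simp add: skew_eval_eq_sum[of 0 0])

lemma polys_over_const_pCons:
  "pCons a q \<in> polys_over (const_field \<delta>) \<longleftrightarrow> a \<in> const_field \<delta> \<and> q \<in> polys_over (const_field \<delta>)"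
  by (auto simp: polys_over_def coeff_pCons split: nat.splits) 

lemma skew_eval_center: "q \<in> polys_over (const_field \<delta>) \<Longrightarrow> skew_eval \<delta> x q \<in> Z"
  by (induction q) (auto simp: skew_eval_pCons polys_over_const_pCons intro!: center_add center_mult center_const x_center)

text \<open>Converts degrees in \<open>x\<close> to degrees in \<open>t\<close>. No cancellation
  occurs in the Horner step, since a multiple of \<open>x\<close> by a nonzero element has positive
  degree and the added term is constant.\<close>

lemma degree_skew_eval: "q \<noteq> 0 \<Longrightarrow> skew_eval \<delta> x q \<noteq> 0 \<and> degree (skew_eval \<delta> x q) = p ^ e * degree q"
proof (induction q)
  case (pCons a q)
  show ?case
  proof (cases "q = 0")
    case True
    then show ?thesis using pCons by (simp add: skew_eval_pCons)
  next
    case False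
    then have IH: "skew_eval \<delta> x q \<noteq> 0" "degree (skew_eval \<delta> x q) = p ^ e * degree q"
      using pCons by auto
    have d: "degree (skew_eval \<delta> x q \<star> x) = p ^ e * Suc (degree q)"
      using IH by (simp add: degree_skew_mult degree_x)
    then have "degree ([:a:] + skew_eval \<delta> x q \<star> x) = p ^ e * Suc (degree q)"
      using p_pow_pos by (subst degree_add_eq_right) auto
    then show ?thesis using False p_pow_pos by (auto simp: skew_eval_pCons)
  qed
qed simp

text \<open>Divide a central element by \<open>x\<close>: quotient and remainder are central, and
  the remainder, of degree below \<open>p ^ e\<close>, is a constant in \<open>F\<close>. Induction
  applies to the quotient.\<close>

lemma center_eq_central_polys: "Z = central_polys \<delta> x"
proof
  show "central_polys \<delta> x \<subseteq> Z" by (auto simp: central_polys_def skew_eval_center)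
  have "z \<in> Z \<Longrightarrow> \<exists>q\<in>polys_over (const_field \<delta>). z = skew_eval \<delta> x q" for z
  proof (induction "degree z" arbitrary: z rule: less_induct)
    case less
    obtain s r where sr: "z = s \<star> x + r" "r = 0 \<or> degree r < degree x"
      using skew_division[of x z] by auto
    then have Z: "s \<in> Z" "r \<in> Z" using skew_division_center[OF less(2) x_center] by auto
    obtain a where a: "a \<in> const_field \<delta>" "r = [:a:]"
      using center_low_degree[OF Z(2)] sr(2) p_pow_pos by (auto simp: degree_x)
    show ?case
    proof (cases "s = 0")
      case True
      moreover have "0 \<in> polys_over (const_field \<delta>)" by (simp add: polys_over_def)
      ultimately show ?thesis using a sr
        by (intro bexI[of _ "[:a:]"]) (auto simp: skew_eval_pCons polys_over_const_pCons)
    next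
      case False
      have "degree z = degree s + p ^ e"
        using False p_pow_pos by (simp add: sr(1) a(2) degree_add_eq_left degree_skew_mult degree_x)
      then have "degree s < degree z" using p_pow_pos by simp
      from less(1)[OF this Z(1)] obtain q where "q \<in> polys_over (const_field \<delta>)" "s = skew_eval \<delta> x q" by auto
      then show ?thesis using a sr
        by (intro bexI[of _ "pCons a q"]) (auto simp: skew_eval_pCons polys_over_const_pCons add.commute)
    qed
  qed
  then show "Z \<subseteq> central_polys \<delta> x" by (auto simp: central_polys_def)
qed

end

section \<open>Linear dependence over the constants\<close>

text \<open>Gaussian elimination with the unknowns as left coefficients. \<open>F\<close> is a
  division subring given as a set, so the lemma serves both for the constants inside
  \<open>D\<close> and for a whole field.\<close>

lemma homogeneous_system_nontrivial:
  fixes A :: "'i \<Rightarrow> 'j \<Rightarrow> 'a::division_ring"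
  assumes F: "0 \<in> F" "1 \<in> F" "\<And>a b. a \<in> F \<Longrightarrow> b \<in> F \<Longrightarrow> a + b \<in> F" "\<And>a b. a \<in> F \<Longrightarrow> b \<in> F \<Longrightarrow> a * b \<in> F"
      "\<And>a. a \<in> F \<Longrightarrow> - a \<in> F" "\<And>a. a \<in> F \<Longrightarrow> inverse a \<in> F"
    and "finite J" "finite I" "card J < card I"
    and "\<And>i j. i \<in> I \<Longrightarrow> j \<in> J \<Longrightarrow> A i j \<in> F"
  obtains c where "\<And>i. i \<in> I \<Longrightarrow> c i \<in> F" "\<exists>i\<in>I. c i \<noteq> 0" "\<And>j. j \<in> J \<Longrightarrow> (\<Sum>i\<in>I. c i * A i j) = 0"
proof -
  have F_sum: "(\<And>i. i \<in> I \<Longrightarrow> f i \<in> F) \<Longrightarrow> sum f I \<in> F" for f :: "'i \<Rightarrow> 'a" and I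
    by (induction I rule: infinite_finite_induct) (auto simp: F)
  have "\<exists>c. (\<forall>i\<in>I. c i \<in> F) \<and> (\<exists>i\<in>I. c i \<noteq> 0) \<and> (\<forall>j\<in>J. (\<Sum>i\<in>I. c i * A i j) = 0)"
    using assms(7-10)
  proof (induction J arbitrary: I A rule: finite_induct)
    case empty
    then have "I \<noteq> {}" by auto
    then show ?case using F by (intro exI[of _ "\<lambda>_. 1"]) auto
  next
    case (insert l J)
    show ?case
    proof (cases "\<forall>i\<in>I. A i l = 0")
      case True
      have "\<exists>c. (\<forall>i\<in>I. c i \<in> F) \<and> (\<exists>i\<in>I. c i \<noteq> 0) \<and> (\<forall>j\<in>J. (\<Sum>i\<in>I. c i * A i j) = 0)"
        using insert by (intro insert.IH) auto
      then show ?thesis using True by auto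
    next
      case False
      then obtain k where k: "k \<in> I" "A k l \<noteq> 0" by auto
      define I' where "I' = I - {k}"
      define A' where "A' i j = A i j + (- (A i l * inverse (A k l))) * A k j" for i j
      have I': "I = insert k I'" "k \<notin> I'" "finite I'" using k insert.prems by (auto simp: I'_def)
      have "\<exists>c. (\<forall>i\<in>I'. c i \<in> F) \<and> (\<exists>i\<in>I'. c i \<noteq> 0) \<and> (\<forall>j\<in>J. (\<Sum>i\<in>I'. c i * A' i j) = 0)"
      proof (rule insert.IH)
        show "A' i j \<in> F" if "i \<in> I'" "j \<in> J" for i j
          unfolding A'_def using that insert.prems(3) k by (intro F) (auto simp: I'_def)
      qed (use insert.prems insert.hyps I' in auto)
      then obtain c where c: "\<And>i. i \<in> I' \<Longrightarrow> c i \<in> F" "\<exists>i\<in>I'. c i \<noteq> 0"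
        "\<And>j. j \<in> J \<Longrightarrow> (\<Sum>i\<in>I'. c i * A' i j) = 0" by auto
      \<comment> \<open>Back substitution: equation \<open>l\<close> solved for the unknown of the
        pivot \<open>k\<close>.\<close>
      define ck where "ck = (\<Sum>i\<in>I'. - (c i * A i l * inverse (A k l)))"
      define c' where "c' = c(k := ck)"
      have c'k: "c' k = ck" and c'i: "i \<in> I' \<Longrightarrow> c' i = c i" for i
        using I' by (auto simp: c'_def)
      have ckF: "ck \<in> F" unfolding ck_def
        using insert.prems(3) k c(1) by (intro F_sum F) (auto simp: I'_def)
      have sum': "(\<Sum>i\<in>I. c' i * A i j) = ck * A k j + (\<Sum>i\<in>I'. c i * A i j)" for j
        using I' c'i by (simp add: c'k)
      have "(\<Sum>i\<in>I. c' i * A i l) = 0"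
        using k(2) by (simp add: sum' ck_def sum_distrib_right mult.assoc sum_negf)
      moreover have "(\<Sum>i\<in>I. c' i * A i j) = 0" if "j \<in> J" for j
      proof -
        have "(\<Sum>i\<in>I'. c i * A' i j) = (\<Sum>i\<in>I. c' i * A i j)"
          by (simp add: sum' ck_def A'_def sum_distrib_right right_diff_distrib mult.assoc sum_subtractf sum_negf)
        then show ?thesis using c(3)[OF that] by simp
      qed
      moreover have "\<forall>i\<in>I. c' i \<in> F" using c(1) ckF I' by (auto simp: c'_def)
      moreover have "\<exists>i\<in>I. c' i \<noteq> 0" using c(2) c'i I' by auto
      ultimately show ?thesis by blast
    qed
  qed
  then show ?thesis using that by blast
qed

lemma ring_of_division_ring: "ring (ring_of_type_algebra :: 'a::division_ring ring)"
proof -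
  have "\<exists>y. x + y = 0" for x :: 'a
    using add.right_inverse by blast
  then show ?thesis
    unfolding ring_of_type_algebra_def using add.right_inverse
    by unfold_locales (auto simp: algebra_simps Units_def)
qed

text \<open>Turns the inductive notion of dimension into explicit coordinates: each line extension
  contributes one more spanning vector.\<close>

lemma central_division_algebra_spanning:
  assumes "central_division_algebra_degree TYPE('a::division_ring) d"
  obtains v :: "nat \<Rightarrow> 'a::division_ring" where "\<And>z. \<exists>a. (\<forall>i<d\<^sup>2. a i \<in> base_field) \<and> z = (\<Sum>i<d\<^sup>2. a i * v i)"
proof -
  let ?R = "ring_of_type_algebra :: 'a ring"
  interpret D: ring ?R by (rule ring_of_division_ring)
  have "D.dimension n (base_field :: 'a set) E \<Longrightarrow>
    \<exists>v. \<forall>z\<in>E. \<exists>a. (\<forall>i<n. a i \<in> base_field) \<and> z = (\<Sum>i<n. a i * v i)" for n E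
  proof (induction n "base_field :: 'a set" E rule: D.dimension.induct)
    case zero_dim
    then show ?case by (simp add: ring_of_type_algebra_def)
  next
    case (Suc_dim u E n)
    then obtain v where v: "\<And>z. z \<in> E \<Longrightarrow> \<exists>a. (\<forall>i<n. a i \<in> base_field) \<and> z = (\<Sum>i<n. a i * v i)"
      by blast
    have "\<exists>a. (\<forall>i<Suc n. a i \<in> base_field) \<and> z = (\<Sum>i<Suc n. a i * (v(n := u)) i)"
      if z: "z \<in> D.line_extension base_field u E" for z
    proof -
      from z obtain k w where kw: "k \<in> base_field" "w \<in> E" "z = k * u + w"
        unfolding D.line_extension_def set_add_def set_mult_def r_coset_def
        by (auto simp: ring_of_type_algebra_def)
      then obtain a where a: "\<forall>i<n. a i \<in> base_field" "w = (\<Sum>i<n. a i * v i)" using v by blast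
      then show ?thesis using kw
        by (intro exI[of _ "a(n := k)"]) (auto simp: less_Suc_eq add.commute)
    qed
    then show ?case by blast
  qed
  from this[OF assms[unfolded central_division_algebra_degree_def]] show ?thesis
    using that by blast
qed

context derivation_ring
begin

text \<open>An operator of order \<open>degree r\<close> has at most that many solutions independent
  over the constants. Split off a right factor \<open>t - b\<close> killing one solution
  \<open>z\<close>. It maps the other solutions to solutions of the left factor, which are dependent
  by induction; the same combination \<open>y\<close> of the original solutions satisfies
  \<open>\<delta> y = b y\<close> and is thus a constant multiple of \<open>z\<close>.\<close>

lemma annihilated_dependent:
  assumes "r \<noteq> 0" "finite I" "degree r < card I"
    and "\<And>i. i \<in> I \<Longrightarrow> u i \<in> base_field" "\<And>i. i \<in> I \<Longrightarrow> poly_in_der r \<delta> (u i) = 0"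
  shows "\<exists>c. (\<forall>i\<in>I. c i \<in> const_field \<delta>) \<and> (\<exists>i\<in>I. c i \<noteq> 0) \<and> (\<Sum>i\<in>I. c i * u i) = 0"
  using assms
proof (induction "degree r" arbitrary: r I u rule: less_induct)
  case less
  show ?case
  proof (cases "\<exists>k\<in>I. u k = 0")
    case True
    then obtain k where k: "k \<in> I" "u k = 0" by auto
    have "(\<Sum>i\<in>I. (if i = k then 1 else 0) * u i) = (\<Sum>i\<in>I. if i = k then u i else 0)"
      by (intro sum.cong) auto
    then show ?thesis using k less.prems(2) by (intro exI[of _ "\<lambda>i. if i = k then 1 else 0"]) auto
  next
    case False
    obtain k where k: "k \<in> I" using less.prems(3) by fastforce
    define z where "z = u k"
    define I' where "I' = I - {k}"
    have I': "I = insert k I'" "k \<notin> I'" "finite I'" using k less.prems(2) by (auto simp: I'_def)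
    have z: "z \<noteq> 0" "z \<in> base_field" using False k less.prems by (auto simp: z_def)
    \<comment> \<open>The logarithmic derivative of \<open>z\<close>, so that \<open>t - b\<close>
      annihilates \<open>z\<close>. The remainder of \<open>r\<close> on division by
      \<open>t - b\<close> is a constant that still annihilates \<open>z\<close>, hence
      zero.\<close>
    define b where "b = \<delta> z * inverse z"
    have b: "b \<in> base_field" using z by (auto simp: b_def intro!: base_field_closed der_base_field)
    have act: "poly_in_der [:- b, 1:] \<delta> y = \<delta> y - b * y" for y
      by (simp add: poly_in_der_def)
    obtain s \<rho> where s: "r = s \<star> [:- b, 1:] + \<rho>" "\<rho> = 0 \<or> degree \<rho> < degree [:- b, 1:]"
      using skew_division[of "[:- b, 1:]" r] by auto
    have "degree \<rho> = 0" using s(2) by auto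
    then obtain \<rho>0 where \<rho>0: "\<rho> = [:\<rho>0:]" by (rule degree_eq_zeroE)
    have "b * z = \<delta> z" using z by (simp add: b_def mult.assoc)
    then have "poly_in_der r \<delta> z = \<rho>0 * z"
      by (simp add: s(1) \<rho>0 poly_in_der_add poly_in_der_skew_mult act)
        (simp add: poly_in_der_def)
    then have "\<rho> = 0" using less.prems(5)[OF k] z \<rho>0 by (simp add: z_def)
    with s have r: "r = s \<star> [:- b, 1:]" by simp
    then have s0: "s \<noteq> 0" using less.prems(1) by auto
    then have dr: "degree r = Suc (degree s)" by (simp add: r degree_skew_mult)
    define u' where "u' i = \<delta> (u i) - b * u i" for i
    have "\<exists>c. (\<forall>i\<in>I'. c i \<in> const_field \<delta>) \<and> (\<exists>i\<in>I'. c i \<noteq> 0) \<and> (\<Sum>i\<in>I'. c i * u' i) = 0"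
    proof (rule less.hyps)
      show "degree s < card I'" using I' less.prems(3) dr by simp
      fix i assume i: "i \<in> I'"
      then have u: "u i \<in> base_field" using I' less.prems by auto
      then show "u' i \<in> base_field" using b by (auto simp: u'_def intro!: base_field_closed der_base_field)
      show "poly_in_der s \<delta> (u' i) = 0"
        using less.prems(5)[of i] i I' by (simp add: r poly_in_der_skew_mult act u'_def)
    qed (use s0 I' dr in auto)
    then obtain c where c: "\<And>i. i \<in> I' \<Longrightarrow> c i \<in> const_field \<delta>" "\<exists>i\<in>I'. c i \<noteq> 0"
      "(\<Sum>i\<in>I'. c i * u' i) = 0" by auto
    define y where "y = (\<Sum>i\<in>I'. c i * u i)"
    have "(\<Sum>i\<in>I'. c i * u' i) = \<delta> y - b * y"
    proof -
      have "c i * u' i = \<delta> (c i * u i) - b * (c i * u i)" if "i \<in> I'" for i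
        using c(1)[OF that] b
        by (simp add: u'_def der_mult const_field_def Const_def mem_base_field right_diff_distrib)
          (metis mult.assoc)
      then show ?thesis by (simp add: y_def der_sum sum_distrib_left sum_subtractf)
    qed
    then have y: "\<delta> y = b * y" using c(3) by simp
    \<comment> \<open>Variation of constants: \<open>y = z a\<close>, and
      \<open>\<delta> y = b y\<close> forces \<open>\<delta> a = 0\<close>.\<close>
    define a where "a = inverse z * y"
    have yza: "y = z * a" using z by (simp add: a_def mult.assoc[symmetric])
    have "\<delta> y = b * y + z * \<delta> a"
      using z by (simp add: yza der_mult b_def mult.assoc) (simp add: mult.assoc[symmetric])
    then have "\<delta> a = 0" using y z by simp
    have sumC: "(\<And>i. i \<in> K \<Longrightarrow> f i \<in> base_field) \<Longrightarrow> sum f K \<in> base_field" for f and K :: "'b set"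
      by (induction K rule: infinite_finite_induct) (auto simp: mem_base_field distrib_left distrib_right)
    have "y \<in> base_field" unfolding y_def
      using c(1) less.prems(4) I' by (intro sumC base_field_closed) (auto simp: const_field_def)
    then have "a \<in> base_field" using z by (auto simp: a_def intro: base_field_closed)
    with \<open>\<delta> a = 0\<close> have a: "a \<in> const_field \<delta>" by (simp add: const_field_def Const_def)
    have "(\<Sum>i\<in>I. (c(k := - a)) i * u i) = - a * z + (\<Sum>i\<in>I'. (c(k := - a)) i * u i)"
      using I' by (simp add: z_def)
    also have "(\<Sum>i\<in>I'. (c(k := - a)) i * u i) = y"
      unfolding y_def using I' by (intro sum.cong) auto
    also have "- a * z + y = 0" using z by (simp add: yza mem_base_field)
    finally have "(\<Sum>i\<in>I. (c(k := - a)) i * u i) = 0" .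
    moreover have "\<forall>i\<in>I. (c(k := - a)) i \<in> const_field \<delta>" using c(1) a I' by (auto intro: const_field_closed)
    moreover have "\<exists>i\<in>I. (c(k := - a)) i \<noteq> 0" using c(2) I' by auto
    ultimately show ?thesis by blast
  qed
qed

section \<open>Divisibility in the center\<close>

text \<open>Units of \<open>F[x]\<close> are recognised by their degree in \<open>t\<close>: the
  central elements of degree zero are the elements of \<open>F\<close>.\<close>

definition center_irreducible :: "'a poly \<Rightarrow> bool" where
  "center_irreducible h \<longleftrightarrow> h \<in> Z \<and> degree h \<noteq> 0 \<and>
     (\<forall>a\<in>Z. \<forall>b\<in>Z. h = a \<star> b \<longrightarrow> degree a = 0 \<or> degree b = 0)"

lemma center_irreducibleD:
  "center_irreducible h \<Longrightarrow> a \<in> Z \<Longrightarrow> b \<in> Z \<Longrightarrow> h = a \<star> b \<Longrightarrow> degree a = 0 \<or> degree b = 0"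
  unfolding center_irreducible_def by metis

lemma center_unit:
  assumes "u \<in> Z" "u \<noteq> 0" "degree u = 0"
  shows "\<exists>v\<in>Z. v \<star> u = [:1:]"
proof -
  obtain a where a: "u = [:a:]" using assms(3) by (rule degree_eq_zeroE)
  then have "a \<in> const_field \<delta>" using assms center_constD by auto
  then have "[:inverse a:] \<in> Z" by (intro center_const const_field_closed)
  moreover have "[:inverse a:] \<star> u = [:1:]" using assms(2) a by (simp add: map_poly_pCons)
  ultimately show ?thesis by blast
qed

lemma degree_zero_of_unit: "v \<star> u = [:1:] \<Longrightarrow> degree u = 0"
proof -
  assume a: "v \<star> u = [:1:]"
  then have "v \<noteq> 0" "u \<noteq> 0" by auto
  then have "degree v + degree u = degree [:1 :: 'a:]" using a degree_skew_mult by metis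
  then show ?thesis by simp
qed

lemma Units_subcarrier:
  "w \<in> Units ((skew_poly_ring \<delta>)\<lparr>carrier := S\<rparr>) \<longleftrightarrow> w \<in> S \<and> (\<exists>v\<in>S. v \<star> w = [:1:] \<and> w \<star> v = [:1:])"
  by (auto simp: Units_def skew_poly_ring_def)

lemma divides_subcarrier:
  "a divides\<^bsub>(skew_poly_ring \<delta>)\<lparr>carrier := S\<rparr>\<^esub> b \<longleftrightarrow> (\<exists>c\<in>S. b = a \<star> c)"
  by (auto simp: factor_def skew_poly_ring_def)

text \<open>If \<open>u = a \<star> b\<close>, either \<open>u\<close> divides \<open>a\<close>,
  which forces \<open>degree b = 0\<close>, or \<open>a\<close> is a proper factor and hence a unit.
  Conversely, a proper factor has a cofactor that is not a unit.\<close>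

lemma ring_irreducible_iff:
  assumes "u \<in> Z"
  shows "ring_irreducible\<^bsub>(skew_poly_ring \<delta>)\<lparr>carrier := Z\<rparr>\<^esub> u \<longleftrightarrow> center_irreducible u"
proof -
  let ?R = "(skew_poly_ring \<delta>)\<lparr>carrier := Z\<rparr>"
  have units: "w \<in> Units ?R \<longleftrightarrow> w \<noteq> 0 \<and> degree w = 0" if "w \<in> Z" for w
  proof
    assume "w \<in> Units ?R"
    then obtain v where "v \<star> w = [:1:]" unfolding Units_subcarrier by blast
    then show "w \<noteq> 0 \<and> degree w = 0" using degree_zero_of_unit[of v w] by auto
  next
    assume "w \<noteq> 0 \<and> degree w = 0"
    then obtain v where v: "v \<in> Z" "v \<star> w = [:1:]" using center_unit[OF \<open>w \<in> Z\<close>] by blast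
    then have "w \<star> v = [:1:]" using center_commute[OF v(1), of w] by simp
    then show "w \<in> Units ?R" using that v unfolding Units_subcarrier by blast
  qed
  have zero: "\<zero>\<^bsub>?R\<^esub> = 0" by (simp add: skew_poly_ring_def)
  show ?thesis
  proof
    assume irr: "ring_irreducible\<^bsub>?R\<^esub> u"
    then have u: "u \<noteq> 0" "degree u \<noteq> 0"
      using units[OF assms] by (auto simp: ring_irreducible_def Divisibility.irreducible_def zero)
    have "degree a = 0 \<or> degree b = 0" if ab: "a \<in> Z" "b \<in> Z" "u = a \<star> b" for a b
    proof (cases "u divides\<^bsub>?R\<^esub> a")
      case True
      then obtain c where c: "a = u \<star> c" by (auto simp: divides_subcarrier)
      have nz: "a \<noteq> 0" "b \<noteq> 0" using u(1) ab(3) by auto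
      then have "c \<noteq> 0" using c by auto
      then have "degree a = degree u + degree c" using c degree_skew_mult u(1) by metis
      moreover have "degree u = degree a + degree b" using ab(3) degree_skew_mult nz by metis
      ultimately show ?thesis by simp
    next
      case False
      then have "a \<in> Units ?R"
        using irr ab by (auto simp: ring_irreducible_def Divisibility.irreducible_def properfactor_def divides_subcarrier)
      then show ?thesis using units ab by auto
    qed
    then show "center_irreducible u" using u assms by (auto simp: center_irreducible_def)
  next
    assume irr: "center_irreducible u"
    then have u: "u \<noteq> 0" "degree u \<noteq> 0" by (auto simp: center_irreducible_def)
    have "b \<in> Units ?R" if b: "b \<in> Z" "properfactor ?R b u" for b
    proof -
      obtain c where c: "c \<in> Z" "u = b \<star> c" using b by (auto simp: properfactor_def divides_subcarrier)
      have nz: "b \<noteq> 0" "c \<noteq> 0" using c u by auto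
      have "degree c \<noteq> 0"
      proof
        assume "degree c = 0"
        then obtain v where v: "v \<in> Z" "v \<star> c = [:1:]" using center_unit c(1) nz(2) by blast
        then have "b = u \<star> v" using center_commute[OF c(1), of v] by (simp add: c(2) sk.mult_assoc)
        then show False using b v by (auto simp: properfactor_def divides_subcarrier)
      qed
      then have "degree b = 0" using center_irreducibleD[OF irr b(1) c] by simp
      then show ?thesis using units b nz by auto
    qed
    then show "ring_irreducible\<^bsub>?R\<^esub> u"
      using u units[OF assms] by (auto simp: ring_irreducible_def Divisibility.irreducible_def zero)
  qed
qed

text \<open>The combination of \<open>a\<close> and \<open>b\<close> of least degree divides both,
  because division by a central element stays inside \<open>Z\<close>.\<close>

lemma center_gcd:
  assumes "a \<in> Z" "b \<in> Z" "a \<noteq> 0 \<or> b \<noteq> 0"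
  obtains v s t a' b' where "v \<in> Z" "v \<noteq> 0" "s \<in> Z" "t \<in> Z" "v = s \<star> a + t \<star> b"
    "a' \<in> Z" "a = a' \<star> v" "b' \<in> Z" "b = b' \<star> v"
proof -
  define P where "P v \<longleftrightarrow> v \<noteq> 0 \<and> (\<exists>s\<in>Z. \<exists>t\<in>Z. v = s \<star> a + t \<star> b)" for v
  have "P a \<or> P b"
  proof -
    have "a = [:1:] \<star> a + 0 \<star> b" "b = 0 \<star> a + [:1:] \<star> b" by auto
    then show ?thesis using assms(3) center_0 center_1 unfolding P_def by metis
  qed
  then obtain v where v: "P v" and min: "\<And>w. P w \<Longrightarrow> degree v \<le> degree w"
    using ex_has_least_nat[of P _ degree] by blast
  then obtain s t where st: "s \<in> Z" "t \<in> Z" "v = s \<star> a + t \<star> b" "v \<noteq> 0" by (auto simp: P_def)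
  then have vZ: "v \<in> Z" using assms by (auto intro!: center_add center_mult)
  have div: "\<exists>w'\<in>Z. w = w' \<star> v" if w: "s' \<in> Z" "t' \<in> Z" "w = s' \<star> a + t' \<star> b" for w s' t'
  proof -
    have wZ: "w \<in> Z" using w assms by (auto intro!: center_add center_mult)
    obtain k r where kr: "w = k \<star> v + r" "r = 0 \<or> degree r < degree v"
      using skew_division[OF st(4)] by blast
    have kZ: "k \<in> Z" using skew_division_center[OF wZ vZ st(4) kr] by simp
    have "r = (s' - k \<star> s) \<star> a + (t' - k \<star> t) \<star> b"
    proof -
      have "r = w - k \<star> v" using kr(1) by simp
      then show ?thesis
        by (simp add: w(3) st(3) sk.left_diff_distrib sk.distrib_left sk.mult_assoc)
    qed
    moreover have "s' - k \<star> s \<in> Z" "t' - k \<star> t \<in> Z"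
      using w st kZ by (auto intro!: center_diff center_mult)
    ultimately have "r \<noteq> 0 \<Longrightarrow> P r" by (auto simp: P_def)
    then have "r = 0" using min kr(2) by (meson leD)
    then show ?thesis using kr kZ by auto
  qed
  have "a = [:1:] \<star> a + 0 \<star> b" "b = 0 \<star> a + [:1:] \<star> b" by auto
  then have "\<exists>w'\<in>Z. a = w' \<star> v" "\<exists>w'\<in>Z. b = w' \<star> v"
    using div center_0 center_1 by blast+
  then show ?thesis using that vZ st by blast
qed

text \<open>Let \<open>v\<close> be the gcd and \<open>h = b' \<star> v\<close>. If
  \<open>b'\<close> were a unit, \<open>h\<close> would divide \<open>a\<close>; so \<open>v\<close>
  is a unit.\<close>

lemma center_irreducible_coprime:
  assumes "center_irreducible h" "a \<in> Z" "\<not> (\<exists>b\<in>Z. a = b \<star> h)"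
  obtains s t where "s \<in> Z" "t \<in> Z" "s \<star> a + t \<star> h = [:1:]"
proof -
  have h: "h \<in> Z" "h \<noteq> 0" using assms by (auto simp: center_irreducible_def)
  obtain v s t a' b' where v: "v \<in> Z" "v \<noteq> 0" "s \<in> Z" "t \<in> Z" "v = s \<star> a + t \<star> h"
    "a' \<in> Z" "a = a' \<star> v" "b' \<in> Z" "h = b' \<star> v"
    by (rule center_gcd[OF assms(2) h(1) disjI2[OF h(2)]])
  have b': "b' \<noteq> 0" using v(9) h(2) by auto
  have "degree b' \<noteq> 0"
  proof
    assume "degree b' = 0"
    then obtain w where w: "w \<in> Z" "w \<star> b' = [:1:]" using center_unit[OF v(8) b'] by blast
    have "w \<star> h = [:1:] \<star> v" by (simp only: v(9) sk.mult_assoc[symmetric] w(2))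
    then have "a = a' \<star> w \<star> h" using v(7) by (simp add: sk.mult_assoc)
    then show False using assms(3) w(1) v(6) center_mult by blast
  qed
  then have "degree v = 0" using assms(1) v(1,8,9) by (auto simp: center_irreducible_def)
  then obtain w where w: "w \<in> Z" "w \<star> v = [:1:]" using center_unit[OF v(1,2)] by blast
  have "(w \<star> s) \<star> a + (w \<star> t) \<star> h = w \<star> v" by (simp only: v(5) sk.mult_assoc sk.distrib_left)
  then show ?thesis using that[of "w \<star> s" "w \<star> t"] w v(3,4) by (simp add: center_mult)
qed

lemma center_irreducible_prime:
  assumes "center_irreducible h" "a \<in> Z" "b \<in> Z" "c \<in> Z" "a \<star> b = c \<star> h"
  shows "(\<exists>a'\<in>Z. a = a' \<star> h) \<or> (\<exists>b'\<in>Z. b = b' \<star> h)"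
proof (rule disjCI)
  assume "\<not> (\<exists>b'\<in>Z. b = b' \<star> h)"
  then obtain s t where st: "s \<in> Z" "t \<in> Z" "s \<star> b + t \<star> h = [:1:]"
    using center_irreducible_coprime assms by metis
  have "a = a \<star> (s \<star> b + t \<star> h)" using st by simp
  also have "\<dots> = s \<star> (a \<star> b) + a \<star> t \<star> h"
    using center_commute[OF st(1)] by (simp add: sk.distrib_left sk.mult_assoc)
  also have "\<dots> = (s \<star> c + a \<star> t) \<star> h" using assms(5) by (simp add: sk.distrib_right sk.mult_assoc)
  finally show "\<exists>a'\<in>Z. a = a' \<star> h" using st assms center_add center_mult by blast
qed

section \<open>Left multiples and two-sided ideals\<close>

text \<open>Euclid's algorithm with exchanged roles: if \<open>v = k b + r\<close> and
  \<open>s' b = q' r\<close>, then \<open>q' v = (q' k + s') b\<close>. The bound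
  \<open>degree s' \<le> degree r\<close> turns into \<open>degree q' \<le> degree b\<close>, since
  both sides of \<open>s' b = q' r\<close> have the same degree.\<close>

lemma ore_left_multiple:
  assumes "b \<noteq> 0"
  shows "\<exists>s q. s \<noteq> 0 \<and> degree s \<le> degree b \<and> s \<star> v = q \<star> b"
  using assms
proof (induction "degree b" arbitrary: b v rule: less_induct)
  case less
  obtain k r where kr: "v = k \<star> b + r" "r = 0 \<or> degree r < degree b"
    using skew_division[OF less.prems] by blast
  show ?case
  proof (cases "r = 0")
    case True
    then show ?thesis using kr by (intro exI[of _ "[:1:]"] exI[of _ k]) simp
  next
    case False
    then obtain s' q' where s': "s' \<noteq> 0" "degree s' \<le> degree r" "s' \<star> b = q' \<star> r"
      using less.hyps[of r b] kr by auto
    have q': "q' \<noteq> 0" using s' less.prems by auto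
    have "degree q' + degree r = degree s' + degree b"
      using s' q' False less.prems by (metis degree_skew_mult)
    then have "degree q' \<le> degree b" using s'(2) by simp
    moreover have "q' \<star> v = (q' \<star> k + s') \<star> b"
      using kr(1) s'(3) by (simp add: sk.distrib_left sk.distrib_right sk.mult_assoc)
    ultimately show ?thesis using q' by blast
  qed
qed

text \<open>Each further element \<open>v k\<close> costs one left factor of degree at most
  \<open>degree b\<close>, chosen for \<open>r \<star> v k\<close>; left multiplication keeps what
  was achieved for the earlier elements.\<close>

lemma ore_common_left_multiple:
  assumes "b \<noteq> 0" "finite I"
  shows "\<exists>r. r \<noteq> 0 \<and> degree r \<le> card I * degree b \<and> (\<forall>i\<in>I. \<exists>q. r \<star> v i = q \<star> b)"
  using assms(2)
proof (induction I rule: finite_induct)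
  case empty
  then show ?case by (intro exI[of _ "[:1:]"]) simp
next
  case (insert k I)
  then obtain r where r: "r \<noteq> 0" "degree r \<le> card I * degree b" "\<forall>i\<in>I. \<exists>q. r \<star> v i = q \<star> b" by auto
  obtain s q where s: "s \<noteq> 0" "degree s \<le> degree b" "s \<star> (r \<star> v k) = q \<star> b"
    using ore_left_multiple[OF assms(1)] by blast
  have "\<exists>q. s \<star> r \<star> v i = q \<star> b" if "i \<in> insert k I" for i
    using that s(3) r(3) by (metis insert_iff sk.mult_assoc)
  moreover have "degree (s \<star> r) \<le> card (insert k I) * degree b"
    using r s insert by (simp add: degree_skew_mult)
  ultimately show ?case using r s by (intro exI[of _ "s \<star> r"]) auto
qed

text \<open>
  If \<open>u\<close> is monic of least degree in the ideal, its commutators with \<open>D\<close> and with \<open>t\<close> lie in the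
  ideal and have smaller degree, so they vanish.
\<close>

lemma two_sided_ideal_center:
  assumes add: "\<And>a b. P a \<Longrightarrow> P b \<Longrightarrow> P (a - b)"
    and left: "\<And>a y. P a \<Longrightarrow> P (y \<star> a)" and right: "\<And>a y. P a \<Longrightarrow> P (a \<star> y)"
    and r: "P r" "r \<noteq> 0"
  obtains u where "P u" "u \<noteq> 0" "u \<in> Z" "\<And>w. P w \<Longrightarrow> w \<noteq> 0 \<Longrightarrow> degree u \<le> degree w"
proof -
  define Q where "Q w \<longleftrightarrow> P w \<and> w \<noteq> 0" for w
  have "Q r" using r by (simp add: Q_def)
  then obtain u0 where u0: "Q u0" and min0: "\<And>w. Q w \<Longrightarrow> degree u0 \<le> degree w"
    using ex_has_least_nat[of Q r degree] by blast
  define u where "u = [:inverse (lead_coeff u0):] \<star> u0"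
  have u00: "u0 \<noteq> 0" using u0 by (simp add: Q_def)
  have Pu: "P u" using u0 left by (auto simp: Q_def u_def simp del: const_skew_mult)
  have u: "u \<noteq> 0" "degree u = degree u0" "lead_coeff u = 1"
    using u00 lead_coeff_skew_mult[of "[:inverse (lead_coeff u0):]" u0]
    by (auto simp: u_def degree_skew_mult simp del: const_skew_mult)
  have min: "degree u \<le> degree w" if "P w" "w \<noteq> 0" for w
    using that min0 u by (simp add: Q_def)
  have zero: "w = 0" if "P w" "degree w \<le> degree u" "coeff w (degree u) = 0" for w
    using min[OF that(1)] that(2,3) by (metis le_antisym leading_coeff_0_iff)
  have comm: "u \<star> y = y \<star> u" if "degree (u \<star> y - y \<star> u) \<le> degree u" "coeff (u \<star> y - y \<star> u) (degree u) = 0" for y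
  proof -
    have "u \<star> y - y \<star> u = 0" by (rule zero) (use that Pu left right add in auto)
    then show ?thesis by simp
  qed
  have "u \<in> Z"
  proof (rule centerI)
    fix c
    have "coeff (u \<star> [:c:]) (degree u) = c"
      using coeff_skew_mult_lead[of u "[:c:]"] u by simp
    moreover have "degree (u \<star> [:c:] - [:c:] \<star> u) \<le> degree u"
      using degree_skew_mult_le[of u "[:c:]"] degree_skew_mult_le[of "[:c:]" u]
      by (intro degree_diff_le) auto
    ultimately have "u \<star> [:c:] = [:c:] \<star> u" using u by (intro comm) auto
    then show "u \<star> [:c:] = scale c u" by simp
    have eq: "u \<star> [:0,1:] - [:0,1:] \<star> u = - map_poly \<delta> u"
      by (simp add: skew_t_def)
    have "degree (map_poly \<delta> u) \<le> degree u"
      by (rule degree_le) (simp add: coeff_map_poly coeff_eq_0)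
    then have "u \<star> [:0,1:] = [:0,1:] \<star> u"
      using u by (intro comm) (auto simp only: eq degree_minus coeff_minus coeff_map_poly der_0 der_1 minus_zero)
    then show "pCons 0 u = skew_t \<delta> u" by simp
  qed
  then show ?thesis using that Pu u min by blast
qed

end

section \<open>Finite generation over the center\<close>

context center_algebraic_derivation
begin

text \<open>\<open>g(\<delta>)\<close> vanishes on the center of \<open>D\<close>, so a family
  independent over the constants has at most \<open>p ^ e\<close> members, and one of greatest
  length spans.\<close>

lemma base_field_spanning:
  obtains M b where "M \<le> p ^ e" "\<And>z. z \<in> base_field \<Longrightarrow>
    \<exists>a. (\<forall>i<M. a i \<in> const_field \<delta>) \<and> z = (\<Sum>i<M. a i * b (i::nat))"
proof -
  define indep where "indep M b \<longleftrightarrow> (\<forall>i<M. b i \<in> base_field) \<and>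
    (\<forall>a. (\<forall>i<M. a i \<in> const_field \<delta>) \<longrightarrow> (\<Sum>i<M. a i * b i) = 0 \<longrightarrow> (\<forall>i<M. a i = 0))"
    for M :: nat and b :: "nat \<Rightarrow> 'a"
  have bound: "M \<le> p ^ e" if "indep M b" for M b
  proof (rule ccontr)
    assume "\<not> M \<le> p ^ e"
    then have "\<exists>c. (\<forall>i\<in>{..<M}. c i \<in> const_field \<delta>) \<and> (\<exists>i\<in>{..<M}. c i \<noteq> 0) \<and> (\<Sum>i<M. c i * b i) = 0"
      using that min_g lead_g
      by (intro annihilated_dependent[of g]) (auto simp: degree_g indep_def min_poly_der_def)
    then show False using that by (auto simp: indep_def)
  qed
  define M where "M = (GREATEST M. \<exists>b. indep M b)"
  have ex0: "\<exists>b. indep 0 b" by (auto simp: indep_def)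
  obtain b where b: "indep M b"
    using GreatestI_nat[of "\<lambda>M. \<exists>b. indep M b", OF ex0] bound unfolding M_def by blast
  have max: "\<not> indep (Suc M) b'" for b'
    using Greatest_le_nat[of "\<lambda>M. \<exists>b. indep M b" "Suc M" "p ^ e"] bound
    unfolding M_def by (metis Suc_n_not_le_n)
  have "\<exists>a. (\<forall>i<M. a i \<in> const_field \<delta>) \<and> z = (\<Sum>i<M. a i * b i)" if z: "z \<in> base_field" for z
  proof -
    have "\<forall>i<Suc M. (b(M := z)) i \<in> base_field" using b z by (auto simp: indep_def)
    with max[of "b(M := z)"] obtain a where a: "\<forall>i<Suc M. a i \<in> const_field \<delta>"
      "(\<Sum>i<Suc M. a i * (b(M := z)) i) = 0" "\<exists>i<Suc M. a i \<noteq> 0"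
      unfolding indep_def by blast
    have sum0: "(\<Sum>i<M. a i * b i) + a M * z = 0"
      using a(2) by (simp cong: sum.cong_simp)
    have aM: "a M \<noteq> 0"
    proof
      assume "a M = 0"
      then have "\<forall>i<M. a i = 0" using sum0 a(1) b by (auto simp: indep_def)
      then show False using a(3) \<open>a M = 0\<close> by (auto simp: less_Suc_eq)
    qed
    have "a M * z = - (\<Sum>i<M. a i * b i)" using sum0 by (simp add: eq_neg_iff_add_eq_0 add.commute)
    then have "inverse (a M) * (a M * z) = inverse (a M) * - (\<Sum>i<M. a i * b i)" by simp
    then have "z = (\<Sum>i<M. (- (inverse (a M) * a i)) * b i)"
      using aM by (simp add: mult.assoc[symmetric]) (simp add: mult.assoc sum_distrib_left sum_negf)
    then show ?thesis using a(1)
      by (intro exI[of _ "\<lambda>i. - (inverse (a M) * a i)"]) (auto intro!: const_field_closed)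
  qed
  then show ?thesis using that bound[OF b] by blast
qed

end

locale central_division_derivation = center_algebraic_derivation \<delta> p e c d0 g x
  for \<delta> :: "'a::division_ring \<Rightarrow> 'a" and p e c d0 g x +
  fixes d :: nat
  assumes central: "central_division_algebra_degree TYPE('a) d"
begin

text \<open>The tower of \<open>F\<close> inside the center of \<open>D\<close> inside
  \<open>D\<close>: the products of two spanning families span.\<close>

lemma const_field_spanning:
  obtains J :: "(nat \<times> nat) set" and v where "finite J" "card J \<le> d\<^sup>2 * p ^ e"
    "\<And>z. \<exists>a. (\<forall>i\<in>J. a i \<in> const_field \<delta>) \<and> z = (\<Sum>i\<in>J. a i * v i)"
proof -
  obtain w :: "nat \<Rightarrow> 'a" where w: "\<And>z. \<exists>a. (\<forall>i<d\<^sup>2. a i \<in> base_field) \<and> z = (\<Sum>i<d\<^sup>2. a i * w i)"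
    using central_division_algebra_spanning[OF central] by blast
  obtain M b where b: "M \<le> p ^ e" "\<And>z. z \<in> base_field \<Longrightarrow>
    \<exists>a. (\<forall>i<M. a i \<in> const_field \<delta>) \<and> z = (\<Sum>i<M. a i * b (i::nat))"
    using base_field_spanning by blast
  let ?J = "{..<d\<^sup>2} \<times> {..<M}" and ?v = "\<lambda>(i, j). b j * w i"
  have "\<exists>a. (\<forall>k\<in>?J. a k \<in> const_field \<delta>) \<and> z = (\<Sum>k\<in>?J. a k * ?v k)" for z
  proof -
    obtain a where a: "\<forall>i<d\<^sup>2. a i \<in> base_field" "z = (\<Sum>i<d\<^sup>2. a i * w i)" using w by blast
    have "\<forall>i. \<exists>q. i < d\<^sup>2 \<longrightarrow> (\<forall>j<M. q j \<in> const_field \<delta>) \<and> a i = (\<Sum>j<M. q j * b j)"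
      using a(1) b(2) by metis
    then obtain q where q: "\<And>i. i < d\<^sup>2 \<Longrightarrow> (\<forall>j<M. q i j \<in> const_field \<delta>) \<and> a i = (\<Sum>j<M. q i j * b j)"
      by metis
    have "z = (\<Sum>i<d\<^sup>2. \<Sum>j<M. q i j * (b j * w i))"
      unfolding a(2) by (intro sum.cong) (use q in \<open>auto simp: sum_distrib_right mult.assoc\<close>)
    also have "\<dots> = (\<Sum>k\<in>?J. (case k of (i, j) \<Rightarrow> q i j) * ?v k)"
      by (simp add: sum.cartesian_product split_def)
    finally show ?thesis using q by (intro exI[of _ "\<lambda>(i, j). q i j"]) auto
  qed
  moreover have "card ?J \<le> d\<^sup>2 * p ^ e" using b(1) by (simp add: card_cartesian_product)
  ultimately show ?thesis using that[of ?J ?v] by blast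
qed

text \<open>Repeated division by \<open>x\<close> leaves remainders of degree below
  \<open>p ^ e\<close>, whose coefficients are expanded over \<open>F\<close>; the generators are
  the \<open>v_i t^j\<close>. The bound on \<open>degree (q k)\<close> later controls the degree of
  the norm, and the count \<open>d^2 p^e * p^e\<close> is compared with \<open>n^2\<close>.\<close>

lemma skew_poly_spanning:
  obtains K :: "((nat \<times> nat) \<times> nat) set" and E where "finite K" "card K \<le> (d * p ^ e)\<^sup>2"
    "\<And>y. \<exists>q. (\<forall>k\<in>K. q k \<in> Z \<and> degree (q k) \<le> degree y) \<and> y = (\<Sum>k\<in>K. q k \<star> E k)"
proof -
  obtain J :: "(nat \<times> nat) set" and v where J: "finite J" "card J \<le> d\<^sup>2 * p ^ e"
    "\<And>z. \<exists>a. (\<forall>i\<in>J. a i \<in> const_field \<delta>) \<and> z = (\<Sum>i\<in>J. a i * v i)"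
    using const_field_spanning by blast
  let ?K = "J \<times> {..<p ^ e}" and ?E = "\<lambda>(i, j). monom (v i) j"
  have "\<exists>q. (\<forall>k\<in>?K. q k \<in> Z \<and> degree (q k) \<le> degree y) \<and> y = (\<Sum>k\<in>?K. q k \<star> ?E k)" for y
  proof (induction "degree y" arbitrary: y rule: less_induct)
    case less
    obtain s r where sr: "y = s \<star> x + r" "r = 0 \<or> degree r < degree x"
      using skew_division[OF x_nonzero] by blast
    have dr: "degree r < p ^ e" using sr(2) p_pow_pos by (auto simp: degree_x)
    have "\<forall>j. \<exists>a. (\<forall>i\<in>J. a i \<in> const_field \<delta>) \<and> coeff r j = (\<Sum>i\<in>J. a i * v i)" using J(3) by blast
    then obtain a where a: "\<And>i j. i \<in> J \<Longrightarrow> a j i \<in> const_field \<delta>" "\<And>j. coeff r j = (\<Sum>i\<in>J. a j i * v i)"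
      by metis
    have r: "r = (\<Sum>k\<in>?K. [:case k of (i, j) \<Rightarrow> a j i:] \<star> ?E k)"
    proof -
      have "(\<Sum>k\<in>?K. [:case k of (i, j) \<Rightarrow> a j i:] \<star> ?E k) = (\<Sum>i\<in>J. \<Sum>j<p ^ e. scale (a j i) (monom (v i) j))"
        by (simp add: sum.cartesian_product split_def)
      also have "\<dots> = (\<Sum>j<p ^ e. \<Sum>i\<in>J. scale (a j i) (monom (v i) j))" by (rule sum.swap)
      also have "\<dots> = (\<Sum>j<p ^ e. monom (coeff r j) j)"
        by (intro sum.cong) (auto simp: a(2) poly_eq_iff coeff_sum)
      also have "\<dots> = r"
        using dr by (auto simp: poly_eq_iff coeff_sum coeff_eq_0)
      finally show ?thesis by simp
    qed
    show ?case
    proof (cases "s = 0")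
      case True
      then show ?thesis using a(1) r sr
        by (intro exI[of _ "\<lambda>(i, j). [:a j i:]"]) (auto simp: center_const split_def simp del: const_skew_mult)
    next
      case False
      have dy: "degree y = degree s + p ^ e"
        using False dr by (simp add: sr(1) degree_add_eq_left degree_skew_mult degree_x)
      then have "degree s < degree y" using p_pow_pos by simp
      from less[OF this] obtain q where
        q0: "(\<forall>k\<in>?K. q k \<in> Z \<and> degree (q k) \<le> degree s) \<and> s = (\<Sum>k\<in>?K. q k \<star> ?E k)"
        by (rule exE)
      note q = bspec[OF conjunct1[OF q0]] conjunct2[OF q0]
      define q' where "q' k = q k \<star> x + [:case k of (i, j) \<Rightarrow> a j i:]" for k
      have "y = (\<Sum>k\<in>?K. q' k \<star> ?E k)"
      proof -
        have "q k \<star> x \<star> ?E k = q k \<star> ?E k \<star> x" for k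
          using center_commute[OF x_center] by (simp add: sk.mult_assoc)
        then have "(\<Sum>k\<in>?K. q' k \<star> ?E k) = (\<Sum>k\<in>?K. q k \<star> ?E k) \<star> x + (\<Sum>k\<in>?K. [:case k of (i, j) \<Rightarrow> a j i:] \<star> ?E k)"
          by (simp only: q'_def sk.distrib_right sum.distrib sum_skew_mult)
        then show ?thesis using sr(1) q(2) r by simp
      qed
      moreover have "q' k \<in> Z \<and> degree (q' k) \<le> degree y" if "k \<in> ?K" for k
      proof
        show "q' k \<in> Z" unfolding q'_def using that q(1) a(1)
          by (intro center_add center_mult x_center center_const) auto
        have "degree (q k \<star> x) \<le> degree y"
          using degree_skew_mult_le[of "q k" x] q(1)[OF that] by (simp add: dy degree_x)
        then show "degree (q' k) \<le> degree y" unfolding q'_def by (intro degree_add_le) auto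
      qed
      ultimately show ?thesis by blast
    qed
  qed
  moreover have "card ?K \<le> (d * p ^ e)\<^sup>2"
    using J(2) mult_le_mono1[OF J(2), of "p ^ e"]
    by (simp add: card_cartesian_product power2_eq_square mult_ac)
  ultimately show ?thesis using that[of ?K ?E] J(1) by blast
qed

section \<open>Irreducibility and the reduced norm\<close>

theorem skew_irreducible_of_center_irreducible:
  assumes h: "center_irreducible h" "h = q \<star> f" and deg: "degree h = p ^ e * (d * degree f)"
  shows "skew_irreducible \<delta> f"
proof -
  have h0: "h \<in> Z" "h \<noteq> 0" "degree h \<noteq> 0" using h by (auto simp: center_irreducible_def)
  have f0: "f \<noteq> 0" using h h0 by auto
  have dpos: "d > 0" "degree f > 0" using deg h0 by auto
  have "f \<notin> Units (skew_poly_ring \<delta>)"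
  proof
    assume "f \<in> Units (skew_poly_ring \<delta>)"
    then have "degree f = 0" using degree_zero_of_unit by (auto simp: Units_def skew_poly_ring_def)
    then show False using dpos by simp
  qed
  moreover have False if ab: "f = a \<star> b" "1 \<le> degree b" "degree b < degree f" for a b
  proof -
    have b0: "b \<noteq> 0" using ab by auto
    \<comment> \<open>Membership in the left ideal \<open>Rb\<close>, which serves as the congruence
      defining \<open>R/Rb\<close>.\<close>
    define I where "I y \<longleftrightarrow> (\<exists>s. y = s \<star> b)" for y
    have I_add: "I (y + z)" if "I y" "I z" for y z
      using that unfolding I_def by (metis sk.distrib_right)
    have I_mult: "I (y \<star> z)" if "I z" for y z
      using that unfolding I_def by (metis sk.mult_assoc)
    have I_diff: "I (y - z)" if "I y" "I z" for y z
      using that unfolding I_def by (metis sk.left_diff_distrib)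
    have I_0: "I 0" unfolding I_def by (intro exI[of _ 0]) simp
    have I_sum: "(\<And>i. i \<in> A \<Longrightarrow> I (F i)) \<Longrightarrow> I (sum F A)" for F and A :: "((nat \<times> nat) \<times> nat) set"
      by (induction A rule: infinite_finite_induct) (auto simp: I_0 I_add)
    \<comment> \<open>\<open>h = q a b\<close>, so \<open>Rh\<close> lies in \<open>Rb\<close>;
      being central, \<open>h\<close> acts as zero on \<open>R/Rb\<close>.\<close>
    have I_h: "I (y \<star> h)" for y
      unfolding I_def h(2) ab(1) by (metis sk.mult_assoc)
    obtain K :: "((nat \<times> nat) \<times> nat) set" and E where K: "finite K"
      "\<And>y. \<exists>q. (\<forall>k\<in>K. q k \<in> Z \<and> degree (q k) \<le> degree y) \<and> y = (\<Sum>k\<in>K. q k \<star> E k)"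
      by (rule skew_poly_spanning) blast
    \<comment> \<open>Sets whose \<open>E k\<close> generate \<open>R/Rb\<close> over
      \<open>F[x]\<close>. The cardinality of a smallest one plays the role of the dimension over
      \<open>F[x]/(h)\<close>.\<close>
    define gen where "gen V \<longleftrightarrow> V \<subseteq> K \<and> (\<forall>y. \<exists>q. (\<forall>k\<in>V. q k \<in> Z) \<and> I (y - (\<Sum>k\<in>V. q k \<star> E k)))" for V
    have "gen K" unfolding gen_def
    proof (intro conjI allI order_refl)
      fix y
      obtain q where q: "(\<forall>k\<in>K. q k \<in> Z \<and> degree (q k) \<le> degree y) \<and> y = (\<Sum>k\<in>K. q k \<star> E k)"
        using K(2)[of y] by (rule exE)
      then have "y - (\<Sum>k\<in>K. q k \<star> E k) = 0" by simp
      then have "(\<forall>k\<in>K. q k \<in> Z) \<and> I (y - (\<Sum>k\<in>K. q k \<star> E k))" using q I_0 by simp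
      then show "\<exists>q. (\<forall>k\<in>K. q k \<in> Z) \<and> I (y - (\<Sum>k\<in>K. q k \<star> E k))"
        by (intro exI[of _ q])
    qed
    then obtain V where V: "gen V" and min: "\<And>W. gen W \<Longrightarrow> card V \<le> card W"
      using ex_has_least_nat[of gen K card] by blast
    have finV: "finite V" using V K(1) finite_subset by (auto simp: gen_def)
    obtain J :: "(nat \<times> nat) set" and v where J: "finite J" "card J \<le> d\<^sup>2 * p ^ e"
      "\<And>z. \<exists>a. (\<forall>i\<in>J. a i \<in> const_field \<delta>) \<and> z = (\<Sum>i\<in>J. a i * v i)"
      using const_field_spanning by blast
    \<comment> \<open>The degree of \<open>h\<close> in \<open>x\<close>, so the powers
      \<open>x^j\<close> with \<open>j < D\<close> represent \<open>F[x]/(h)\<close> over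
      \<open>F\<close>.\<close>
    define D where "D = d * degree f"
    have Dpos: "D > 0" using dpos by (simp add: D_def)
    \<comment> \<open>Otherwise there is a relation modulo \<open>Rb\<close> with a coefficient invertible modulo \<open>h\<close>.\<close>
    have cardV: "card V * D \<le> card J * degree b"
    proof (rule ccontr)
      assume "\<not> card V * D \<le> card J * degree b"
      \<comment> \<open>The unknowns are the coefficients of \<open>x^j E_k\<close>; the equations
        are the \<open>F\<close>-coordinates of the \<open>degree b\<close> coefficients of the
        remainders modulo \<open>b\<close>.\<close>
      then have less: "card (J \<times> {..<degree b}) < card (V \<times> {..<D})"
        by (simp add: card_cartesian_product)
      have "\<forall>kj. \<exists>r. I (sk.power x (snd kj) \<star> E (fst kj) - r) \<and> degree r < degree b"
      proof
        fix kj
        obtain s r where sr: "sk.power x (snd kj) \<star> E (fst kj) = s \<star> b + r" "r = 0 \<or> degree r < degree b"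
          using skew_division[OF b0] by blast
        then show "\<exists>r. I (sk.power x (snd kj) \<star> E (fst kj) - r) \<and> degree r < degree b"
          using ab(2) by (intro exI[of _ r]) (auto simp: I_def)
      qed
      then obtain \<rho> where \<rho>: "\<And>k j. I (sk.power x j \<star> E k - \<rho> (k, j))" "\<And>kj. degree (\<rho> kj) < degree b"
        by (metis fst_conv snd_conv)
      have "\<forall>kj l. \<exists>a. (\<forall>i\<in>J. a i \<in> const_field \<delta>) \<and> coeff (\<rho> kj) l = (\<Sum>i\<in>J. a i * v i)"
        using J(3) by blast
      then obtain A where A: "\<And>kj l i. i \<in> J \<Longrightarrow> A kj l i \<in> const_field \<delta>"
        "\<And>kj l. coeff (\<rho> kj) l = (\<Sum>i\<in>J. A kj l i * v i)" by metis
      obtain C where C: "\<And>kj. kj \<in> V \<times> {..<D} \<Longrightarrow> C kj \<in> const_field \<delta>"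
        "\<exists>kj\<in>V \<times> {..<D}. C kj \<noteq> 0"
        "\<And>il. il \<in> J \<times> {..<degree b} \<Longrightarrow> (\<Sum>kj\<in>V \<times> {..<D}. C kj * (case il of (i, l) \<Rightarrow> A kj l i)) = 0"
      proof (rule homogeneous_system_nontrivial[where F = "const_field \<delta>" and I = "V \<times> {..<D}"
            and J = "J \<times> {..<degree b}" and A = "\<lambda>kj (i, l). A kj l i"])
      qed (use less J(1) finV A(1) in \<open>auto intro: const_field_closed\<close>)
      have rel0: "(\<Sum>kj\<in>V \<times> {..<D}. scale (C kj) (\<rho> kj)) = 0"
      proof -
        have "coeff (\<Sum>kj\<in>V \<times> {..<D}. scale (C kj) (\<rho> kj)) l = 0" for l
        proof (cases "l < degree b")
          case True
          have "coeff (\<Sum>kj\<in>V \<times> {..<D}. scale (C kj) (\<rho> kj)) l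
              = (\<Sum>kj\<in>V \<times> {..<D}. \<Sum>i\<in>J. C kj * A kj l i * v i)"
            by (simp add: coeff_sum A(2) sum_distrib_left mult.assoc)
          also have "\<dots> = (\<Sum>i\<in>J. (\<Sum>kj\<in>V \<times> {..<D}. C kj * A kj l i) * v i)"
            by (subst sum.swap) (simp add: sum_distrib_right)
          also have "\<dots> = 0"
          proof (rule sum.neutral, rule ballI)
            fix i assume "i \<in> J"
            then have "(\<Sum>kj\<in>V \<times> {..<D}. C kj * A kj l i) = 0" using C(3)[of "(i, l)"] True by simp
            then show "(\<Sum>kj\<in>V \<times> {..<D}. C kj * A kj l i) * v i = 0" by simp
          qed
          finally show ?thesis .
        next
          case False
          then have "coeff (\<rho> kj) l = 0" for kj using \<rho>(2)[of kj] by (intro coeff_eq_0) simp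
          then show ?thesis by (simp add: coeff_sum)
        qed
        then show ?thesis by (simp add: poly_eq_iff)
      qed
      \<comment> \<open>The solution regrouped as one polynomial in \<open>x\<close> per generator.
        Its degree is below \<open>D\<close>, so a nonzero \<open>qq k\<close> has smaller degree
        than \<open>h\<close> and cannot be a multiple of it.\<close>
      define Q where "Q k = (\<Sum>j<D. monom (C (k, j)) j)" for k
      define qq where "qq k = skew_eval \<delta> x (Q k)" for k
      have coeffQ: "coeff (Q k) j = (if j < D then C (k, j) else 0)" for k j
        by (simp add: Q_def coeff_sum)
      have degQ: "degree (Q k) < D" for k
        using Dpos by (intro degree_lessI) (auto simp: coeffQ)
      have qZ: "qq k \<in> Z" if "k \<in> V" for k
        unfolding qq_def using that C(1) by (intro skew_eval_center) (auto simp: polys_over_def coeffQ)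
      have qq_sum: "qq k = (\<Sum>j<D. scale (C (k, j)) (sk.power x j))" for k
      proof -
        have "qq k = (\<Sum>j\<le>D - 1. scale (coeff (Q k) j) (sk.power x j))"
          unfolding qq_def using degQ[of k] by (intro skew_eval_eq_sum) simp
        also have "{..D - 1} = {..<D}" using Dpos by auto
        finally show ?thesis by (simp add: coeffQ)
      qed
      have rel: "I (\<Sum>k\<in>V. qq k \<star> E k)"
      proof -
        have "(\<Sum>k\<in>V. qq k \<star> E k) = (\<Sum>k\<in>V. \<Sum>j<D. scale (C (k, j)) (sk.power x j \<star> E k))"
          by (simp add: qq_sum sum_skew_mult scale_skew_mult)
        also have "\<dots> = (\<Sum>k\<in>V. \<Sum>j<D. scale (C (k, j)) (sk.power x j \<star> E k)) - (\<Sum>k\<in>V. \<Sum>j<D. scale (C (k, j)) (\<rho> (k, j)))"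
          using rel0 by (simp add: sum.cartesian_product split_def)
        also have "\<dots> = (\<Sum>k\<in>V. \<Sum>j<D. [:C (k, j):] \<star> (sk.power x j \<star> E k - \<rho> (k, j)))"
          by (simp only: sum_subtractf[symmetric] sk.right_diff_distrib const_skew_mult)
        finally have eq: "(\<Sum>k\<in>V. qq k \<star> E k) = (\<Sum>k\<in>V. \<Sum>j<D. [:C (k, j):] \<star> (sk.power x j \<star> E k - \<rho> (k, j)))" .
        have I_sum': "(\<And>i. i \<in> A \<Longrightarrow> I (F i)) \<Longrightarrow> I (sum F A)" for F and A :: "nat set"
          by (induction A rule: infinite_finite_induct) (auto simp: I_0 I_add)
        show ?thesis unfolding eq by (intro I_sum I_sum' I_mult \<rho>)
      qed
      obtain k where k: "k \<in> V" "Q k \<noteq> 0"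
      proof -
        obtain k j where kj: "k \<in> V" "j < D" "C (k, j) \<noteq> 0" using C(2) by auto
        then have "coeff (Q k) j \<noteq> 0" by (simp add: coeffQ)
        then have "Q k \<noteq> 0" by auto
        then show ?thesis using that kj by blast
      qed
      have "\<not> (\<exists>w\<in>Z. qq k = w \<star> h)"
      proof
        assume "\<exists>w\<in>Z. qq k = w \<star> h"
        then obtain w where w: "qq k = w \<star> h" by auto
        have nz: "qq k \<noteq> 0" "degree (qq k) = p ^ e * degree (Q k)"
          using degree_skew_eval[OF k(2)] by (auto simp: qq_def)
        then have "w \<noteq> 0" using w by auto
        then have "degree h \<le> degree (qq k)" using w h0 by (simp add: degree_skew_mult)
        then show False using nz degQ[of k] p_pow_pos by (simp add: deg D_def)
      qed
      then obtain s t where st: "s \<in> Z" "t \<in> Z" "s \<star> qq k + t \<star> h = [:1:]"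
        using center_irreducible_coprime[OF h(1) qZ[OF k(1)]] by metis
      \<comment> \<open>Multiplying the relation by \<open>s\<close>, an inverse of
        \<open>qq k\<close> modulo \<open>h\<close>, expresses \<open>E k\<close> through the other
        generators, so \<open>V\<close> was not smallest.\<close>
      have Ek: "I (E k + (\<Sum>i\<in>V - {k}. s \<star> qq i \<star> E i))"
      proof -
        have "I (s \<star> (\<Sum>i\<in>V. qq i \<star> E i) + t \<star> E k \<star> h)" by (intro I_add I_mult rel I_h)
        also have "s \<star> (\<Sum>i\<in>V. qq i \<star> E i) = s \<star> qq k \<star> E k + (\<Sum>i\<in>V - {k}. s \<star> qq i \<star> E i)"
          using k finV by (simp add: sum.remove[of V k] sk.distrib_left skew_mult_sum sk.mult_assoc)
        also have "t \<star> E k \<star> h = t \<star> h \<star> E k" using center_commute[OF h0(1)] by (simp add: sk.mult_assoc)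
        also have "s \<star> qq k \<star> E k + (\<Sum>i\<in>V - {k}. s \<star> qq i \<star> E i) + t \<star> h \<star> E k
            = (s \<star> qq k + t \<star> h) \<star> E k + (\<Sum>i\<in>V - {k}. s \<star> qq i \<star> E i)"
          by (simp add: sk.distrib_right add_ac)
        finally show ?thesis using st by simp
      qed
      have "gen (V - {k})" unfolding gen_def
      proof (intro conjI allI)
        show "V - {k} \<subseteq> K" using V by (auto simp: gen_def)
        fix y
        obtain r where r0: "(\<forall>i\<in>V. r i \<in> Z) \<and> I (y - (\<Sum>i\<in>V. r i \<star> E i))"
          using conjunct2[OF V[unfolded gen_def], rule_format, of y] by (rule exE)
        note r = bspec[OF conjunct1[OF r0]] conjunct2[OF r0]
        define r' where "r' i = r i - r k \<star> (s \<star> qq i)" for i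
        have "(y - (\<Sum>i\<in>V. r i \<star> E i)) + r k \<star> (E k + (\<Sum>i\<in>V - {k}. s \<star> qq i \<star> E i)) = y - (\<Sum>i\<in>V - {k}. r' i \<star> E i)"
          using k finV by (simp add: sum.remove[of V k] r'_def sk.distrib_left sk.left_diff_distrib
            skew_mult_sum sum_subtractf sk.mult_assoc)
        then have "I (y - (\<Sum>i\<in>V - {k}. r' i \<star> E i))" using I_add[OF r(2) I_mult[OF Ek, of "r k"]] by (simp only:)
        moreover have "\<forall>i\<in>V - {k}. r' i \<in> Z"
          unfolding r'_def by (intro ballI center_diff center_mult r(1) qZ st k(1)) auto
        ultimately show "\<exists>q. (\<forall>i\<in>V - {k}. q i \<in> Z) \<and> I (y - (\<Sum>i\<in>V - {k}. q i \<star> E i))"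
          by (intro exI[of _ r'] conjI)
      qed
      then have "card V \<le> card (V - {k})" by (rule min)
      then show False using card_Diff1_less[OF finV k(1)] by simp
    qed
    obtain r where r0: "r \<noteq> 0 \<and> degree r \<le> card V * degree b \<and> (\<forall>k\<in>V. \<exists>q. r \<star> E k = q \<star> b)"
      using ore_common_left_multiple[OF b0 finV, of E] by (rule exE)
    then have r: "r \<noteq> 0" "degree r \<le> card V * degree b" "\<And>k. k \<in> V \<Longrightarrow> I (r \<star> E k)"
      by (simp_all add: I_def)
    \<comment> \<open>The annihilator of \<open>R/Rb\<close>. It contains \<open>r\<close>, because
      \<open>r\<close> sends every generator into \<open>Rb\<close> and the coefficients of a
      combination are central.\<close>
    define ann where "ann w \<longleftrightarrow> (\<forall>y. I (w \<star> y))" for w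
    have "ann r" unfolding ann_def
    proof
      fix y
      obtain q where q0: "(\<forall>k\<in>V. q k \<in> Z) \<and> I (y - (\<Sum>k\<in>V. q k \<star> E k))"
        using conjunct2[OF V[unfolded gen_def], rule_format, of y] by (rule exE)
      note q = bspec[OF conjunct1[OF q0]] conjunct2[OF q0]
      have "I (\<Sum>k\<in>V. q k \<star> (r \<star> E k))" by (intro I_sum I_mult r)
      also have "(\<Sum>k\<in>V. q k \<star> (r \<star> E k)) = r \<star> (\<Sum>k\<in>V. q k \<star> E k)"
        unfolding skew_mult_sum
      proof (intro sum.cong refl)
        fix k assume "k \<in> V"
        then show "q k \<star> (r \<star> E k) = r \<star> (q k \<star> E k)"
          using center_commute[OF q(1), of k r] by (simp add: sk.mult_assoc[symmetric])
      qed
      finally have "I (r \<star> (\<Sum>k\<in>V. q k \<star> E k) + r \<star> (y - (\<Sum>k\<in>V. q k \<star> E k)))"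
        by (rule I_add) (rule I_mult[OF q(2)])
      then show "I (r \<star> y)" by (simp add: sk.distrib_left[symmetric])
    qed
    obtain u where u: "ann u" "u \<noteq> 0" "u \<in> Z" "\<And>w. ann w \<Longrightarrow> w \<noteq> 0 \<Longrightarrow> degree u \<le> degree w"
    proof (rule two_sided_ideal_center[of ann r])
      show "ann (a - b)" if "ann a" "ann b" for a b
        using that by (auto simp: ann_def sk.left_diff_distrib I_diff)
      show "ann (y \<star> a)" "ann (a \<star> y)" if "ann a" for a y
        using that by (auto simp: ann_def sk.mult_assoc I_mult)
    qed (use \<open>ann r\<close> r in auto)
    have "ann h" unfolding ann_def using I_h center_commute[OF h0(1)] by simp
    obtain s w where sw: "h = s \<star> u + w" "w = 0 \<or> degree w < degree u"
      using skew_division[OF u(2)] by blast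
    have "ann w" unfolding ann_def
    proof
      fix y
      have "w \<star> y = h \<star> y - s \<star> (u \<star> y)" by (simp add: sw(1) sk.distrib_right sk.mult_assoc)
      then show "I (w \<star> y)" using \<open>ann h\<close> u(1) by (auto simp: ann_def intro: I_diff I_mult)
    qed
    then have w0: "w = 0" using u(4) sw(2) by (meson leD)
    have hsu: "h = s \<star> u" using sw w0 by simp
    have "s \<in> Z" using skew_division_center[OF h0(1) u(3,2) sw] by simp
    then have "degree s = 0 \<or> degree u = 0" using h(1) u(3) hsu by (auto simp: center_irreducible_def)
    \<comment> \<open>Applied to \<open>1\<close>, the annihilator lies in \<open>Rb\<close>, and
      \<open>b\<close> has positive degree.\<close>
    moreover have "degree u \<noteq> 0"
    proof
      assume "degree u = 0"
      have "I u" using u(1) unfolding ann_def by (metis sk.mult_1_right)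
      then obtain s where "u = s \<star> b" by (auto simp: I_def)
      moreover from this have "s \<noteq> 0" using u(2) by auto
      ultimately show False using \<open>degree u = 0\<close> b0 ab(2) by (simp add: degree_skew_mult)
    qed
    ultimately have "degree h = degree u" using hsu h0 by (simp add: degree_skew_mult)
    also have "\<dots> \<le> degree r" using u(4) \<open>ann r\<close> r(1) by blast
    also have "\<dots> \<le> card V * degree b" by (rule r(2))
    finally have "p ^ e * D \<le> card V * degree b" by (simp add: deg D_def)
    \<comment> \<open>The extra factor \<open>D\<close> lets \<open>cardV\<close> eliminate the
      unknown \<open>card V\<close>, leaving
      \<open>p^e d^2 (deg f)^2 \<le> p^e d^2 (deg b)^2\<close>.\<close>
    then have "p ^ e * D * D \<le> card V * degree b * D" by (rule mult_le_mono1)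
    also have "\<dots> = card V * D * degree b" by simp
    also have "\<dots> \<le> card J * degree b * degree b" using cardV by (rule mult_le_mono1)
    also have "\<dots> \<le> d\<^sup>2 * p ^ e * degree b * degree b" using J(2) by (intro mult_le_mono1)
    finally have "(p ^ e * d\<^sup>2) * (degree f * degree f) \<le> (p ^ e * d\<^sup>2) * (degree b * degree b)"
      by (simp add: D_def power2_eq_square mult_ac)
    then have "degree f * degree f \<le> degree b * degree b" using p_pow_pos dpos by auto
    moreover have "degree b * degree b < degree f * degree f" using ab(3) by (intro mult_strict_mono) auto
    ultimately show False by simp
  qed
  ultimately show ?thesis unfolding skew_irreducible_def skew_poly_ring_simps by blast
qed

end

text \<open>Multilinearity in the rows: \<open>g\<close> selects one summand in each row. The
  determinant becomes a form of degree \<open>n\<close> in the coordinates \<open>a k\<close>, with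
  coefficients depending only on the matrices \<open>A k\<close>.\<close>

lemma det_sum_expansion:
  fixes A :: "'k \<Rightarrow> 'l::comm_ring_1 mat"
  assumes M: "M \<in> carrier_mat n n" and K: "finite K"
    and entries: "\<And>i l. i < n \<Longrightarrow> l < n \<Longrightarrow> M $$ (i, l) = (\<Sum>k\<in>K. a k * A k $$ (i, l))"
  shows "det M = (\<Sum>g\<in>PiE {0..<n} (\<lambda>_. K). (\<Prod>i = 0..<n. a (g i)) *
    (\<Sum>\<pi> | \<pi> permutes {0..<n}. signof \<pi> * (\<Prod>i = 0..<n. A (g i) $$ (i, \<pi> i))))"
proof -
  let ?S = "PiE {0..<n} (\<lambda>_. K)"
  have "det M = (\<Sum>\<pi> | \<pi> permutes {0..<n}. signof \<pi> * (\<Prod>i = 0..<n. M $$ (i, \<pi> i)))"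
    by (rule det_def'[OF M])
  also have "\<dots> = (\<Sum>\<pi> | \<pi> permutes {0..<n}. signof \<pi> *
      (\<Sum>g\<in>?S. \<Prod>i = 0..<n. a (g i) * A (g i) $$ (i, \<pi> i)))"
  proof (intro sum.cong refl arg_cong2[where f = "(*)"])
    fix \<pi> assume "\<pi> \<in> {\<pi>. \<pi> permutes {0..<n}}"
    then have \<pi>: "\<pi> permutes {0..<n}" by simp
    have "(\<Prod>i = 0..<n. M $$ (i, \<pi> i)) = (\<Prod>i = 0..<n. \<Sum>k\<in>K. a k * A k $$ (i, \<pi> i))"
    proof (intro prod.cong refl)
      fix i assume "i \<in> {0..<n}"
      then show "M $$ (i, \<pi> i) = (\<Sum>k\<in>K. a k * A k $$ (i, \<pi> i))"
        using permutes_in_image[OF \<pi>, of i] by (intro entries) auto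
    qed
    also have "\<dots> = (\<Sum>g\<in>?S. \<Prod>i = 0..<n. a (g i) * A (g i) $$ (i, \<pi> i))"
      by (rule prod_sum_PiE) (use K in auto)
    finally show "(\<Prod>i = 0..<n. M $$ (i, \<pi> i)) = (\<Sum>g\<in>?S. \<Prod>i = 0..<n. a (g i) * A (g i) $$ (i, \<pi> i))" .
  qed
  also have "\<dots> = (\<Sum>g\<in>?S. \<Sum>\<pi> | \<pi> permutes {0..<n}. signof \<pi> * (\<Prod>i = 0..<n. a (g i) * A (g i) $$ (i, \<pi> i)))"
    by (simp only: sum_distrib_left) (rule sum.swap)
  also have "\<dots> = (\<Sum>g\<in>?S. (\<Prod>i = 0..<n. a (g i)) *
    (\<Sum>\<pi> | \<pi> permutes {0..<n}. signof \<pi> * (\<Prod>i = 0..<n. A (g i) $$ (i, \<pi> i))))"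
    by (simp add: prod.distrib sum_distrib_left mult_ac)
  finally show ?thesis .
qed

text \<open>Coordinates of a \<open>K\<close>-linear retraction of \<open>\<Sum> K c\<^sub>s\<close> onto its intersection with \<open>K\<close>.\<close>

lemma subfield_retraction:
  fixes K :: "'l::field set" and c :: "'s \<Rightarrow> 'l"
  assumes K: "0 \<in> K" "\<And>a b. a \<in> K \<Longrightarrow> b \<in> K \<Longrightarrow> a + b \<in> K" "\<And>a b. a \<in> K \<Longrightarrow> b \<in> K \<Longrightarrow> a * b \<in> K"
      "\<And>a. a \<in> K \<Longrightarrow> - a \<in> K" "\<And>a. a \<in> K \<Longrightarrow> inverse a \<in> K"
    and "finite S"
  shows "\<exists>\<mu>. (\<forall>s\<in>S. \<mu> s \<in> K) \<and>
    (\<forall>a. (\<forall>s\<in>S. a s \<in> K) \<longrightarrow> (\<Sum>s\<in>S. a s * c s) \<in> K \<longrightarrow> (\<Sum>s\<in>S. a s * c s) = (\<Sum>s\<in>S. a s * \<mu> s))"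
proof -
  have K_sum: "(\<And>i. i \<in> A \<Longrightarrow> f i \<in> K) \<Longrightarrow> sum f A \<in> K" for f :: "'s \<Rightarrow> 'l" and A
    by (induction A rule: infinite_finite_induct) (auto simp: K)
  have K_diff: "a - b \<in> K" if "a \<in> K" "b \<in> K" for a b
    using K(2)[OF that(1) K(4)[OF that(2)]] by simp
  show ?thesis using \<open>finite S\<close>
  proof (induction S rule: finite_induct)
    case (insert t S)
    then obtain \<mu> where \<mu>: "\<And>s. s \<in> S \<Longrightarrow> \<mu> s \<in> K"
      "\<And>a. (\<And>s. s \<in> S \<Longrightarrow> a s \<in> K) \<Longrightarrow> (\<Sum>s\<in>S. a s * c s) \<in> K \<Longrightarrow> (\<Sum>s\<in>S. a s * c s) = (\<Sum>s\<in>S. a s * \<mu> s)"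
      by blast
    have ins: "(\<Sum>s\<in>insert t S. a s * c' s) = a t * c' t + (\<Sum>s\<in>S. a s * c' s)" for a c'
      using insert.hyps by simp
    \<comment> \<open>If \<open>c t\<close> lies in \<open>K\<close> plus the span of the earlier
      \<open>c s\<close>, its image is forced by linearity. Otherwise \<open>a t\<close> must vanish
      whenever the sum lies in \<open>K\<close>, and the value 0 serves.\<close>
    show ?case
    proof (cases "\<exists>\<beta> b. \<beta> \<in> K \<and> (\<forall>s\<in>S. b s \<in> K) \<and> c t = \<beta> + (\<Sum>s\<in>S. b s * c s)")
      case True
      then obtain \<beta> b where b: "\<beta> \<in> K" "\<And>s. s \<in> S \<Longrightarrow> b s \<in> K" "c t = \<beta> + (\<Sum>s\<in>S. b s * c s)"
        by auto
      define \<nu> where "\<nu> = \<beta> + (\<Sum>s\<in>S. b s * \<mu> s)"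
      have \<nu>: "\<nu> \<in> K" unfolding \<nu>_def by (intro K K_sum b \<mu>)
      have upd: "(\<Sum>s\<in>S. a s * (\<mu>(t := \<nu>)) s) = (\<Sum>s\<in>S. a s * \<mu> s)" for a
        using insert.hyps by (intro sum.cong) auto
      show ?thesis
      proof (intro exI[of _ "\<mu>(t := \<nu>)"] conjI allI impI)
        show "\<forall>s\<in>insert t S. (\<mu>(t := \<nu>)) s \<in> K" using \<mu>(1) \<nu> by auto
        fix a assume a: "\<forall>s\<in>insert t S. a s \<in> K" "(\<Sum>s\<in>insert t S. a s * c s) \<in> K"
        have eq: "(\<Sum>s\<in>insert t S. a s * c s) = a t * \<beta> + (\<Sum>s\<in>S. (a s + a t * b s) * c s)"
          unfolding ins b(3) by (simp add: distrib_left distrib_right sum.distrib sum_distrib_left mult.assoc)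
        have "(\<Sum>s\<in>S. (a s + a t * b s) * c s) = (\<Sum>s\<in>insert t S. a s * c s) - a t * \<beta>"
          using eq by simp
        also have "\<dots> \<in> K" using a b(1) by (intro K_diff K) auto
        finally have "(\<Sum>s\<in>S. (a s + a t * b s) * c s) = (\<Sum>s\<in>S. (a s + a t * b s) * \<mu> s)"
          using a(1) b(2) by (intro \<mu>(2) K) auto
        then show "(\<Sum>s\<in>insert t S. a s * c s) = (\<Sum>s\<in>insert t S. a s * (\<mu>(t := \<nu>)) s)"
          unfolding eq ins upd
          by (simp add: \<nu>_def distrib_left distrib_right sum.distrib sum_distrib_left mult.assoc)
      qed
    next
      case False
      have upd: "(\<Sum>s\<in>S. a s * (\<mu>(t := 0)) s) = (\<Sum>s\<in>S. a s * \<mu> s)" for a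
        using insert.hyps by (intro sum.cong) auto
      show ?thesis
      proof (intro exI[of _ "\<mu>(t := 0)"] conjI allI impI)
        show "\<forall>s\<in>insert t S. (\<mu>(t := 0)) s \<in> K" using \<mu>(1) K by auto
        fix a assume a: "\<forall>s\<in>insert t S. a s \<in> K" "(\<Sum>s\<in>insert t S. a s * c s) \<in> K"
        have "a t = 0"
        proof (rule ccontr)
          assume at: "a t \<noteq> 0"
          define w where "w = (\<Sum>s\<in>insert t S. a s * c s)"
          have "a t * c t = w + (\<Sum>s\<in>S. - a s * c s)" by (simp add: w_def ins sum_negf)
          then have "inverse (a t) * (a t * c t) = inverse (a t) * w + (\<Sum>s\<in>S. (inverse (a t) * - a s) * c s)"
            by (simp add: distrib_left sum_distrib_left mult.assoc)
          then have "c t = inverse (a t) * w + (\<Sum>s\<in>S. (inverse (a t) * - a s) * c s)"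
            using at by (simp add: mult.assoc[symmetric])
          moreover have "inverse (a t) * w \<in> K" using a by (auto simp: w_def intro!: K)
          moreover have "\<forall>s\<in>S. inverse (a t) * - a s \<in> K" using a(1) by (auto intro!: K)
          ultimately have "\<exists>\<beta> b. \<beta> \<in> K \<and> (\<forall>s\<in>S. b s \<in> K) \<and> c t = \<beta> + (\<Sum>s\<in>S. b s * c s)"
            by (intro exI[of _ "inverse (a t) * w"] exI[of _ "\<lambda>s. inverse (a t) * - a s"] conjI)
          with False show False by (rule notE)
        qed
        then show "(\<Sum>s\<in>insert t S. a s * c s) = (\<Sum>s\<in>insert t S. a s * (\<mu>(t := 0)) s)"
          using a \<mu>(2)[of a] unfolding ins upd by simp
      qed
    qed
  qed simp
qed

section \<open>Minimal central left multiples of irreducible elements; coprimality in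
  \<open>F[x]\<close>\<close>

context derivation_ring
begin

lemma left_ideal_principal:
  assumes diff: "\<And>a b. P a \<Longrightarrow> P b \<Longrightarrow> P (a - b)" and left: "\<And>a y. P a \<Longrightarrow> P (y \<star> a)"
    and r: "P r" "r \<noteq> 0"
  obtains u where "P u" "u \<noteq> 0" "\<And>w. P w \<Longrightarrow> \<exists>s. w = s \<star> u"
proof -
  define Q where "Q w \<longleftrightarrow> P w \<and> w \<noteq> 0" for w
  have "Q r" using r by (simp add: Q_def)
  then obtain u where u: "Q u" and min: "\<And>w. Q w \<Longrightarrow> degree u \<le> degree w"
    using ex_has_least_nat[of Q r degree] by blast
  have u0: "P u" "u \<noteq> 0" using u by (auto simp: Q_def)
  have "\<exists>s. w = s \<star> u" if w: "P w" for w
  proof -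
    obtain s t where st: "w = s \<star> u + t" "t = 0 \<or> degree t < degree u"
      using skew_division[OF u0(2)] by blast
    have "t = w - s \<star> u" using st(1) by simp
    then have "P t" using diff[OF w left[OF u0(1)]] by simp
    have "t = 0"
    proof (rule ccontr)
      assume "t \<noteq> 0"
      then have "degree u \<le> degree t" using min \<open>P t\<close> by (simp add: Q_def)
      then show False using st(2) \<open>t \<noteq> 0\<close> by simp
    qed
    then show ?thesis using st(1) by auto
  qed
  then show ?thesis using that u0 by blast
qed

lemma degree_zero_in_Units:
  assumes "f \<noteq> 0" "degree f = 0"
  shows "f \<in> Units (skew_poly_ring \<delta>)"
proof -
  obtain a where a: "f = [:a:]" using assms(2) by (rule degree_eq_zeroE)
  then have "[:inverse a:] \<star> f = [:1:]" "f \<star> [:inverse a:] = [:1:]"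
    using assms(1) by (auto simp: map_poly_pCons)
  then show ?thesis
    by (auto simp: Units_def skew_poly_ring_def intro!: exI[of _ "[:inverse a:]"])
qed

text \<open>If \<open>h = a b\<close> properly, neither \<open>a\<close> nor \<open>b\<close> lies
  in \<open>Rf\<close>, by minimality of \<open>h\<close>. Let \<open>Ra + Rf = Ru\<close> and
  \<open>f = s u\<close>. If \<open>u\<close> is a unit, multiplying \<open>u = s' a + t' f\<close>
  by \<open>b\<close> puts \<open>b\<close> into \<open>Rf\<close>; if \<open>s\<close> is a unit,
  then \<open>a\<close> lies in \<open>Ru = Rf\<close>.\<close>

lemma center_irreducible_of_skew_irreducible:
  assumes irr: "skew_irreducible \<delta> f" and f: "f \<noteq> 0"
    and h: "h \<in> Z" "h \<noteq> 0" "h = q \<star> f"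
    and min: "\<And>k s. k \<in> Z \<Longrightarrow> k \<noteq> 0 \<Longrightarrow> k = s \<star> f \<Longrightarrow> degree h \<le> degree k"
  shows "center_irreducible h"
proof -
  have df: "degree f \<noteq> 0"
    using irr degree_zero_in_Units[OF f] by (auto simp: skew_irreducible_def)
  have q0: "q \<noteq> 0" using h by auto
  have dh: "degree h \<noteq> 0" using df f q0 by (simp add: h(3) degree_skew_mult)
  have "degree a = 0 \<or> degree b = 0" if ab: "a \<in> Z" "b \<in> Z" "h = a \<star> b" for a b
  proof (rule ccontr)
    assume "\<not> (degree a = 0 \<or> degree b = 0)"
    then have dab: "degree a \<noteq> 0" "degree b \<noteq> 0" by auto
    then have ab0: "a \<noteq> 0" "b \<noteq> 0" by auto
    have "degree h = degree a + degree b" using ab(3) ab0 degree_skew_mult by metis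
    then have na: "a \<noteq> s \<star> f" and nb: "b \<noteq> s \<star> f" for s
      using min[OF ab(1) ab0(1), of s] min[OF ab(2) ab0(2), of s] dab by auto
    define P where "P w \<longleftrightarrow> (\<exists>s t. w = s \<star> a + t \<star> f)" for w
    have Pf: "P f" unfolding P_def by (intro exI[of _ 0] exI[of _ "[:1:]"]) simp
    have Pa: "P a" unfolding P_def by (intro exI[of _ "[:1:]"] exI[of _ 0]) simp
    obtain u where u: "P u" "u \<noteq> 0" "\<And>w. P w \<Longrightarrow> \<exists>s. w = s \<star> u"
    proof (rule left_ideal_principal[of P f])
      fix v w assume "P v" "P w"
      then obtain s t s' t' where "v = s \<star> a + t \<star> f" "w = s' \<star> a + t' \<star> f" by (auto simp: P_def)
      then have "v - w = (s - s') \<star> a + (t - t') \<star> f" by (simp add: sk.left_diff_distrib)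
      then show "P (v - w)" unfolding P_def by blast
    next
      fix v y assume "P v"
      then obtain s t where "v = s \<star> a + t \<star> f" by (auto simp: P_def)
      then have "y \<star> v = (y \<star> s) \<star> a + (y \<star> t) \<star> f" by (simp add: sk.distrib_left sk.mult_assoc)
      then show "P (y \<star> v)" unfolding P_def by blast
    qed (use Pf f in auto)
    obtain s where s: "f = s \<star> u" using u(3)[OF Pf] by blast
    have s0: "s \<noteq> 0" using s f by auto
    have ds: "degree f = degree s + degree u" using s degree_skew_mult[OF s0 u(2)] by simp
    have "\<not> (1 \<le> degree s \<and> degree s < degree f \<and> 1 \<le> degree u \<and> degree u < degree f)"
      using irr s unfolding skew_irreducible_def by (auto simp: skew_poly_ring_def)
    then consider "degree u = 0" | "degree s = 0" using ds by linarith
    then show False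
    proof cases
      case 1
      then obtain c where c: "u = [:c:]" by (rule degree_eq_zeroE)
      obtain s' t' where "u = s' \<star> a + t' \<star> f" using u(1) by (auto simp: P_def)
      then have "[:inverse c:] \<star> u \<star> b = [:inverse c:] \<star> (s' \<star> h + t' \<star> (f \<star> b))"
        by (simp only: ab(3) sk.distrib_left sk.distrib_right sk.mult_assoc)
      also have "f \<star> b = b \<star> f" using center_commute[OF ab(2)] by simp
      also have "[:inverse c:] \<star> (s' \<star> h + t' \<star> (b \<star> f)) = ([:inverse c:] \<star> (s' \<star> q + t' \<star> b)) \<star> f"
        by (simp only: h(3) sk.distrib_left sk.distrib_right sk.mult_assoc)
      also have "[:inverse c:] \<star> u = [:1:]" using u(2) c by (simp add: map_poly_pCons)
      finally show False using nb by simp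
    next
      case 2
      then obtain c where c: "s = [:c:]" by (rule degree_eq_zeroE)
      have "[:inverse c:] \<star> f = [:inverse c:] \<star> [:c:] \<star> u" by (simp only: s c sk.mult_assoc)
      also have "[:inverse c:] \<star> [:c:] = [:1:]" using s0 c by (simp add: map_poly_pCons)
      finally have uf: "u = [:inverse c:] \<star> f" by simp
      obtain s' where "a = s' \<star> u" using u(3)[OF Pa] by blast
      then have "a = s' \<star> [:inverse c:] \<star> f" by (simp only: uf sk.mult_assoc)
      then show False using na by blast
    qed
  qed
  then show ?thesis using h dh by (auto simp: center_irreducible_def)
qed

lemma degree_power: "a \<noteq> 0 \<Longrightarrow> sk.power a k \<noteq> 0 \<and> degree (sk.power a k) = k * degree a"
  by (induction k) (auto simp: degree_skew_mult)

text \<open>Being prime, \<open>h\<close> divides \<open>u\<close> or \<open>w\<close>; cancel it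
  there and continue with the next lower power.\<close>

lemma center_irreducible_divides_power:
  assumes h: "center_irreducible h" and "u \<in> Z" "w \<in> Z" "u \<star> w = sk.power h n"
  shows "\<exists>c k. c \<in> Z \<and> degree c = 0 \<and> u = c \<star> sk.power h k"
  using assms(2-4)
proof (induction n arbitrary: u w)
  case 0
  then have nz: "u \<noteq> 0" "w \<noteq> 0" by auto
  have "degree u + degree w = degree [:1 :: 'a:]" using 0 degree_skew_mult[OF nz] by simp
  then show ?case using 0 by (intro exI[of _ u] exI[of _ 0]) auto
next
  case (Suc n)
  have hZ: "h \<in> Z" "h \<noteq> 0" using h by (auto simp: center_irreducible_def)
  have eq: "u \<star> w = sk.power h n \<star> h" using Suc.prems sk.power_commutes[of h n] by simp
  from center_irreducible_prime[OF h Suc.prems(1,2) center_power[OF hZ(1)] eq]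
  show ?case
  proof (elim disjE bexE)
    fix u' assume u': "u' \<in> Z" "u = u' \<star> h"
    have "u' \<star> w \<star> h = sk.power h n \<star> h"
      using eq center_commute[OF hZ(1), of w] by (simp add: u' sk.mult_assoc)
    then have "u' \<star> w = sk.power h n" by (rule skew_mult_cancel_right[OF hZ(2)])
    from Suc.IH[OF u'(1) Suc.prems(2) this] obtain c k where
      ck: "c \<in> Z" "degree c = 0" "u' = c \<star> sk.power h k" by blast
    then have "u = c \<star> sk.power h (Suc k)" using u' sk.power_commutes[of h k] by (simp add: sk.mult_assoc)
    then show ?thesis using ck by blast
  next
    fix w' assume w': "w' \<in> Z" "w = w' \<star> h"
    have "u \<star> w' \<star> h = sk.power h n \<star> h" using eq by (simp add: w' sk.mult_assoc)
    then have "u \<star> w' = sk.power h n" by (rule skew_mult_cancel_right[OF hZ(2)])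
    from Suc.IH[OF Suc.prems(1) w'(1) this] show ?thesis .
  qed
qed

text \<open>Coprimality as a Bezout identity, which passes to products and powers without any
  factorization.\<close>

definition center_coprime :: "'a poly \<Rightarrow> 'a poly \<Rightarrow> bool" where
  "center_coprime a b \<longleftrightarrow> (\<exists>s\<in>Z. \<exists>t\<in>Z. s \<star> a + t \<star> b = [:1:])"

lemma center_coprime_mult:
  assumes "center_coprime a c" "center_coprime b c" "a \<in> Z" "b \<in> Z" "c \<in> Z"
  shows "center_coprime (a \<star> b) c"
proof -
  obtain s t where s: "s \<in> Z" "t \<in> Z" "s \<star> a + t \<star> c = [:1:]" using assms by (auto simp: center_coprime_def)
  obtain s' t' where s': "s' \<in> Z" "t' \<in> Z" "s' \<star> b + t' \<star> c = [:1:]" using assms by (auto simp: center_coprime_def)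
  have "[:1:] = s \<star> a \<star> (s' \<star> b + t' \<star> c) + t \<star> c" using s s' by simp
  also have "\<dots> = (s \<star> s') \<star> (a \<star> b) + (s \<star> a \<star> t' + t) \<star> c"
  proof -
    have "a \<star> (s' \<star> b) = s' \<star> (a \<star> b)" using center_commute[OF s'(1), of a] by (metis sk.mult_assoc)
    then show ?thesis by (simp add: sk.distrib_left sk.distrib_right sk.mult_assoc add.assoc)
  qed
  finally show ?thesis unfolding center_coprime_def using s s' assms
    by (metis center_mult center_add)
qed

lemma center_coprime_commute: "center_coprime a b \<Longrightarrow> center_coprime b a"
  unfolding center_coprime_def by (metis add.commute)

lemma center_coprime_power: "center_coprime a b \<Longrightarrow> a \<in> Z \<Longrightarrow> b \<in> Z \<Longrightarrow> center_coprime (sk.power a k) b"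
proof (induction k)
  case 0
  have "[:1:] \<star> sk.power a 0 + 0 \<star> b = [:1:]" by simp
  then show ?case unfolding center_coprime_def using center_0 center_1 by blast
next
  case (Suc k)
  then show ?case using center_coprime_mult[of a b "sk.power a k"] center_power by simp
qed

end

text \<open>What the norm argument takes from a splitting: \<open>\<psi>\<close> is its restriction
  to \<open>D[t;\<delta>]\<close> and \<open>\<iota>\<close> the scalar by which a central element
  acts. \<open>\<psi>_spanning\<close> says that the image spans all matrices over
  \<open>'l\<close>, and \<open>det_\<psi>\<close> that determinants lie in the copy of
  \<open>F(x)\<close>. That \<open>\<iota>\<close> is additive and multiplicative is read off the
  entry \<open>(0, 0)\<close>, which exists because \<open>n > 0\<close>.\<close>

locale matrix_representation = central_division_derivation \<delta> p e c d0 g x d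
  for \<delta> :: "'a::division_ring \<Rightarrow> 'a" and p e c d0 g x d +
  fixes n :: nat and \<psi> :: "'a poly \<Rightarrow> 'l::field mat" and \<iota> :: "'a poly \<Rightarrow> 'l"
  assumes n_pos: "n > 0"
    and \<psi>_carrier: "\<psi> r \<in> carrier_mat n n"
    and \<psi>_mult: "\<psi> (r \<star> s) = \<psi> r * \<psi> s"
    and \<psi>_add: "\<psi> (r + s) = \<psi> r + \<psi> s"
    and \<psi>_center: "a \<in> Z \<Longrightarrow> \<psi> a = \<iota> a \<cdot>\<^sub>m 1\<^sub>m n"
    and \<iota>_nonzero: "a \<in> Z \<Longrightarrow> a \<noteq> 0 \<Longrightarrow> \<iota> a \<noteq> 0"
    and \<psi>_spanning: "M \<in> carrier_mat n n \<Longrightarrow> \<exists>(k::nat) l r. \<forall>i<n. \<forall>j<n. M $$ (i, j) = (\<Sum>s<k. l s * \<psi> (r s) $$ (i, j))"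
    and det_\<psi>: "\<exists>a\<in>Z. \<exists>b\<in>Z. b \<noteq> 0 \<and> det (\<psi> r) * \<iota> b = \<iota> a"
begin

lemma \<psi>_dims [simp]: "dim_row (\<psi> r) = n" "dim_col (\<psi> r) = n"
  using \<psi>_carrier[of r] by auto

lemma \<psi>_entry_center: "a \<in> Z \<Longrightarrow> i < n \<Longrightarrow> j < n \<Longrightarrow> \<psi> (a \<star> r) $$ (i, j) = \<iota> a * \<psi> r $$ (i, j)"
  using \<psi>_carrier[of r] by (simp add: \<psi>_mult \<psi>_center)

lemma \<iota>_add: "a \<in> Z \<Longrightarrow> b \<in> Z \<Longrightarrow> \<iota> (a + b) = \<iota> a + \<iota> b"
proof -
  assume ab: "a \<in> Z" "b \<in> Z"
  have "\<psi> (a + b) $$ (0, 0) = \<psi> a $$ (0, 0) + \<psi> b $$ (0, 0)" using n_pos by (simp add: \<psi>_add)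
  then show ?thesis using ab n_pos by (simp add: \<psi>_center center_add)
qed

lemma \<iota>_mult: "a \<in> Z \<Longrightarrow> b \<in> Z \<Longrightarrow> \<iota> (a \<star> b) = \<iota> a * \<iota> b"
proof -
  assume ab: "a \<in> Z" "b \<in> Z"
  have "\<psi> (a \<star> b) $$ (0, 0) = \<iota> a * \<psi> b $$ (0, 0)" using n_pos ab by (intro \<psi>_entry_center) auto
  then show ?thesis using ab n_pos by (simp add: \<psi>_center center_mult)
qed

lemma \<iota>_0 [simp]: "\<iota> 0 = 0"
proof -
  have "\<iota> 0 + \<iota> 0 = \<iota> 0 + 0" using \<iota>_add[of 0 0] by simp
  then show ?thesis by (rule add_left_imp_eq)
qed

lemma \<iota>_1 [simp]: "\<iota> [:1:] = 1"
  using \<iota>_mult[of "[:1:]" "[:1:]"] \<iota>_nonzero[of "[:1:]"] by simp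

lemma \<iota>_inj: "a \<in> Z \<Longrightarrow> b \<in> Z \<Longrightarrow> \<iota> a = \<iota> b \<Longrightarrow> a = b"
proof (rule ccontr)
  assume ab: "a \<in> Z" "b \<in> Z" "\<iota> a = \<iota> b" "a \<noteq> b"
  have "\<iota> (a - b) + \<iota> b = \<iota> (a - b + b)" using ab by (intro \<iota>_add[symmetric] center_diff)
  then have "\<iota> (a - b) = 0" using ab by simp
  then show False using \<iota>_nonzero[of "a - b"] ab by (auto intro: center_diff)
qed

lemma \<iota>_sum: "(\<And>s. s \<in> S \<Longrightarrow> f s \<in> Z) \<Longrightarrow> \<iota> (sum f S) = (\<Sum>s\<in>S. \<iota> (f s))"
  by (induction S rule: infinite_finite_induct) (auto simp: \<iota>_add center_sum)

lemma \<iota>_power: "a \<in> Z \<Longrightarrow> \<iota> (sk.power a k) = \<iota> a ^ k"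
  by (induction k) (auto simp: \<iota>_mult center_power)

lemma \<psi>_entry_sum:
  assumes "finite K" "\<And>k. k \<in> K \<Longrightarrow> a k \<in> Z" "i < n" "j < n"
  shows "\<psi> (\<Sum>k\<in>K. a k \<star> E k) $$ (i, j) = (\<Sum>k\<in>K. \<iota> (a k) * \<psi> (E k) $$ (i, j))"
  using assms(1,2)
proof (induction K rule: finite_induct)
  case empty
  then show ?case using \<psi>_center[of 0] assms(3,4) by simp
next
  case (insert l K)
  then show ?case using assms(3,4) by (simp add: \<psi>_add \<psi>_entry_center)
qed

text \<open>The images of at most \<open>(d p^e)^2\<close> generators span the \<open>n\<close> by
  \<open>n\<close> matrices over \<open>'l\<close>, a space of dimension \<open>n^2\<close>.\<close>

lemma degree_representation_le: "n \<le> d * p ^ e"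
proof -
  obtain K :: "((nat \<times> nat) \<times> nat) set" and E where K: "finite K" "card K \<le> (d * p ^ e)\<^sup>2"
    "\<And>y. \<exists>q. (\<forall>k\<in>K. q k \<in> Z \<and> degree (q k) \<le> degree y) \<and> y = (\<Sum>k\<in>K. q k \<star> E k)"
    by (rule skew_poly_spanning) blast
  have spanE: "\<exists>l. \<forall>i<n. \<forall>j<n. M $$ (i, j) = (\<Sum>k\<in>K. l k * \<psi> (E k) $$ (i, j))"
    if M: "M \<in> carrier_mat n n" for M
  proof -
    obtain t :: nat and l r where t: "\<And>i j. i < n \<Longrightarrow> j < n \<Longrightarrow> M $$ (i, j) = (\<Sum>s<t. l s * \<psi> (r s) $$ (i, j))"
      using \<psi>_spanning[OF M] by auto
    have "\<forall>s. \<exists>q. (\<forall>k\<in>K. q k \<in> Z) \<and> r s = (\<Sum>k\<in>K. q k \<star> E k)" using K(3) by metis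
    then obtain q where q: "\<And>s. (\<forall>k\<in>K. q s k \<in> Z) \<and> r s = (\<Sum>k\<in>K. q s k \<star> E k)" by metis
    have "M $$ (i, j) = (\<Sum>k\<in>K. (\<Sum>s<t. l s * \<iota> (q s k)) * \<psi> (E k) $$ (i, j))" if ij: "i < n" "j < n" for i j
    proof -
      have "\<psi> (r s) $$ (i, j) = (\<Sum>k\<in>K. \<iota> (q s k) * \<psi> (E k) $$ (i, j))" for s
        using q[of s] \<psi>_entry_sum[OF K(1) _ ij, of "q s" E] by simp
      then have "M $$ (i, j) = (\<Sum>s<t. \<Sum>k\<in>K. l s * \<iota> (q s k) * \<psi> (E k) $$ (i, j))"
        by (simp add: t[OF ij] sum_distrib_left mult.assoc)
      also have "\<dots> = (\<Sum>k\<in>K. (\<Sum>s<t. l s * \<iota> (q s k)) * \<psi> (E k) $$ (i, j))"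
        by (subst sum.swap) (simp add: sum_distrib_right)
      finally show ?thesis .
    qed
    then show ?thesis by (intro exI[of _ "\<lambda>k. \<Sum>s<t. l s * \<iota> (q s k)"]) simp
  qed
  define U where "U kl = mat n n (\<lambda>ij. if ij = kl then 1 else (0::'l))" for kl
  have "\<forall>kl. \<exists>l. \<forall>i<n. \<forall>j<n. U kl $$ (i, j) = (\<Sum>k\<in>K. l k * \<psi> (E k) $$ (i, j))"
    by (intro allI spanE) (simp add: U_def)
  then obtain A where A: "\<And>kl i j. i < n \<Longrightarrow> j < n \<Longrightarrow> U kl $$ (i, j) = (\<Sum>k\<in>K. A kl k * \<psi> (E k) $$ (i, j))"
    by metis
  have "n\<^sup>2 \<le> card K"
  proof (rule ccontr)
    assume "\<not> n\<^sup>2 \<le> card K"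
    then have less: "card K < card ({..<n} \<times> {..<n})" by (simp add: card_cartesian_product power2_eq_square)
    \<comment> \<open>Too few generators would force a linear relation \<open>C\<close> among the
      matrix units \<open>U kl\<close>; reading its entries shows that \<open>C\<close> is
      zero.\<close>
    obtain C where C: "\<exists>kl\<in>{..<n} \<times> {..<n}. C kl \<noteq> 0"
      "\<And>k. k \<in> K \<Longrightarrow> (\<Sum>kl\<in>{..<n} \<times> {..<n}. C kl * A kl k) = 0"
    proof (rule homogeneous_system_nontrivial[where F = UNIV and I = "{..<n} \<times> {..<n}" and J = K and A = A])
    qed (use less K(1) in auto)
    have "C (i, j) = 0" if ij: "i < n" "j < n" for i j
    proof -
      have "(\<Sum>kl\<in>{..<n} \<times> {..<n}. C kl * U kl $$ (i, j)) = (\<Sum>kl\<in>{..<n} \<times> {..<n}. if kl = (i, j) then C kl else 0)"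
        using ij by (intro sum.cong) (auto simp: U_def)
      then have "C (i, j) = (\<Sum>kl\<in>{..<n} \<times> {..<n}. C kl * U kl $$ (i, j))" using ij by simp
      also have "\<dots> = (\<Sum>k\<in>K. (\<Sum>kl\<in>{..<n} \<times> {..<n}. C kl * A kl k) * \<psi> (E k) $$ (i, j))"
        by (simp add: A[OF ij] sum_distrib_left sum_distrib_right mult.assoc) (rule sum.swap)
      also have "\<dots> = 0" by (intro sum.neutral ballI) (simp add: C(2))
      finally show ?thesis .
    qed
    then show False using C(1) by auto
  qed
  then have "n\<^sup>2 \<le> (d * p ^ e)\<^sup>2" using K(2) by (rule order_trans)
  then show ?thesis by (simp only: power2_nat_le_eq_le)
qed

lemma prod_center:
  assumes "\<And>i. i < k \<Longrightarrow> a i \<in> Z \<and> degree (a i) \<le> D"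
  shows "\<exists>P\<in>Z. \<iota> P = (\<Prod>i = 0..<k. \<iota> (a i)) \<and> degree P \<le> k * D"
  using assms
proof (induction k)
  case 0
  then show ?case by (intro bexI[of _ "[:1:]"]) auto
next
  case (Suc k)
  then obtain P where P: "P \<in> Z" "\<iota> P = (\<Prod>i = 0..<k. \<iota> (a i))" "degree P \<le> k * D" by auto
  have a: "a k \<in> Z" "degree (a k) \<le> D" using Suc.prems[of k] by auto
  have "degree (P \<star> a k) \<le> Suc k * D" using degree_skew_mult_le[of P "a k"] P(3) a(2) by simp
  then show ?case using P a by (intro bexI[of _ "P \<star> a k"]) (auto simp: \<iota>_mult center_mult)
qed

text \<open>The copy of \<open>F(x)\<close> inside \<open>'l\<close>, target of the
  retraction.\<close>

definition fractions :: "'l set" where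
  "fractions = {y. \<exists>a\<in>Z. \<exists>b\<in>Z. b \<noteq> 0 \<and> y * \<iota> b = \<iota> a}"

lemma fractionsI: "a \<in> Z \<Longrightarrow> b \<in> Z \<Longrightarrow> b \<noteq> 0 \<Longrightarrow> y * \<iota> b = \<iota> a \<Longrightarrow> y \<in> fractions"
  by (auto simp: fractions_def)

lemma fractions_closed:
  assumes "y \<in> fractions" "z \<in> fractions"
  shows "y + z \<in> fractions" "y * z \<in> fractions" "- y \<in> fractions" "inverse y \<in> fractions" 
proof -
  obtain a b where ab: "a \<in> Z" "b \<in> Z" "b \<noteq> 0" "y * \<iota> b = \<iota> a" using assms(1) by (auto simp: fractions_def)
  obtain a' b' where ab': "a' \<in> Z" "b' \<in> Z" "b' \<noteq> 0" "z * \<iota> b' = \<iota> a'" using assms(2) by (auto simp: fractions_def)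
  have bb: "b \<star> b' \<in> Z" "b \<star> b' \<noteq> 0" using ab ab' center_mult by auto
  show "y + z \<in> fractions"
  proof (rule fractionsI[OF _ bb])
    show "a \<star> b' + a' \<star> b \<in> Z" using ab ab' by (intro center_add center_mult)
    show "(y + z) * \<iota> (b \<star> b') = \<iota> (a \<star> b' + a' \<star> b)"
      using ab ab' by (simp add: \<iota>_add \<iota>_mult center_mult ab(4)[symmetric] ab'(4)[symmetric] algebra_simps)
  qed
  show "y * z \<in> fractions"
    by (rule fractionsI[OF center_mult[OF ab(1) ab'(1)] bb])
      (use ab ab' in \<open>simp add: \<iota>_mult ab(4)[symmetric] ab'(4)[symmetric] mult_ac\<close>)
  have "\<iota> (- a) + \<iota> a = \<iota> (- a + a)" using ab by (intro \<iota>_add[symmetric] center_minus)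
  then have "\<iota> (- a) = - \<iota> a" by (simp add: eq_neg_iff_add_eq_0)
  then show "- y \<in> fractions" using ab by (intro fractionsI[of "- a" b]) (auto intro: center_minus)
  show "inverse y \<in> fractions"
  proof (cases "y = 0")
    case True
    then show ?thesis using assms by simp
  next
    case False
    then have "\<iota> a \<noteq> 0" using ab(4) \<iota>_nonzero[OF ab(2,3)] by (metis mult_eq_0_iff)
    then have "a \<noteq> 0" by auto
    moreover have "inverse y * \<iota> a = \<iota> b" using False by (simp add: ab(4)[symmetric])
    ultimately show ?thesis using ab by (intro fractionsI[of b a])
  qed
qed

lemma \<iota>_fractions: "a \<in> Z \<Longrightarrow> \<iota> a \<in> fractions"
  by (rule fractionsI[of a "[:1:]"]) auto

lemma common_denominator:
  assumes "finite S" "\<And>s. s \<in> S \<Longrightarrow> \<mu> s \<in> fractions"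
  shows "\<exists>q b. q \<in> Z \<and> q \<noteq> 0 \<and> (\<forall>s\<in>S. b s \<in> Z \<and> \<iota> q * \<mu> s = \<iota> (b s))"
  using assms
proof (induction S rule: finite_induct)
  case empty
  show ?case by (intro exI[of _ "[:1:]"]) auto
next
  case (insert t S)
  then obtain q b where qb: "q \<in> Z" "q \<noteq> 0" "\<And>s. s \<in> S \<Longrightarrow> b s \<in> Z \<and> \<iota> q * \<mu> s = \<iota> (b s)" by auto
  obtain a' b' where ab: "a' \<in> Z" "b' \<in> Z" "b' \<noteq> 0" "\<mu> t * \<iota> b' = \<iota> a'"
    using insert.prems[of t] unfolding fractions_def by blast
  have "\<forall>s\<in>insert t S. (if s = t then a' \<star> q else b' \<star> b s) \<in> Z \<and>
      \<iota> (q \<star> b') * \<mu> s = \<iota> (if s = t then a' \<star> q else b' \<star> b s)"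
    using qb ab by (auto simp: \<iota>_mult center_mult ab(4)[symmetric] mult_ac)
  then show ?case using qb ab
    by (intro exI[of _ "q \<star> b'"] exI[of _ "\<lambda>s. if s = t then a' \<star> q else b' \<star> b s"]) (auto simp: center_mult)
qed

text \<open>The coefficients \<open>c s\<close> of the determinant form do not depend on
  \<open>r\<close>. The retraction replaces them by fractions \<open>\<mu> s\<close>;
  \<open>q\<close> is a common denominator of these finitely many fractions, and \<open>B\<close>
  bounds the degrees of the numerators.\<close>

lemma det_bounded_denominator:
  "\<exists>q B. q \<in> Z \<and> q \<noteq> 0 \<and> (\<forall>r. \<exists>P\<in>Z. \<iota> q * det (\<psi> r) = \<iota> P \<and> degree P \<le> n * degree r + B)"
proof -
  obtain K :: "((nat \<times> nat) \<times> nat) set" and E where K: "finite K"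
    "\<And>y. \<exists>q. (\<forall>k\<in>K. q k \<in> Z \<and> degree (q k) \<le> degree y) \<and> y = (\<Sum>k\<in>K. q k \<star> E k)"
    by (rule skew_poly_spanning) blast
  define S where "S = PiE {0..<n} (\<lambda>_. K)"
  define c where "c g = (\<Sum>\<pi> | \<pi> permutes {0..<n}. signof \<pi> * (\<Prod>i = 0..<n. \<psi> (E (g i)) $$ (i, \<pi> i)))" for g
  have finS: "finite S" unfolding S_def using K(1) by (intro finite_PiE) auto
  have "\<exists>\<mu>. (\<forall>s\<in>S. \<mu> s \<in> fractions) \<and>
    (\<forall>a. (\<forall>s\<in>S. a s \<in> fractions) \<longrightarrow> (\<Sum>s\<in>S. a s * c s) \<in> fractions \<longrightarrow> (\<Sum>s\<in>S. a s * c s) = (\<Sum>s\<in>S. a s * \<mu> s))"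
    by (rule subfield_retraction) (use finS fractions_closed \<iota>_fractions[of 0] in auto)
  then obtain \<mu> where \<mu>: "\<And>s. s \<in> S \<Longrightarrow> \<mu> s \<in> fractions"
    "\<And>a. (\<forall>s\<in>S. a s \<in> fractions) \<Longrightarrow> (\<Sum>s\<in>S. a s * c s) \<in> fractions \<Longrightarrow> (\<Sum>s\<in>S. a s * c s) = (\<Sum>s\<in>S. a s * \<mu> s)"
    by blast
  obtain q b where qb: "q \<in> Z" "q \<noteq> 0" "\<And>s. s \<in> S \<Longrightarrow> b s \<in> Z \<and> \<iota> q * \<mu> s = \<iota> (b s)"
    using common_denominator[OF finS, of \<mu>] \<mu>(1) by blast
  define B where "B = (\<Sum>s\<in>S. degree (b s))"
  have "\<exists>P\<in>Z. \<iota> q * det (\<psi> r) = \<iota> P \<and> degree P \<le> n * degree r + B" for r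
  proof -
    obtain a where a0: "(\<forall>k\<in>K. a k \<in> Z \<and> degree (a k) \<le> degree r) \<and> r = (\<Sum>k\<in>K. a k \<star> E k)"
      using K(2)[of r] by (rule exE)
    note a = bspec[OF conjunct1[OF a0]] conjunct2[OF a0]
    have entry: "\<psi> r $$ (i, j) = (\<Sum>k\<in>K. \<iota> (a k) * \<psi> (E k) $$ (i, j))" if "i < n" "j < n" for i j
      by (subst a(2)) (intro \<psi>_entry_sum K(1) that conjunct1[OF a(1)])
    have "\<forall>s. \<exists>P. s \<in> S \<longrightarrow> P \<in> Z \<and> \<iota> P = (\<Prod>i = 0..<n. \<iota> (a (s i))) \<and> degree P \<le> n * degree r"
    proof
      fix s
      show "\<exists>P. s \<in> S \<longrightarrow> P \<in> Z \<and> \<iota> P = (\<Prod>i = 0..<n. \<iota> (a (s i))) \<and> degree P \<le> n * degree r"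
      proof (cases "s \<in> S")
        case True
        have "\<exists>P\<in>Z. \<iota> P = (\<Prod>i = 0..<n. \<iota> (a (s i))) \<and> degree P \<le> n * degree r"
          by (rule prod_center, rule a(1)) (use True in \<open>auto simp: S_def\<close>)
        then show ?thesis by blast
      qed simp
    qed
    then obtain P where P: "\<And>s. s \<in> S \<Longrightarrow> P s \<in> Z \<and> \<iota> (P s) = (\<Prod>i = 0..<n. \<iota> (a (s i))) \<and> degree (P s) \<le> n * degree r"
      by metis
    have det_eq: "det (\<psi> r) = (\<Sum>s\<in>S. \<iota> (P s) * c s)"
    proof -
      have "det (\<psi> r) = (\<Sum>s\<in>S. (\<Prod>i = 0..<n. \<iota> (a (s i))) * c s)"
        unfolding S_def c_def
        by (rule det_sum_expansion[where a = "\<lambda>k. \<iota> (a k)" and A = "\<lambda>k. \<psi> (E k)", OF \<psi>_carrier K(1) entry])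
      then show ?thesis using P by simp
    qed
    \<comment> \<open>The retraction preserves only sums that lie in \<open>fractions\<close>; this
      is where \<open>det_\<psi>\<close> enters.\<close>
    have "det (\<psi> r) \<in> fractions" using det_\<psi>[of r] by (auto simp: fractions_def)
    moreover have "\<forall>s\<in>S. \<iota> (P s) \<in> fractions" using P \<iota>_fractions by blast
    ultimately have "det (\<psi> r) = (\<Sum>s\<in>S. \<iota> (P s) * \<mu> s)"
      unfolding det_eq by (intro \<mu>(2))
    then have "\<iota> q * det (\<psi> r) = (\<Sum>s\<in>S. \<iota> (P s) * (\<iota> q * \<mu> s))"
      by (simp add: sum_distrib_left mult.left_commute)
    also have "\<dots> = (\<Sum>s\<in>S. \<iota> (P s \<star> b s))"
      by (intro sum.cong refl) (metis P qb(3) \<iota>_mult)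
    also have "\<dots> = \<iota> (\<Sum>s\<in>S. P s \<star> b s)"
      using P qb by (intro \<iota>_sum[symmetric] center_mult) auto
    finally have "\<iota> q * det (\<psi> r) = \<iota> (\<Sum>s\<in>S. P s \<star> b s)" .
    moreover have "(\<Sum>s\<in>S. P s \<star> b s) \<in> Z" using P qb by (intro center_sum center_mult) auto
    moreover have "degree (\<Sum>s\<in>S. P s \<star> b s) \<le> n * degree r + B"
    proof (rule degree_sum_le[OF finS])
      fix s assume s: "s \<in> S"
      have "degree (b s) \<le> B" unfolding B_def using s finS by (intro member_le_sum) auto
      then show "degree (P s \<star> b s) \<le> n * degree r + B"
        using degree_skew_mult_le[of "P s" "b s"] P[OF s] by linarith
    qed
    ultimately show ?thesis by blast
  qed
  then show ?thesis using qb by blast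
qed

lemma \<psi>_1: "\<psi> [:1:] = 1\<^sub>m n"
  by (rule eq_matI) (auto simp: \<psi>_center)

lemma det_\<psi>_mult: "det (\<psi> (r \<star> s)) = det (\<psi> r) * det (\<psi> s)"
  by (simp add: \<psi>_mult det_mult[OF \<psi>_carrier \<psi>_carrier])

lemma det_\<psi>_power: "det (\<psi> (sk.power r k)) = det (\<psi> r) ^ k"
  by (induction k) (auto simp: \<psi>_1 det_\<psi>_mult)

text \<open>
  The powers of \<open>det (\<psi> r)\<close> have a common denominator, so \<open>det (\<psi> r)\<close> is a polynomial, and their
  degrees grow linearly, which bounds its degree.
\<close>

lemma reduced_norm_polynomial:
  "\<exists>u\<in>Z. \<iota> u = det (\<psi> r) \<and> degree u \<le> n * degree r"
proof -
  obtain q B where q: "q \<in> Z" "q \<noteq> 0"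
    "\<And>r. \<exists>P\<in>Z. \<iota> q * det (\<psi> r) = \<iota> P \<and> degree P \<le> n * degree r + B"
    using det_bounded_denominator by blast
  obtain a b where ab: "a \<in> Z" "b \<in> Z" "b \<noteq> 0" "det (\<psi> r) * \<iota> b = \<iota> a" using det_\<psi> by blast
  obtain v s t a' b' where v: "v \<in> Z" "v \<noteq> 0" "s \<in> Z" "t \<in> Z" "v = s \<star> a + t \<star> b"
    "a' \<in> Z" "a = a' \<star> v" "b' \<in> Z" "b = b' \<star> v"
    by (rule center_gcd[OF ab(1,2) disjI2[OF ab(3)]])
  \<comment> \<open>Reduce the fraction for the determinant to lowest terms \<open>a'/b'\<close>; it
    remains to show that \<open>b'\<close> is a unit.\<close>
  have "(s \<star> a' + t \<star> b') \<star> v = s \<star> a + t \<star> b"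
    by (simp only: v(7,9) sk.distrib_right sk.mult_assoc)
  then have "(s \<star> a' + t \<star> b') \<star> v = [:1:] \<star> v" using v(5) by simp
  then have "s \<star> a' + t \<star> b' = [:1:]" by (rule skew_mult_cancel_right[OF v(2)])
  then have cop: "center_coprime a' b'" unfolding center_coprime_def using v(3,4) by blast
  have b'0: "b' \<noteq> 0" using v(9) ab(3) by auto
  have "det (\<psi> r) * \<iota> b' * \<iota> v = \<iota> a' * \<iota> v"
    using ab(4) v(1,6,8) by (simp only: v(7,9) \<iota>_mult mult.assoc)
  then have det': "det (\<psi> r) * \<iota> b' = \<iota> a'" using \<iota>_nonzero[OF v(1,2)] by simp
  have "degree b' = 0"
  proof (rule ccontr)
    assume "degree b' \<noteq> 0"
    \<comment> \<open>From \<open>q a'^k = P b'^k\<close> and coprimality, \<open>b'^k\<close>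
      divides \<open>q\<close>. This exponent makes its degree exceed
      \<open>degree q\<close>.\<close>
    define k where "k = Suc (degree q)"
    let ?ak = "sk.power a' k" and ?bk = "sk.power b' k"
    obtain P where P: "P \<in> Z" "\<iota> q * det (\<psi> (sk.power r k)) = \<iota> P" using q(3) by blast
    have kZ: "?ak \<in> Z" "?bk \<in> Z" using v(6,8) center_power by auto
    have "\<iota> (q \<star> ?ak) = \<iota> (P \<star> ?bk)"
      using q(1) P v(6,8) kZ
      by (simp add: \<iota>_mult \<iota>_power det_\<psi>_power det'[symmetric] power_mult_distrib P(2)[symmetric] mult.assoc)
    then have eq: "q \<star> ?ak = P \<star> ?bk" using q(1) P(1) kZ by (intro \<iota>_inj center_mult)
    have "center_coprime ?ak ?bk"
      using center_coprime_power[OF center_coprime_commute[OF center_coprime_power[OF cop v(6,8), of k]] v(8) kZ(1), of k]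
      by (rule center_coprime_commute)
    then obtain s t where st: "s \<in> Z" "t \<in> Z" "s \<star> ?ak + t \<star> ?bk = [:1:]" by (auto simp: center_coprime_def)
    have "q = q \<star> (s \<star> ?ak + t \<star> ?bk)" using st(3) by simp
    also have "\<dots> = s \<star> (q \<star> ?ak) + q \<star> t \<star> ?bk"
      using center_commute[OF q(1), of s] by (simp add: sk.distrib_left sk.mult_assoc[symmetric])
    also have "\<dots> = (s \<star> P + q \<star> t) \<star> ?bk" by (simp add: eq sk.distrib_right sk.mult_assoc)
    finally have qeq: "q = (s \<star> P + q \<star> t) \<star> ?bk" .
    then have "s \<star> P + q \<star> t \<noteq> 0" using q(2) by auto
    then have "degree q = degree (s \<star> P + q \<star> t) + k * degree b'"
      using qeq degree_skew_mult degree_power[OF b'0, of k] by metis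
    moreover have "k * 1 \<le> k * degree b'" using \<open>degree b' \<noteq> 0\<close> by (intro mult_le_mono2) simp
    ultimately show False by (simp add: k_def)
  qed
  then obtain w where w: "w \<in> Z" "w \<star> b' = [:1:]" using center_unit[OF v(8) b'0] by blast
  define u where "u = a' \<star> w"
  have uZ: "u \<in> Z" unfolding u_def by (intro center_mult v w)
  have "\<iota> w * \<iota> b' = 1" using \<iota>_mult[OF w(1) v(8)] w(2) by simp
  then have u: "\<iota> u = det (\<psi> r)"
    using v(6) w(1) by (simp add: u_def \<iota>_mult det'[symmetric] mult.assoc) (simp add: mult.commute)
  have "degree u \<le> n * degree r"
  proof (cases "u = 0 \<or> r = 0")
    case True
    show ?thesis
    proof (cases "u = 0")
      case False
      then have "r = 0" using True by simp
      then have "det (\<psi> r) = 0" using n_pos \<psi>_center[of 0] by (simp add: det_smult)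
      then show ?thesis using u \<iota>_nonzero[OF uZ False] by simp
    qed simp
  next
    case False
    show ?thesis
    proof (rule ccontr)
      assume "\<not> degree u \<le> n * degree r"
      then have less: "n * degree r + 1 \<le> degree u" by simp
      \<comment> \<open>A surplus of at least 1 in the degree of \<open>u\<close> grows to at least
        \<open>k\<close> in its power, beyond the constant error \<open>B\<close>.\<close>
      define k where "k = Suc B"
      obtain P where P: "P \<in> Z" "\<iota> q * det (\<psi> (sk.power r k)) = \<iota> P" "degree P \<le> n * degree (sk.power r k) + B"
        using q(3) by blast
      have "\<iota> (q \<star> sk.power u k) = \<iota> P"
        using P(2) q(1) uZ by (simp add: \<iota>_mult \<iota>_power center_power det_\<psi>_power u)
      then have eq: "q \<star> sk.power u k = P" using q(1) P(1) uZ by (intro \<iota>_inj center_mult center_power)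
      have "degree P = degree q + k * degree u"
        using degree_power[of u k] q(2) False by (simp add: eq[symmetric] degree_skew_mult)
      moreover have "degree (sk.power r k) = k * degree r" using degree_power[of r k] False by simp
      ultimately have "k * degree u \<le> k * (n * degree r) + B" using P(3) by (simp add: mult_ac)
      moreover have "k * (n * degree r + 1) \<le> k * degree u" using less by (rule mult_le_mono2)
      ultimately show False by (simp add: k_def)
    qed
  qed
  then show ?thesis using uZ u by blast
qed

theorem reduced_norm_irreducible:
  assumes h: "center_irreducible h" "h = q \<star> f" and deg: "degree h = p ^ e * (d * degree f)"
  shows "\<exists>u\<in>Z. \<iota> u = det (\<psi> f) \<and> center_irreducible u"
proof -
  have h0: "h \<in> Z" "h \<noteq> 0" "degree h \<noteq> 0" using h(1) by (auto simp: center_irreducible_def)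
  have nz: "q \<noteq> 0" "f \<noteq> 0" using h0 h(2) by auto
  obtain u where u: "u \<in> Z" "\<iota> u = det (\<psi> f)" "degree u \<le> n * degree f"
    using reduced_norm_polynomial by blast
  obtain w where w: "w \<in> Z" "\<iota> w = det (\<psi> q)" "degree w \<le> n * degree q"
    using reduced_norm_polynomial by blast
  have "\<iota> (u \<star> w) = det (\<psi> h)" using u w by (simp add: \<iota>_mult h(2) det_\<psi>_mult mult.commute)
  also have "\<dots> = \<iota> h ^ n" using h0(1) by (simp add: \<psi>_center det_smult)
  also have "\<dots> = \<iota> (sk.power h n)" using h0(1) by (simp add: \<iota>_power)
  finally have uw: "u \<star> w = sk.power h n"
    using u(1) w(1) h0(1) by (intro \<iota>_inj center_mult center_power)
  have "u \<star> w \<noteq> 0" using degree_power[OF h0(2), of n] uw by simp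
  then have uw0: "u \<noteq> 0" "w \<noteq> 0" by auto
  have "degree u + degree w = n * degree h"
    using degree_power[OF h0(2), of n] uw degree_skew_mult[OF uw0] by simp
  also have "\<dots> = n * degree q + n * degree f" by (simp add: h(2) degree_skew_mult nz distrib_left)
  finally have du: "degree u = n * degree f" using u(3) w(3) by simp
  obtain c k where ck: "c \<in> Z" "degree c = 0" "u = c \<star> sk.power h k"
    using center_irreducible_divides_power[OF h(1) u(1) w(1) uw] by blast
  have c0: "c \<noteq> 0" using ck uw0 by auto
  have "degree u = k * degree h" using degree_power[OF h0(2), of k] ck c0 by (simp add: degree_skew_mult)
  moreover have "(k * (d * p ^ e)) * degree f = k * degree h" unfolding deg by (simp only: mult_ac)
  ultimately have eq: "(k * (d * p ^ e)) * degree f = n * degree f" using du by simp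
  have df: "degree f \<noteq> 0" and dp: "d * p ^ e \<noteq> 0" using deg h0(3) by auto
  \<comment> \<open>Comparison of \<open>degree u = n * degree f\<close> with
    \<open>degree u = k * degree h\<close>. Together with \<open>0 < n \<le> d * p ^ e\<close> it
    leaves only \<open>k = 1\<close>.\<close>
  have "k * (d * p ^ e) = n" using eq df by (metis mult_cancel2)
  then have "k * (d * p ^ e) \<le> 1 * (d * p ^ e)" using degree_representation_le by simp
  then have "k \<le> 1" using dp by (metis mult_le_cancel2 neq0_conv)
  moreover have "k \<noteq> 0" using \<open>k * (d * p ^ e) = n\<close> n_pos by auto
  ultimately have "k = 1" by simp
  then have uch: "u = c \<star> h" using ck(3) by simp
  obtain v where v: "v \<in> Z" "v \<star> c = [:1:]" using center_unit[OF ck(1) c0 ck(2)] by blast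
  have v0: "v \<noteq> 0" using v(2) by auto
  have "center_irreducible u" unfolding center_irreducible_def
  proof (intro conjI ballI impI u(1))
    show "degree u \<noteq> 0" using degree_skew_mult[OF c0 h0(2)] h0(3) unfolding uch by linarith
    fix a b assume ab: "a \<in> Z" "b \<in> Z" "u = a \<star> b"
    have "v \<star> u = v \<star> c \<star> h" by (simp only: uch sk.mult_assoc)
    then have "v \<star> u = h" using v(2) by simp
    then have "h = (v \<star> a) \<star> b" by (simp add: ab(3) sk.mult_assoc)
    then have "degree (v \<star> a) = 0 \<or> degree b = 0"
      by (intro center_irreducibleD[OF h(1) center_mult[OF v(1) ab(1)] ab(2)])
    moreover have "a \<noteq> 0" using ab(3) uw0 by auto
    ultimately show "degree a = 0 \<or> degree b = 0" using v0 by (auto simp: degree_skew_mult)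
  qed
  then show ?thesis using u by blast
qed

end

section \<open>The ring of central quotients\<close>

text \<open>The operations on quotients are unions over all representatives; once the result is
  independent of the representatives, the union collapses to one class.\<close>

lemma UN_UN_const:
  "(\<And>u v. u \<in> A \<Longrightarrow> v \<in> B \<Longrightarrow> F u v = C) \<Longrightarrow> A \<noteq> {} \<Longrightarrow> B \<noteq> {} \<Longrightarrow> (\<Union>u\<in>A. \<Union>v\<in>B. F u v) = C"
  by auto

lemma scalar_mat_mult: "V \<in> carrier_mat n m \<Longrightarrow> (k \<cdot>\<^sub>m 1\<^sub>m n) * V = k \<cdot>\<^sub>m (V :: 'l::comm_ring_1 mat)"
  by (simp add: mult_smult_assoc_mat[of _ n n _ m])

context derivation_ring
begin

abbreviation frac :: "'a poly \<Rightarrow> 'a poly \<Rightarrow> ('a poly \<times> 'a poly) set" where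
  "frac f q \<equiv> central_frac (skew_poly_ring \<delta>) Z f q"

abbreviation quot_ring :: "('a poly \<times> 'a poly) set ring" where
  "quot_ring \<equiv> central_quotients (skew_poly_ring \<delta>) Z"

lemma mem_frac: "(f', q') \<in> frac f q \<longleftrightarrow> q' \<in> Z \<and> q' \<noteq> 0 \<and> f \<star> q' = f' \<star> q"
  by (simp add: central_frac_def skew_poly_ring_simps)

text \<open>Cross multiplication is transitive because denominators are central and can be
  cancelled.\<close>

lemma frac_eqI:
  assumes "q \<in> Z" "q \<noteq> 0" "q' \<in> Z" "q' \<noteq> 0" "f \<star> q' = f' \<star> q"
  shows "frac f q = frac f' q'"
proof -
  have "f2 \<star> b = a \<star> q2" if q: "q1 \<in> Z" "q1 \<noteq> 0" "q2 \<in> Z" "f1 \<star> q2 = f2 \<star> q1" and ab: "b \<in> Z" "f1 \<star> b = a \<star> q1"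
    for f1 f2 q1 q2 a b
  proof (rule skew_mult_cancel_right[OF q(2)])
    have "f2 \<star> b \<star> q1 = f2 \<star> q1 \<star> b" using center_commute[OF ab(1), of q1] by (simp only: sk.mult_assoc)
    also have "\<dots> = f1 \<star> q2 \<star> b" by (simp only: q(4))
    also have "\<dots> = f1 \<star> b \<star> q2" using center_commute[OF ab(1), of q2] by (simp only: sk.mult_assoc)
    also have "\<dots> = a \<star> q1 \<star> q2" by (simp only: ab(2))
    also have "\<dots> = a \<star> q2 \<star> q1" using center_commute[OF q(1), of q2] by (simp only: sk.mult_assoc)
    finally show "f2 \<star> b \<star> q1 = a \<star> q2 \<star> q1" .
  qed
  from this[OF assms(1,2,3,5)] this[OF assms(3,4,1) assms(5)[symmetric]]
  show ?thesis by (auto simp: mem_frac set_eq_iff)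
qed

lemma frac_eqD: "q \<in> Z \<Longrightarrow> q \<noteq> 0 \<Longrightarrow> frac f q = frac f' q' \<Longrightarrow> f' \<star> q = f \<star> q'"
  using mem_frac[of f q f' q'] mem_frac[of f q f q] by simp

lemma carrier_quot_ring: "U \<in> carrier quot_ring \<longleftrightarrow> (\<exists>f q. U = frac f q \<and> q \<in> Z \<and> q \<noteq> 0)"
  by (auto simp: central_quotients_def skew_poly_ring_simps)

lemma frac_in_carrier: "q \<in> Z \<Longrightarrow> q \<noteq> 0 \<Longrightarrow> frac f q \<in> carrier quot_ring"
  unfolding carrier_quot_ring by blast

lemma frac_expand: "q \<in> Z \<Longrightarrow> q \<noteq> 0 \<Longrightarrow> s \<in> Z \<Longrightarrow> s \<noteq> 0 \<Longrightarrow> frac (f \<star> s) (q \<star> s) = frac f q"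
  using center_commute[of s q] by (intro frac_eqI center_mult) (auto simp: sk.mult_assoc)

lemma quot_ring_mult:
  assumes q: "q \<in> Z" "q \<noteq> 0" "q' \<in> Z" "q' \<noteq> 0"
  shows "frac f q \<otimes>\<^bsub>quot_ring\<^esub> frac f' q' = frac (f \<star> f') (q \<star> q')"
proof -
  have "frac (a \<star> a') (b \<star> b') = frac (f \<star> f') (q \<star> q')"
    if "(a, b) \<in> frac f q" "(a', b') \<in> frac f' q'" for a b a' b'
  proof -
    have b: "b \<in> Z" "b \<noteq> 0" "f \<star> b = a \<star> q" "b' \<in> Z" "b' \<noteq> 0" "f' \<star> b' = a' \<star> q'"
      using that by (auto simp: mem_frac)
    show ?thesis
    proof (rule frac_eqI)
      have "a \<star> a' \<star> (q \<star> q') = a \<star> (a' \<star> q) \<star> q'" by (simp only: sk.mult_assoc)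
      also have "\<dots> = a \<star> q \<star> (a' \<star> q')"
        by (simp only: center_commute[OF q(1), of a', symmetric] sk.mult_assoc)
      also have "\<dots> = f \<star> (b \<star> f') \<star> b'" by (simp only: b(3,6)[symmetric] sk.mult_assoc)
      also have "\<dots> = f \<star> f' \<star> (b \<star> b')" by (simp only: center_commute[OF b(1), of f'] sk.mult_assoc)
      finally show "a \<star> a' \<star> (q \<star> q') = f \<star> f' \<star> (b \<star> b')" .
    qed (use b q center_mult in auto)
  qed
  moreover have "frac f q \<noteq> {}" "frac f' q' \<noteq> {}"
    using q mem_frac[of f q f q] mem_frac[of f' q' f' q'] by auto
  ultimately have "(\<Union>u\<in>frac f q. \<Union>v\<in>frac f' q'. frac (fst u \<star> fst v) (snd u \<star> snd v)) = frac (f \<star> f') (q \<star> q')"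
    by (intro UN_UN_const) (metis prod.collapse)
  then show ?thesis by (simp add: central_quotients_def skew_poly_ring_simps)
qed

text \<open>Equal denominators suffice, since finitely many quotients can be brought over a common
  central denominator; the ring laws then reduce to those of the numerators.\<close>

lemma quot_ring_add:
  assumes q: "q \<in> Z" "q \<noteq> 0"
  shows "frac f q \<oplus>\<^bsub>quot_ring\<^esub> frac f' q = frac (f + f') q"
proof -
  have "frac (a \<star> b' + a' \<star> b) (b \<star> b') = frac (f + f') q"
    if "(a, b) \<in> frac f q" "(a', b') \<in> frac f' q" for a b a' b'
  proof -
    have b: "b \<in> Z" "b \<noteq> 0" "f \<star> b = a \<star> q" "b' \<in> Z" "b' \<noteq> 0" "f' \<star> b' = a' \<star> q"
      using that by (auto simp: mem_frac)
    show ?thesis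
    proof (rule frac_eqI)
      have "a \<star> b' \<star> q = a \<star> q \<star> b'" using center_commute[OF q(1), of b'] by (simp add: sk.mult_assoc)
      also have "\<dots> = f \<star> (b \<star> b')" by (simp only: b(3)[symmetric] sk.mult_assoc)
      finally have 1: "a \<star> b' \<star> q = f \<star> (b \<star> b')" .
      have "a' \<star> b \<star> q = a' \<star> q \<star> b" using center_commute[OF q(1), of b] by (simp add: sk.mult_assoc)
      also have "\<dots> = f' \<star> (b \<star> b')"
        using center_commute[OF b(1), of b'] by (simp only: b(6)[symmetric] sk.mult_assoc)
      finally have "a' \<star> b \<star> q = f' \<star> (b \<star> b')" .
      with 1 show "(a \<star> b' + a' \<star> b) \<star> q = (f + f') \<star> (b \<star> b')" by (simp only: sk.distrib_right)
    qed (use b q center_mult in auto)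
  qed
  moreover have "frac f q \<noteq> {}" "frac f' q \<noteq> {}"
    using q mem_frac[of f q f q] mem_frac[of f' q f' q] by auto
  ultimately have "(\<Union>u\<in>frac f q. \<Union>v\<in>frac f' q. frac (fst u \<star> snd v + fst v \<star> snd u) (snd u \<star> snd v)) = frac (f + f') q"
    by (intro UN_UN_const) (metis prod.collapse)
  then show ?thesis by (simp add: central_quotients_def skew_poly_ring_simps)
qed

lemma quot_ring_one: "\<one>\<^bsub>quot_ring\<^esub> = frac [:1:] [:1:]"
  by (simp add: central_quotients_def skew_poly_ring_simps)

lemma quot_ring_zero: "\<zero>\<^bsub>quot_ring\<^esub> = frac 0 [:1:]"
  by (simp add: central_quotients_def skew_poly_ring_simps)

lemma frac_zero: "q \<in> Z \<Longrightarrow> q \<noteq> 0 \<Longrightarrow> frac 0 q = \<zero>\<^bsub>quot_ring\<^esub>"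
  unfolding quot_ring_zero by (rule frac_eqI) auto

lemma common_denominator2:
  assumes "U \<in> carrier quot_ring" "Y \<in> carrier quot_ring"
  obtains a b q where "q \<in> Z" "q \<noteq> 0" "U = frac a q" "Y = frac b q"
proof -
  obtain a q b r where q: "q \<in> Z" "q \<noteq> 0" "U = frac a q" and r: "r \<in> Z" "r \<noteq> 0" "Y = frac b r"
    using assms unfolding carrier_quot_ring by blast
  have "U = frac (a \<star> r) (q \<star> r)" using frac_expand[of q r a] q r by simp
  moreover have "Y = frac (b \<star> q) (q \<star> r)"
    using frac_expand[of r q b] q r center_commute[OF q(1), of r] by simp
  ultimately show ?thesis using that[of "q \<star> r"] q r center_mult by auto
qed

lemma common_denominator3:
  assumes "U \<in> carrier quot_ring" "Y \<in> carrier quot_ring" "W \<in> carrier quot_ring"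
  obtains a b c q where "q \<in> Z" "q \<noteq> 0" "U = frac a q" "Y = frac b q" "W = frac c q"
proof -
  obtain a b q where q: "q \<in> Z" "q \<noteq> 0" "U = frac a q" "Y = frac b q"
    by (rule common_denominator2[OF assms(1,2)])
  obtain c r where r: "r \<in> Z" "r \<noteq> 0" "W = frac c r"
    using assms(3) unfolding carrier_quot_ring by blast
  have "U = frac (a \<star> r) (q \<star> r)" "Y = frac (b \<star> r) (q \<star> r)"
    using frac_expand[of q r] q r by simp_all
  moreover have "W = frac (c \<star> q) (q \<star> r)"
    using frac_expand[of r q c] q r center_commute[OF q(1), of r] by simp
  ultimately show ?thesis using that[of "q \<star> r"] q r center_mult by auto
qed

lemma ring_quot_ring: "ring quot_ring"
proof (rule ringI)
  have one: "[:1:] \<in> Z" "[:1:] \<noteq> (0 :: 'a poly)" by auto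
  show "abelian_group quot_ring"
  proof (rule abelian_groupI)
    fix U Y W assume U: "U \<in> carrier quot_ring" and Y: "Y \<in> carrier quot_ring"
    show "U \<oplus>\<^bsub>quot_ring\<^esub> Y \<in> carrier quot_ring" "U \<oplus>\<^bsub>quot_ring\<^esub> Y = Y \<oplus>\<^bsub>quot_ring\<^esub> U"
      by (rule common_denominator2[OF U Y]; simp add: quot_ring_add frac_in_carrier add.commute)+
    assume W: "W \<in> carrier quot_ring"
    show "U \<oplus>\<^bsub>quot_ring\<^esub> Y \<oplus>\<^bsub>quot_ring\<^esub> W = U \<oplus>\<^bsub>quot_ring\<^esub> (Y \<oplus>\<^bsub>quot_ring\<^esub> W)"
      by (rule common_denominator3[OF U Y W]) (simp add: quot_ring_add add.assoc)
  next
    fix U assume U: "U \<in> carrier quot_ring"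
    then obtain a q where q: "q \<in> Z" "q \<noteq> 0" "U = frac a q" unfolding carrier_quot_ring by blast
    show "\<zero>\<^bsub>quot_ring\<^esub> \<oplus>\<^bsub>quot_ring\<^esub> U = U"
      using quot_ring_add[OF q(1,2), of 0 a] frac_zero[OF q(1,2)] q(3) by simp
    show "\<exists>Y\<in>carrier quot_ring. Y \<oplus>\<^bsub>quot_ring\<^esub> U = \<zero>\<^bsub>quot_ring\<^esub>"
      using quot_ring_add[OF q(1,2), of "- a" a] frac_zero[OF q(1,2)] q(3) frac_in_carrier[OF q(1,2)] by auto
  qed (use one in \<open>simp add: quot_ring_zero frac_in_carrier\<close>)
  show "monoid quot_ring"
  proof (rule monoidI)
    fix U Y W assume U: "U \<in> carrier quot_ring" and Y: "Y \<in> carrier quot_ring"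
    show "U \<otimes>\<^bsub>quot_ring\<^esub> Y \<in> carrier quot_ring"
      by (rule common_denominator2[OF U Y]) (simp add: quot_ring_mult frac_in_carrier center_mult)
    assume W: "W \<in> carrier quot_ring"
    show "U \<otimes>\<^bsub>quot_ring\<^esub> Y \<otimes>\<^bsub>quot_ring\<^esub> W = U \<otimes>\<^bsub>quot_ring\<^esub> (Y \<otimes>\<^bsub>quot_ring\<^esub> W)"
      by (rule common_denominator3[OF U Y W]) (simp add: quot_ring_mult center_mult sk.mult_assoc)
  next
    fix U assume U: "U \<in> carrier quot_ring"
    then obtain a q where q: "q \<in> Z" "q \<noteq> 0" "U = frac a q" unfolding carrier_quot_ring by blast
    show "\<one>\<^bsub>quot_ring\<^esub> \<otimes>\<^bsub>quot_ring\<^esub> U = U"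
      using quot_ring_mult[OF one q(1,2), of "[:1:]" a] q(3) by (simp add: quot_ring_one)
    show "U \<otimes>\<^bsub>quot_ring\<^esub> \<one>\<^bsub>quot_ring\<^esub> = U"
      using quot_ring_mult[OF q(1,2) one, of a "[:1:]"] q(3) by (simp add: quot_ring_one)
  qed (use one in \<open>simp add: quot_ring_one frac_in_carrier\<close>)
next
  fix U Y W assume U: "U \<in> carrier quot_ring" and Y: "Y \<in> carrier quot_ring" and W: "W \<in> carrier quot_ring"
  show "(U \<oplus>\<^bsub>quot_ring\<^esub> Y) \<otimes>\<^bsub>quot_ring\<^esub> W = U \<otimes>\<^bsub>quot_ring\<^esub> W \<oplus>\<^bsub>quot_ring\<^esub> Y \<otimes>\<^bsub>quot_ring\<^esub> W"
    by (rule common_denominator3[OF U Y W])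
      (simp add: quot_ring_mult quot_ring_add center_mult sk.distrib_right)
  show "W \<otimes>\<^bsub>quot_ring\<^esub> (U \<oplus>\<^bsub>quot_ring\<^esub> Y) = W \<otimes>\<^bsub>quot_ring\<^esub> U \<oplus>\<^bsub>quot_ring\<^esub> W \<otimes>\<^bsub>quot_ring\<^esub> Y"
    by (rule common_denominator3[OF U Y W])
      (simp add: quot_ring_mult quot_ring_add center_mult sk.distrib_left)
qed

lemma mem_quotients_of_center:
  "U \<in> quotients_of_center (skew_poly_ring \<delta>) Z \<longleftrightarrow> (\<exists>a q. U = frac a q \<and> a \<in> Z \<and> q \<in> Z \<and> q \<noteq> 0)"
  by (auto simp: quotients_of_center_def skew_poly_ring_simps)

end

text \<open>The span is built by successive line extensions with scalar matrices as coefficients;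
  reading entries turns it into an ordinary linear combination over \<open>'l\<close>.\<close>

lemma mat_Span_entries:
  fixes Vs :: "'l::field mat list"
  assumes "set Vs \<subseteq> carrier_mat n n" "U \<in> ring.Span (ring_mat TYPE('l) n ()) {c \<cdot>\<^sub>m 1\<^sub>m n | c. True} Vs"
  shows "U \<in> carrier_mat n n \<and> (\<exists>c. \<forall>i<n. \<forall>j<n. U $$ (i, j) = (\<Sum>s<length Vs. c s * (Vs ! s) $$ (i, j)))"
proof -
  let ?M = "ring_mat TYPE('l) n ()"
  interpret M: ring ?M by (rule ring_mat)
  show ?thesis using assms
  proof (induction Vs arbitrary: U)
    case Nil
    then show ?case by (auto simp: ring_mat_simps)
  next
    case (Cons V Vs)
    then obtain k Y where kY: "Y \<in> M.Span {c \<cdot>\<^sub>m 1\<^sub>m n | c. True} Vs" "U = (k \<cdot>\<^sub>m 1\<^sub>m n) * V + Y"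
      by (auto simp: M.line_extension_def set_add_def set_mult_def r_coset_def ring_mat_simps)
    then obtain c where c: "Y \<in> carrier_mat n n" "\<And>i j. i < n \<Longrightarrow> j < n \<Longrightarrow> Y $$ (i, j) = (\<Sum>s<length Vs. c s * (Vs ! s) $$ (i, j))"
      using Cons.IH[of Y] Cons.prems by auto
    have V: "V \<in> carrier_mat n n" using Cons.prems by auto
    have "U = k \<cdot>\<^sub>m V + Y" using kY(2) scalar_mat_mult[OF V] by simp
    moreover have entries: "\<forall>i<n. \<forall>j<n. (k \<cdot>\<^sub>m V + Y) $$ (i, j)
        = (\<Sum>s<length (V # Vs). (case s of 0 \<Rightarrow> k | Suc t \<Rightarrow> c t) * ((V # Vs) ! s) $$ (i, j))"
      using V c by (simp add: sum.lessThan_Suc_shift del: sum.lessThan_Suc)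
    moreover have "k \<cdot>\<^sub>m V + Y \<in> carrier_mat n n" using c(1) V by auto
    ultimately show ?case
      by (intro conjI exI[of _ "\<lambda>s. case s of 0 \<Rightarrow> k | Suc t \<Rightarrow> c t"]) simp_all
  qed
qed

context central_division_derivation
begin

text \<open>Restriction of the splitting along \<open>r \<mapsto> r/1\<close>. The hypothesis
  \<open>norm\<close> is what makes determinants fractions of central elements.\<close>

lemma matrix_representation_of_splitting:
  fixes \<kappa> :: "('a poly \<times> 'a poly) set \<Rightarrow> 'l::field"
  assumes split: "splitting quot_ring (quotients_of_center (skew_poly_ring \<delta>) Z) n \<kappa> \<phi>"
    and norm: "\<And>U. U \<in> carrier quot_ring \<Longrightarrow>
      N U \<in> quotients_of_center (skew_poly_ring \<delta>) Z \<and> \<kappa> (N U) = det (\<phi> U)"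
  shows "matrix_representation \<delta> p e c d0 g x d n (\<lambda>r. \<phi> (frac r [:1:])) (\<lambda>a. \<kappa> (frac a [:1:]))"
    and "a \<in> Z \<Longrightarrow> b \<in> Z \<Longrightarrow> b \<noteq> 0 \<Longrightarrow> \<kappa> (frac a b) * \<kappa> (frac b [:1:]) = \<kappa> (frac a [:1:])"
proof -
  let ?M = "ring_mat TYPE('l) n ()" and ?S = "{c \<cdot>\<^sub>m 1\<^sub>m n | c. True} :: 'l mat set"
    and ?K = "quotients_of_center (skew_poly_ring \<delta>) Z"
  interpret A: ring quot_ring by (rule ring_quot_ring)
  interpret M: ring ?M by (rule ring_mat)
  have one: "[:1:] \<in> Z" "[:1:] \<noteq> (0 :: 'a poly)" by auto
  obtain Us where hom: "\<phi> \<in> Ring.ring_hom quot_ring ?M"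
    and \<phi>K: "\<And>k. k \<in> ?K \<Longrightarrow> \<phi> k = \<kappa> k \<cdot>\<^sub>m 1\<^sub>m n"
    and Us: "A.independent ?K Us" "A.Span ?K Us = carrier quot_ring"
      "M.independent ?S (map \<phi> Us)" "M.Span ?S (map \<phi> Us) = carrier ?M"
    using split unfolding splitting_def Let_def by blast
  have \<phi>c: "\<phi> U \<in> carrier_mat n n" if "U \<in> carrier quot_ring" for U
    using ring_hom_closed[OF hom that] by (simp add: ring_mat_simps)
  have \<phi>m: "\<phi> (U \<otimes>\<^bsub>quot_ring\<^esub> Y) = \<phi> U * \<phi> Y" if "U \<in> carrier quot_ring" "Y \<in> carrier quot_ring" for U Y
    using ring_hom_mult[OF hom that] by (simp add: ring_mat_simps)
  have \<phi>a: "\<phi> (U \<oplus>\<^bsub>quot_ring\<^esub> Y) = \<phi> U + \<phi> Y" if "U \<in> carrier quot_ring" "Y \<in> carrier quot_ring" for U Y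
    using ring_hom_add[OF hom that] by (simp add: ring_mat_simps)
  have \<phi>1: "\<phi> (frac [:1:] [:1:]) = 1\<^sub>m n"
    using ring_hom_one[OF hom] by (simp add: ring_mat_simps quot_ring_one)
  have UsA: "set Us \<subseteq> carrier quot_ring" by (rule A.independent_in_carrier[OF Us(1)])
  \<comment> \<open>All 0 by 0 matrices are zero, so no nonempty family of them is independent,
    whereas \<open>Us\<close> is nonempty because \<open>1/1\<close> and \<open>0/1\<close>
    differ.\<close>
  have n: "n > 0"
  proof (rule ccontr)
    assume "\<not> n > 0"
    then have n0: "n = 0" by simp
    have zero: "0\<^sub>m n n \<in> M.Span ?S Vs" if "set Vs \<subseteq> carrier_mat n n" for Vs
      using that
    proof (induction Vs)
      case (Cons V Vs)
      then have V: "V \<in> carrier_mat n n" and IH: "0\<^sub>m n n \<in> M.Span ?S Vs" by auto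
      have "0\<^sub>m n n = (0 \<cdot>\<^sub>m 1\<^sub>m n) * V + 0\<^sub>m n n" using V by (auto simp: n0)
      moreover have "0 \<cdot>\<^sub>m 1\<^sub>m n \<in> ?S" by blast
      ultimately show ?case using IH
        unfolding M.Span.simps foldr.simps o_apply M.line_extension_def set_add_def set_mult_def r_coset_def
        by (auto simp: ring_mat_simps)
    qed (simp add: ring_mat_simps)
    have "Us \<noteq> []"
    proof
      assume "Us = []"
      then have "carrier quot_ring = {frac 0 [:1:]}" using Us(2) by (simp add: quot_ring_zero)
      then have "frac [:1:] [:1:] \<in> {frac 0 [:1:]}"
        using frac_in_carrier[OF one, of "[:1:]"] by (simp only:)
      then have "frac [:1:] [:1:] = frac 0 [:1:]" by (rule singletonD)
      then show False using frac_eqD[OF one, of "[:1:]" 0 "[:1:]"] by simp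
    qed
    then obtain u us where u: "Us = u # us" by (cases Us) auto
    have "\<phi> u \<in> carrier_mat n n" using \<phi>c UsA u by auto
    then have "\<phi> u = 0\<^sub>m n n" by (auto simp: n0)
    moreover have "0\<^sub>m n n \<in> M.Span ?S (map \<phi> us)" using \<phi>c UsA u by (intro zero) auto
    moreover have "\<phi> u \<notin> M.Span ?S (map \<phi> us)"
      using M.independent_backwards(1)[of ?S "\<phi> u" "map \<phi> us"] Us(3) u by simp
    ultimately show False by simp
  qed
  \<comment> \<open>A splitting fixes \<open>\<kappa>\<close> only through the scalar matrices
    \<open>\<phi> k\<close>, so multiplicativity comes from the entry \<open>(0, 0)\<close>.\<close>
  show K_mult: "\<kappa> (frac a b) * \<kappa> (frac b [:1:]) = \<kappa> (frac a [:1:])" if "a \<in> Z" "b \<in> Z" "b \<noteq> 0" for a b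
  proof -
    have "frac a b \<otimes>\<^bsub>quot_ring\<^esub> frac b [:1:] = frac a [:1:]"
      using that one center_commute[OF that(2)] by (simp add: quot_ring_mult) (intro frac_eqI, auto)
    then have "\<phi> (frac a [:1:]) = \<phi> (frac a b) * \<phi> (frac b [:1:])"
      using \<phi>m[of "frac a b" "frac b [:1:]"] that one frac_in_carrier by simp
    moreover have "frac a [:1:] \<in> ?K" "frac a b \<in> ?K" "frac b [:1:] \<in> ?K"
      using that one by (auto simp only: mem_quotients_of_center)
    ultimately have "\<kappa> (frac a [:1:]) \<cdot>\<^sub>m 1\<^sub>m n = (\<kappa> (frac a b) \<cdot>\<^sub>m 1\<^sub>m n) * (\<kappa> (frac b [:1:]) \<cdot>\<^sub>m 1\<^sub>m n :: 'l mat)"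
      by (simp only: \<phi>K)
    then have "(\<kappa> (frac a [:1:]) \<cdot>\<^sub>m 1\<^sub>m n) $$ (0, 0) = ((\<kappa> (frac a b) \<cdot>\<^sub>m 1\<^sub>m n) * (\<kappa> (frac b [:1:]) \<cdot>\<^sub>m 1\<^sub>m n :: 'l mat)) $$ (0, 0)"
      by simp
    then show ?thesis using n by simp
  qed
  show "matrix_representation \<delta> p e c d0 g x d n (\<lambda>r. \<phi> (frac r [:1:])) (\<lambda>a. \<kappa> (frac a [:1:]))"
  proof unfold_locales
    show "n > 0" by (rule n)
    fix r s
    show "\<phi> (frac r [:1:]) \<in> carrier_mat n n" by (intro \<phi>c frac_in_carrier one)
    show "\<phi> (frac (r \<star> s) [:1:]) = \<phi> (frac r [:1:]) * \<phi> (frac s [:1:])"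
      using \<phi>m[of "frac r [:1:]" "frac s [:1:]"] one by (simp add: quot_ring_mult frac_in_carrier)
    show "\<phi> (frac (r + s) [:1:]) = \<phi> (frac r [:1:]) + \<phi> (frac s [:1:])"
      using \<phi>a[of "frac r [:1:]" "frac s [:1:]"] one by (simp add: quot_ring_add frac_in_carrier)
    have "N (frac r [:1:]) \<in> ?K" "\<kappa> (N (frac r [:1:])) = det (\<phi> (frac r [:1:]))"
      using norm[OF frac_in_carrier[OF one]] by auto
    then show "\<exists>a\<in>Z. \<exists>b\<in>Z. b \<noteq> 0 \<and> det (\<phi> (frac r [:1:])) * \<kappa> (frac b [:1:]) = \<kappa> (frac a [:1:])"
      unfolding mem_quotients_of_center using K_mult by metis
  next
    fix a assume a: "a \<in> Z"
    show "\<phi> (frac a [:1:]) = \<kappa> (frac a [:1:]) \<cdot>\<^sub>m 1\<^sub>m n"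
      using a one by (intro \<phi>K) (auto simp only: mem_quotients_of_center)
    assume a0: "a \<noteq> 0"
    show "\<kappa> (frac a [:1:]) \<noteq> 0"
    proof
      assume "\<kappa> (frac a [:1:]) = 0"
      moreover have "\<kappa> (frac [:1:] a) * \<kappa> (frac a [:1:]) = \<kappa> (frac [:1:] [:1:])"
        using K_mult[OF one(1) a a0] .
      moreover have "frac [:1:] [:1:] \<in> ?K" using one by (auto simp only: mem_quotients_of_center)
      ultimately have "1\<^sub>m n = (0::'l) \<cdot>\<^sub>m 1\<^sub>m n" using \<phi>1 \<phi>K by simp
      then have "(1\<^sub>m n :: 'l mat) $$ (0, 0) = ((0::'l) \<cdot>\<^sub>m 1\<^sub>m n) $$ (0, 0)" by simp
      then show False using n by simp
    qed
  next
    fix U :: "'l mat" assume "U \<in> carrier_mat n n"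
    then have "U \<in> M.Span ?S (map \<phi> Us)" using Us(4) by (simp add: ring_mat_simps)
    moreover have "set (map \<phi> Us) \<subseteq> carrier_mat n n" using \<phi>c UsA by auto
    ultimately have "\<exists>l. \<forall>i<n. \<forall>j<n. U $$ (i, j) = (\<Sum>s<length (map \<phi> Us). l s * (map \<phi> Us ! s) $$ (i, j))"
      by (intro conjunct2[OF mat_Span_entries])
    then obtain l where
      l: "\<forall>i<n. \<forall>j<n. U $$ (i, j) = (\<Sum>s<length (map \<phi> Us). l s * (map \<phi> Us ! s) $$ (i, j))"
      by (rule exE)
    \<comment> \<open>Each basis element \<open>r/q\<close> is \<open>r/1\<close> times the central
      quotient \<open>1/q\<close>, whose scalar can be absorbed into the coefficients.\<close>
    have "\<forall>s. \<exists>l' r. s < length Us \<longrightarrow> (\<forall>i<n. \<forall>j<n. \<phi> (Us ! s) $$ (i, j) = l' * \<phi> (frac r [:1:]) $$ (i, j))"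
    proof
      fix s
      show "\<exists>l' r. s < length Us \<longrightarrow> (\<forall>i<n. \<forall>j<n. \<phi> (Us ! s) $$ (i, j) = l' * \<phi> (frac r [:1:]) $$ (i, j))"
      proof (cases "s < length Us")
        case True
        then obtain r q where rq: "Us ! s = frac r q" "q \<in> Z" "q \<noteq> 0"
          using subsetD[OF UsA nth_mem[OF True]] unfolding carrier_quot_ring by blast
        have "frac [:1:] q \<otimes>\<^bsub>quot_ring\<^esub> frac r [:1:] = frac r q"
          using rq one by (simp add: quot_ring_mult)
        then have "\<phi> (frac r q) = \<phi> (frac [:1:] q) * \<phi> (frac r [:1:])"
          using \<phi>m[of "frac [:1:] q" "frac r [:1:]"] rq one frac_in_carrier by simp
        also have "\<phi> (frac [:1:] q) = \<kappa> (frac [:1:] q) \<cdot>\<^sub>m 1\<^sub>m n"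
          using rq one by (intro \<phi>K) (auto simp only: mem_quotients_of_center)
        finally have "\<phi> (frac r q) = \<kappa> (frac [:1:] q) \<cdot>\<^sub>m \<phi> (frac r [:1:])"
          by (simp only: scalar_mat_mult[OF \<phi>c[OF frac_in_carrier[OF one, of r]]])
        then have "\<forall>i<n. \<forall>j<n. \<phi> (Us ! s) $$ (i, j) = \<kappa> (frac [:1:] q) * \<phi> (frac r [:1:]) $$ (i, j)"
          using \<phi>c[OF frac_in_carrier[OF one, of r]] rq(1) by auto
        then show ?thesis by (intro exI impI)
      qed simp
    qed
    then obtain l' r where lr: "\<And>s i j. s < length Us \<Longrightarrow> i < n \<Longrightarrow> j < n \<Longrightarrow> \<phi> (Us ! s) $$ (i, j) = l' s * \<phi> (frac (r s) [:1:]) $$ (i, j)"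
      by metis
    have "\<forall>i<n. \<forall>j<n. U $$ (i, j) = (\<Sum>s<length Us. l s * l' s * \<phi> (frac (r s) [:1:]) $$ (i, j))"
      using l lr by (auto simp: mult.assoc)
    then show "\<exists>(k::nat) l r. \<forall>i<n. \<forall>j<n. U $$ (i, j) = (\<Sum>s<k. l s * \<phi> (frac (r s) [:1:]) $$ (i, j))"
      by (intro exI[of _ "length Us"] exI[of _ "\<lambda>s. l s * l' s"] exI[of _ r])
  qed
qed

end

theorem theorem29:
  fixes \<delta> :: "'a::division_ring \<Rightarrow> 'a"
    and p d e m :: nat
    and c :: "nat \<Rightarrow> 'a"
    and d0 :: 'a
    and g x f h hhat :: "'a poly"
    and R :: "'a poly ring"
    and Fx :: "'a poly set"
  assumes "prime p" and "CHAR('a) = p"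
    and "central_division_algebra_degree TYPE('a) d"
    and "derivation \<delta>"
    and g: "g = (\<Sum>i\<le>e. monom (c i) (p ^ (e - i)))"
    and "c 0 = 1" and "\<And>i. i \<le> e \<Longrightarrow> c i \<in> const_field \<delta>"
    and "min_poly_der \<delta> g"
    and "\<And>z. poly_in_der g \<delta> z = d0 * z - z * d0" and "\<delta> d0 = 0"
    and R: "R = skew_poly_ring \<delta>"
    and x: "x = g - [:d0:]"
    and Fx: "Fx = central_polys \<delta> x"
    and "f \<noteq> 0" and "degree f = m"
    and "min_central_left_multiple \<delta> f h"
    and "h = skew_eval \<delta> x hhat"
    and "hhat \<in> polys_over (const_field \<delta>)" and "lead_coeff hhat = 1"
    and "degree hhat = d * m"
  shows "(ring_irreducible\<^bsub>R\<lparr>carrier := Fx\<rparr>\<^esub> h \<longrightarrow> skew_irreducible \<delta> f) \<and>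
         (\<forall>N. is_reduced_norm TYPE('l::field) (central_quotients R Fx) (quotients_of_center R Fx) N
            \<longrightarrow> skew_irreducible \<delta> f
            \<longrightarrow> (\<exists>u \<in> Fx. N (central_frac R Fx f \<one>\<^bsub>R\<^esub>) = central_frac R Fx u \<one>\<^bsub>R\<^esub> \<and>
                     ring_irreducible\<^bsub>R\<lparr>carrier := Fx\<rparr>\<^esub> u))"
proof -
  interpret central_division_derivation \<delta> p e c d0 g x d
    by (intro central_division_derivation.intro center_algebraic_derivation.intro derivation_ring.intro
        center_algebraic_derivation_axioms.intro central_division_derivation_axioms.intro; rule assms)
  have FxZ: "Fx = Z" using center_eq_central_polys Fx by simp
  have h0: "h \<in> Z" "h \<noteq> 0" "\<exists>q. h = q \<star> f"
    and min: "\<And>k q. k \<in> Z \<Longrightarrow> k \<noteq> 0 \<Longrightarrow> k = q \<star> f \<Longrightarrow> degree h \<le> degree k"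
    using \<open>min_central_left_multiple \<delta> f h\<close>
    unfolding min_central_left_multiple_def Let_def skew_poly_ring_simps by blast+
  then obtain q where q: "h = q \<star> f" by blast
  have "hhat \<noteq> 0" using \<open>lead_coeff hhat = 1\<close> by auto
  then have deg: "degree h = p ^ e * (d * degree f)"
    using degree_skew_eval[of hhat] \<open>h = skew_eval \<delta> x hhat\<close> \<open>degree hhat = d * m\<close> \<open>degree f = m\<close> by simp
  have "skew_irreducible \<delta> f" if "ring_irreducible\<^bsub>R\<lparr>carrier := Fx\<rparr>\<^esub> h"
    using that ring_irreducible_iff[OF h0(1)] skew_irreducible_of_center_irreducible[OF _ q deg]
    by (simp add: R FxZ)
  moreover have "\<exists>u\<in>Fx. N (central_frac R Fx f \<one>\<^bsub>R\<^esub>) = central_frac R Fx u \<one>\<^bsub>R\<^esub> \<and>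
      ring_irreducible\<^bsub>R\<lparr>carrier := Fx\<rparr>\<^esub> u"
    if N: "is_reduced_norm TYPE('l) (central_quotients R Fx) (quotients_of_center R Fx) N"
      and irr: "skew_irreducible \<delta> f" for N
  proof -
    obtain n and \<kappa> :: "('a poly \<times> 'a poly) set \<Rightarrow> 'l" and \<phi> where
      split: "splitting quot_ring (quotients_of_center (skew_poly_ring \<delta>) Z) n \<kappa> \<phi>"
      and norm: "\<And>U. U \<in> carrier quot_ring \<Longrightarrow>
        N U \<in> quotients_of_center (skew_poly_ring \<delta>) Z \<and> \<kappa> (N U) = det (\<phi> U)"
      using N unfolding is_reduced_norm_def R FxZ by blast
    have K_mult: "\<kappa> (frac a b) * \<kappa> (frac b [:1:]) = \<kappa> (frac a [:1:])" if "a \<in> Z" "b \<in> Z" "b \<noteq> 0" for a b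
      by (rule matrix_representation_of_splitting(2)[OF split _ that]) (rule norm)
    interpret rep: matrix_representation \<delta> p e c d0 g x d n "\<lambda>r. \<phi> (frac r [:1:])" "\<lambda>a. \<kappa> (frac a [:1:])"
      by (rule matrix_representation_of_splitting(1)[OF split norm])
    have "center_irreducible h"
      by (rule center_irreducible_of_skew_irreducible[OF irr \<open>f \<noteq> 0\<close> h0(1,2) q min])
    from rep.reduced_norm_irreducible[OF this q deg] obtain u where
      u: "u \<in> Z" "\<kappa> (frac u [:1:]) = det (\<phi> (frac f [:1:]))" "center_irreducible u" by blast
    have fA: "frac f [:1:] \<in> carrier quot_ring" by (rule frac_in_carrier) auto
    obtain a b where ab: "N (frac f [:1:]) = frac a b" "a \<in> Z" "b \<in> Z" "b \<noteq> 0"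
      using norm[OF fA] unfolding mem_quotients_of_center by blast
    \<comment> \<open>The norm of \<open>f\<close> is known as some fraction \<open>a/b\<close> with
      the same image in \<open>'l\<close> as \<open>u\<close>; injectivity on the center yields
      \<open>a = u b\<close>.\<close>
    have "\<kappa> (frac (u \<star> b) [:1:]) = \<kappa> (frac a [:1:])"
      using norm[OF fA] K_mult[OF ab(2-4)] rep.\<iota>_mult[OF u(1) ab(3)] u(2) ab(1) by simp
    then have "u \<star> b = a" by (intro rep.\<iota>_inj center_mult u ab)
    then have "frac a b = frac u [:1:]" using ab by (intro frac_eqI) auto
    moreover have "ring_irreducible\<^bsub>(skew_poly_ring \<delta>)\<lparr>carrier := Z\<rparr>\<^esub> u"
      using ring_irreducible_iff u by blast
    ultimately show ?thesis using u(1) ab(1)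
      unfolding FxZ R skew_poly_ring_simps by (intro bexI[of _ u]) simp_all
  qed
  ultimately show ?thesis by blast
qed

end
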